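(* Let $\alpha=(\alpha_1,\ldots,\alpha_m)$ be an $m$-part composition of $n$, let $\pi\in S_n$ have cycle type $\alpha$, let $g\ge 0$ and let $\beta=(\beta_2,\beta_3,\ldots)$ be a finitely supported sequence of nonnegative integers. Inequivalent genus $g$ factorizations of $\pi$ with signature $\beta$ are in one-to-one correspondence with acyclic alternating maps of genus $g$ with $m$ labelled faces in which (a) every vertex is a source, a sink, or has even total degree $\ge 4$; (b) face $i$ contains $\alpha_i$ sources and $\alpha_i$ sinks, with one source (in face $i$) distinguished, for each $i=1,\ldots,m$; (c) there are exactly $\beta_k$ vertices of degree $2k$, for every $k\ge 2$.
   Context: Permutations are multiplied right to left. A cycle factorization of $\pi\in S_n$ is a tuple $(\sigma_1,\ldots,\sigma_r)$ of nontrivial cycles in $S_n$ with $\sigma_1\cdots\sigma_r=\pi$. Its signature is $(\beta_2,\beta_3,\ldots)$ with $\beta_k$ the number of factors that are $k$-cycles, and its depth is $\sum_k (k-1)\beta_k$. It is transitive if its factors generate a group acting transitively on $\{1,\ldots,n\}$, and then its genus is the integer $g\ge0$ with depth $=n+\ell(\pi)-2+2g$, $\ell(\pi)$ being the number of cycles of $\pi$ (including fixed points). Two cycle factorizations are equivalent if one can be obtained from the other by repeatedly interchanging adjacent disjoint factors; an inequivalent factorization is an equivalence class. A map is a connected graph cellularly embedded in a closed orientable surface, considered up to orientation-preserving homeomorphism; its genus is that of the surface. An alternating map is a map of a directed graph such that, around every vertex, the edges encountered in cyclic order alternate between out-directed and in-directed; sources and sinks of such a map are then exactly its out-directed and in-directed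 leaves. It is acyclic if it contains no directed cycle. A vertex is contained in a face if it lies on the boundary walk of that face. The maps in the correspondence carry face labels $1,\ldots,m$ and distinguished sources, and are counted up to isomorphisms preserving these data and edge directions. *)

theory Defs
  imports
    "HOL-Combinatorics.Orbits"
    "HOL-Algebra.Sym_Groups"
begin

section \<open>Cycle factorizations\<close>

definition composition :: "nat list \<Rightarrow> nat \<Rightarrow> nat \<Rightarrow> bool" where
  "composition \<alpha> m n \<longleftrightarrow> length \<alpha> = m \<and> (\<forall>a\<in>set \<alpha>. 0 < a) \<and> sum_list \<alpha> = n"

definition perm_cycles :: "nat \<Rightarrow> (nat \<Rightarrow> nat) \<Rightarrow> nat set set" where
  "perm_cycles n \<pi> = orbit \<pi> ` {1..n}"

text \<open>The cycle type is taken as a multiset: the order of the parts of a composition is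
  irrelevant for a permutation to have that composition as its cycle type.\<close>

definition cycle_type :: "nat \<Rightarrow> (nat \<Rightarrow> nat) \<Rightarrow> nat multiset" where
  "cycle_type n \<pi> = image_mset card (mset_set (perm_cycles n \<pi>))"

definition is_k_cycle :: "nat \<Rightarrow> nat \<Rightarrow> (nat \<Rightarrow> nat) \<Rightarrow> bool" where
  "is_k_cycle n k \<sigma> \<longleftrightarrow>
     (\<exists>cs. cycle cs \<and> length cs = k \<and> set cs \<subseteq> {1..n} \<and> \<sigma> = cycle_of_list cs)"

definition cycle_factorization :: "nat \<Rightarrow> (nat \<Rightarrow> nat) \<Rightarrow> (nat \<Rightarrow> nat) list \<Rightarrow> bool" where
  "cycle_factorization n \<pi> fs \<longleftrightarrow>
     (\<forall>\<sigma>\<in>set fs. \<exists>k\<ge>2. is_k_cycle n k \<sigma>) \<and> foldr (\<circ>) fs id = \<pi>"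

definition signature :: "nat \<Rightarrow> (nat \<Rightarrow> nat) list \<Rightarrow> nat \<Rightarrow> nat" where
  "signature n fs k = length (filter (is_k_cycle n k) fs)"

definition depth :: "nat \<Rightarrow> (nat \<Rightarrow> nat) list \<Rightarrow> nat" where
  "depth n fs = (\<Sum>k = 2..n. (k - 1) * signature n fs k)"

definition transitive_factors :: "nat \<Rightarrow> (nat \<Rightarrow> nat) list \<Rightarrow> bool" where
  "transitive_factors n fs \<longleftrightarrow>
     (\<forall>x\<in>{1..n}. \<forall>y\<in>{1..n}. \<exists>h\<in>generate (sym_group n) (set fs). h x = y)"

definition genus_factorization ::
    "nat \<Rightarrow> nat \<Rightarrow> (nat \<Rightarrow> nat) \<Rightarrow> (nat \<Rightarrow> nat) list \<Rightarrow> bool" where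
  "genus_factorization n g \<pi> fs \<longleftrightarrow>
     cycle_factorization n \<pi> fs \<and> transitive_factors n fs \<and>
     int (depth n fs) = int n + int (card (perm_cycles n \<pi>)) - 2 + 2 * int g"

definition disjoint_perms :: "('a \<Rightarrow> 'a) \<Rightarrow> ('a \<Rightarrow> 'a) \<Rightarrow> bool" where
  "disjoint_perms \<sigma> \<tau> \<longleftrightarrow> {x. \<sigma> x \<noteq> x} \<inter> {x. \<tau> x \<noteq> x} = {}"

definition commutation_step :: "('a \<Rightarrow> 'a) list rel" where
  "commutation_step =
     {(us @ [\<sigma>, \<tau>] @ vs, us @ [\<tau>, \<sigma>] @ vs) | us \<sigma> \<tau> vs. disjoint_perms \<sigma> \<tau>}"

definition commutation_equiv :: "('a \<Rightarrow> 'a) list rel" where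
  "commutation_equiv = commutation_step\<^sup>*"

lemma equiv_commutation_equiv: "equiv UNIV commutation_equiv"
proof -
  have "sym commutation_step"
    unfolding commutation_step_def disjoint_perms_def
    by (rule symI) (clarsimp, metis inf_commute)
  then have "sym (commutation_step\<^sup>*)"
    by (rule sym_rtrancl)
  then show ?thesis
    unfolding commutation_equiv_def by (intro equivI refl_rtrancl trans_rtrancl) simp_all
qed

definition inequivalent_factorizations ::
    "nat \<Rightarrow> nat \<Rightarrow> (nat \<Rightarrow> nat) \<Rightarrow> (nat \<Rightarrow> nat) \<Rightarrow> (nat \<Rightarrow> nat) list set set" where
  "inequivalent_factorizations n g \<pi> \<beta> =
     {fs. genus_factorization n g \<pi> fs \<and> (\<forall>k\<ge>2. signature n fs k = \<beta> k)} // commutation_equiv"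


section \<open>Maps of directed graphs\<close>

text \<open>
  A map, that is, a cellular embedding of a graph (with at least one edge) in a closed oriented
  surface up to orientation-preserving homeomorphism, is represented by its rotation system.
  The darts are the half-edges; rot sends a dart to the next one in the cyclic order around
  its vertex; opp exchanges the two halves of each edge. In a map of a directed graph, outs
  consists of the tail halves of the edges, so that a dart outside outs is directed into its vertex.
  Requiring both functions to be the identity off the darts removes irrelevant freedom.
\<close>

record 'd dmap =
  darts :: "'d set"
  rot :: "'d \<Rightarrow> 'd"
  opp :: "'d \<Rightarrow> 'd"
  outs :: "'d set"

definition vertex_of :: "('d, 'z) dmap_scheme \<Rightarrow> 'd \<Rightarrow> 'd set" where
  "vertex_of M d = orbit (rot M) d"

definition vertices :: "('d, 'z) dmap_scheme \<Rightarrow> 'd set set" where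
  "vertices M = vertex_of M ` darts M"

definition edges :: "('d, 'z) dmap_scheme \<Rightarrow> 'd set set" where
  "edges M = (\<lambda>d. {d, opp M d}) ` darts M"

text \<open>A face is given by its boundary walk, recorded as the set of darts from which the walk
  departs: it traverses an edge from the half d to the half opp d and then continues
  along the next dart around the vertex reached.\<close>

definition faces :: "('d, 'z) dmap_scheme \<Rightarrow> 'd set set" where
  "faces M = orbit (rot M \<circ> opp M) ` darts M"

definition contained_in_face :: "'d set \<Rightarrow> 'd set \<Rightarrow> bool" where
  "contained_in_face v F \<longleftrightarrow> v \<inter> F \<noteq> {}"

abbreviation degree :: "'d set \<Rightarrow> nat" where
  "degree v \<equiv> card v"

definition arc_rel :: "('d, 'z) dmap_scheme \<Rightarrow> 'd set rel" where
  "arc_rel M = {(vertex_of M d, vertex_of M (opp M d)) | d. d \<in> outs M}"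

definition directed_map :: "('d, 'z) dmap_scheme \<Rightarrow> bool" where
  "directed_map M \<longleftrightarrow>
     finite (darts M) \<and> darts M \<noteq> {} \<and>
     rot M permutes darts M \<and>
     opp M permutes darts M \<and> (\<forall>d\<in>darts M. opp M d \<noteq> d \<and> opp M (opp M d) = d) \<and>
     outs M \<subseteq> darts M \<and> (\<forall>d\<in>darts M. opp M d \<in> outs M \<longleftrightarrow> d \<notin> outs M) \<and>
     (\<forall>u\<in>vertices M. \<forall>v\<in>vertices M. (u, v) \<in> (arc_rel M \<union> (arc_rel M)\<inverse>)\<^sup>*)"

definition has_genus :: "('d, 'z) dmap_scheme \<Rightarrow> nat \<Rightarrow> bool" where
  "has_genus M g \<longleftrightarrow>
     int (card (vertices M)) - int (card (edges M)) + int (card (faces M)) = 2 - 2 * int g"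

text \<open>No constraint arises at a leaf, whose single dart is its own successor.\<close>

definition alternating :: "('d, 'z) dmap_scheme \<Rightarrow> bool" where
  "alternating M \<longleftrightarrow>
     (\<forall>d\<in>darts M. rot M d \<noteq> d \<longrightarrow> (rot M d \<in> outs M \<longleftrightarrow> d \<notin> outs M))"

definition acyclic_map :: "('d, 'z) dmap_scheme \<Rightarrow> bool" where
  "acyclic_map M \<longleftrightarrow> acyclic (arc_rel M)"

definition sources :: "('d, 'z) dmap_scheme \<Rightarrow> 'd set set" where
  "sources M = {v \<in> vertices M. v \<subseteq> outs M}"

definition sinks :: "('d, 'z) dmap_scheme \<Rightarrow> 'd set set" where
  "sinks M = {v \<in> vertices M. v \<inter> outs M = {}}"

lemma vertex_of_self:
  assumes "directed_map M" "d \<in> darts M"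
  shows "d \<in> vertex_of M d"
proof -
  have "permutation (rot M)"
    using assms(1) unfolding directed_map_def permutation_permutes by blast
  then show ?thesis
    unfolding vertex_of_def by (rule permutation_self_in_orbit)
qed

lemma alternating_one_sided_vertex_leaf:
  assumes M: "directed_map M" "alternating M"
    and v: "v \<in> sources M \<union> sinks M"
  shows "degree v = 1"
proof -
  obtain d where d: "d \<in> darts M" "v = vertex_of M d"
    using v by (auto simp: sources_def sinks_def vertices_def)
  have "d \<in> v" "rot M d \<in> v"
    using vertex_of_self[OF M(1) d(1)] d(2) by (auto simp: vertex_of_def orbit.base)
  then have fixed: "rot M d = d"
    using v M(2) d(1) unfolding sources_def sinks_def alternating_def by blast
  have "x = d" if "x \<in> orbit (rot M) d" for x
    using that by (induction rule: orbit.induct) (auto simp: fixed)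
  then have "v = {d}"
    using \<open>d \<in> v\<close> d(2) by (auto simp: vertex_of_def)
  then show ?thesis by simp
qed


section \<open>Maps with labelled faces and distinguished sources\<close>

text \<open>Face i and the source distinguished in it are the i-th entries of the two lists. As usual for
  lists, including the list of the parts of a composition, indexing starts at 0, so the labels
  are 0, ..., m - 1 instead of 1, ..., m.\<close>

record 'd labelled_map = "'d dmap" +
  face_list :: "'d set list"
  distinguished :: "'d set list"

definition correspondence_map ::
    "nat \<Rightarrow> nat \<Rightarrow> nat list \<Rightarrow> (nat \<Rightarrow> nat) \<Rightarrow> 'd labelled_map \<Rightarrow> bool" where
  "correspondence_map m g \<alpha> \<beta> M \<longleftrightarrow>
     directed_map M \<and> has_genus M g \<and> alternating M \<and> acyclic_map M \<and>
     length (face_list M) = m \<and> distinct (face_list M) \<and> set (face_list M) = faces M \<and>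
     (\<forall>v\<in>vertices M. v \<in> sources M \<or> v \<in> sinks M \<or> even (degree v) \<and> 4 \<le> degree v) \<and>
     (\<forall>i<m. card {v \<in> sources M. contained_in_face v (face_list M ! i)} = \<alpha> ! i \<and>
            card {v \<in> sinks M. contained_in_face v (face_list M ! i)} = \<alpha> ! i) \<and>
     length (distinguished M) = m \<and>
     (\<forall>i<m. distinguished M ! i \<in> sources M \<and>
            contained_in_face (distinguished M ! i) (face_list M ! i)) \<and>
     (\<forall>k\<ge>2. card {v \<in> vertices M. degree v = 2 * k} = \<beta> k)"

definition labelled_map_iso ::
    "('d \<Rightarrow> 'e) \<Rightarrow> 'd labelled_map \<Rightarrow> 'e labelled_map \<Rightarrow> bool" where
  "labelled_map_iso h M N \<longleftrightarrow>
     bij_betw h (darts M) (darts N) \<and>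
     (\<forall>d\<in>darts M. h (rot M d) = rot N (h d) \<and> h (opp M d) = opp N (h d) \<and>
                  (h d \<in> outs N \<longleftrightarrow> d \<in> outs M)) \<and>
     face_list N = map ((`) h) (face_list M) \<and>
     distinguished N = map ((`) h) (distinguished M)"

text \<open>Every finite map has an isomorphic copy whose darts are natural numbers, hence isomorphism
  classes of such maps represent all isomorphism classes.\<close>

definition correspondence_maps ::
    "nat \<Rightarrow> nat \<Rightarrow> nat list \<Rightarrow> (nat \<Rightarrow> nat) \<Rightarrow> nat labelled_map set" where
  "correspondence_maps m g \<alpha> \<beta> = {M. correspondence_map m g \<alpha> \<beta> M}"

definition labelled_map_iso_rel :: "nat labelled_map set \<Rightarrow> nat labelled_map rel" where
  "labelled_map_iso_rel \<M> = {(M, N). M \<in> \<M> \<and> N \<in> \<M> \<and> (\<exists>h. labelled_map_iso h M N)}"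

lemma directed_map_cell_subsets:
  assumes "directed_map M"
  shows "v \<in> vertices M \<Longrightarrow> v \<subseteq> darts M" and "F \<in> faces M \<Longrightarrow> F \<subseteq> darts M"
proof -
  have r: "rot M permutes darts M" and "opp M permutes darts M"
    using assms by (simp_all add: directed_map_def)
  then have ro: "rot M \<circ> opp M permutes darts M"
    by (simp add: permutes_compose)
  show "v \<subseteq> darts M" if "v \<in> vertices M"
    using that permutes_orbit_subset[OF r] unfolding vertices_def vertex_of_def by auto
  show "F \<subseteq> darts M" if "F \<in> faces M"
    using that permutes_orbit_subset[OF ro] unfolding faces_def by auto
qed

lemma labelled_map_iso_sym:
  assumes M: "correspondence_map m g \<alpha> \<beta> M" and h: "labelled_map_iso h M N"
  shows "labelled_map_iso (inv_into (darts M) h) N M"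
proof -
  let ?k = "inv_into (darts M) h"
  have dM: "directed_map M" using M by (simp add: correspondence_map_def)
  have b: "bij_betw h (darts M) (darts N)" using h by (simp add: labelled_map_iso_def)
  have kd: "?k (h d) = d" if "d \<in> darts M" for d
    using that b by (simp add: bij_betw_def)
  have img: "?k ` h ` X = X" if "X \<subseteq> darts M" for X
    using that kd by force
  have lists: "map ((`) ?k) (map ((`) h) Xs) = Xs" if "\<forall>X\<in>set Xs. X \<subseteq> darts M" for Xs
    using that img by (induction Xs) auto
  have "\<forall>X\<in>set (face_list M). X \<subseteq> darts M"
    using M directed_map_cell_subsets(2)[OF dM] by (auto simp: correspondence_map_def)
  moreover have "\<forall>X\<in>set (distinguished M). X \<subseteq> darts M"
    using M directed_map_cell_subsets(1)[OF dM]
    by (force simp: correspondence_map_def sources_def in_set_conv_nth)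
  moreover have "?k (rot N e) = rot M (?k e) \<and> ?k (opp N e) = opp M (?k e) \<and>
      (?k e \<in> outs M \<longleftrightarrow> e \<in> outs N)" if e: "e \<in> darts N" for e
  proof -
    obtain d where d: "d \<in> darts M" "e = h d" using e b by (auto simp: bij_betw_def)
    have "rot M d \<in> darts M" "opp M d \<in> darts M"
      using dM d by (auto simp: directed_map_def permutes_in_image)
    then show ?thesis
      using h d kd unfolding labelled_map_iso_def by metis
  qed
  ultimately show ?thesis
    using h b lists unfolding labelled_map_iso_def by (auto simp: bij_betw_inv_into)
qed

lemma labelled_map_iso_trans:
  assumes M: "correspondence_map m g \<alpha> \<beta> M"
    and "labelled_map_iso h M N" "labelled_map_iso k N P"
  shows "labelled_map_iso (k \<circ> h) M P"
proof -
  have "directed_map M" using M by (simp add: correspondence_map_def)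
  then have "rot M d \<in> darts M" "opp M d \<in> darts M" if "d \<in> darts M" for d
    using that by (auto simp: directed_map_def permutes_in_image)
  moreover have "bij_betw (k \<circ> h) (darts M) (darts P)"
    using assms(2,3) bij_betw_trans unfolding labelled_map_iso_def by blast
  moreover have "h d \<in> darts N" if "d \<in> darts M" for d
    using that assms(2) by (auto simp: labelled_map_iso_def bij_betw_def)
  moreover have "(`) k \<circ> (`) h = (`) (k \<circ> h)"
    by (rule ext) (simp add: image_comp)
  ultimately show ?thesis
    using assms(2,3) unfolding labelled_map_iso_def by simp
qed

lemma equiv_labelled_map_iso_rel:
  "equiv (correspondence_maps m g \<alpha> \<beta>) (labelled_map_iso_rel (correspondence_maps m g \<alpha> \<beta>))"
proof (rule equivI)
  show "labelled_map_iso_rel (correspondence_maps m g \<alpha> \<beta>)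
      \<subseteq> correspondence_maps m g \<alpha> \<beta> \<times> correspondence_maps m g \<alpha> \<beta>"
    by (auto simp: labelled_map_iso_rel_def)
  have "labelled_map_iso id M M" for M :: "nat labelled_map"
    by (simp add: labelled_map_iso_def)
  then show "refl_on (correspondence_maps m g \<alpha> \<beta>)
      (labelled_map_iso_rel (correspondence_maps m g \<alpha> \<beta>))"
    by (auto simp: refl_on_def labelled_map_iso_rel_def)
  show "sym (labelled_map_iso_rel (correspondence_maps m g \<alpha> \<beta>))"
    by (rule symI)
       (auto simp: labelled_map_iso_rel_def correspondence_maps_def dest: labelled_map_iso_sym)
  show "trans (labelled_map_iso_rel (correspondence_maps m g \<alpha> \<beta>))"
    by (rule transI)
       (auto simp: labelled_map_iso_rel_def correspondence_maps_def dest: labelled_map_iso_trans)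
qed

definition correspondence_map_classes ::
    "nat \<Rightarrow> nat \<Rightarrow> nat list \<Rightarrow> (nat \<Rightarrow> nat) \<Rightarrow> nat labelled_map set set" where
  "correspondence_map_classes m g \<alpha> \<beta> =
     correspondence_maps m g \<alpha> \<beta> // labelled_map_iso_rel (correspondence_maps m g \<alpha> \<beta>)"

end

theory Submission
  imports Defs "HOL-Library.Countable"
begin

text \<open>
  In an acyclic alternating map every edge lies on a unique strand: a directed path that leaves a
  source, passes from each in-dart to the next dart around its vertex, and ends in a sink. Label the
  strands 1, ..., n. A vertex of degree 2k then carries a k-cycle on the strands through it, and a
  topological order of these vertices lists the cycles as a word; two orders differ by
  commutations, and commuting disjoint factors does not change the map. The boundary walk of a face
  follows a strand from its source to its sink and then runs back to a source, applying the cycles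
  from the last to the first. Hence the faces are the cycles of the product, the Euler
  characteristic becomes the depth formula, and connectedness becomes transitivity.

  Conversely, an isomorphism between the maps of two factorizations of the same permutation commutes
  with that permutation on sources, hence fixes every strand as soon as it fixes one distinguished
  source in each face. It then identifies, for every point, the subwords of the factors moving that
  point, which forces the two words to be equivalent.
\<close>

text \<open>Renumbering the strands of a map conjugates the product of its word, so the bare map
  determines \<pi> only up to conjugacy. The remedy is a fixed list \<open>cs\<close> with one point
  in each cycle of \<pi>: every point of {1..n} is an iterate of \<pi> applied to some
  \<open>cs ! i\<close>, with the exponent determined modulo the i-th part of \<alpha>. In these
  coordinates two permutations with base points for the same \<alpha> are conjugate by a map that
  matches the base points, and only the identity commutes with \<pi> and fixes all of
  \<open>cs\<close>. For surjectivity the sources receive an arbitrary numbering, which yields a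
  word with some product. The conjugation to \<pi> is then applied to the numbering, not to the
  word, and a word is extracted anew. Its product is \<pi> by the same relation that gives rigidity:
  an isomorphism of strand maps intertwines the two products. Conjugation of single factors
  therefore never has to be studied.\<close>

abbreviation moved :: "('a \<Rightarrow> 'a) \<Rightarrow> 'a set" where
  "moved \<sigma> \<equiv> {x. \<sigma> x \<noteq> x}"

section \<open>Orbits of permutations of finite sets\<close>

lemma orbit_mapsto_subset:
  assumes "\<And>x. x \<in> S \<Longrightarrow> f x \<in> S" "x \<in> S"
  shows "orbit f x \<subseteq> S"
proof
  fix y assume "y \<in> orbit f x"
  then show "y \<in> S" by induction (use assms in auto)
qed

lemma image_orbit:
  assumes "\<And>x. x \<in> S \<Longrightarrow> f x \<in> S" and "\<And>x. x \<in> S \<Longrightarrow> h (f x) = g (h x)" and "x \<in> S"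
  shows "h ` orbit f x = orbit g (h x)"
proof
  have S: "orbit f x \<subseteq> S"
    by (rule orbit_mapsto_subset) (use assms in auto)
  show "h ` orbit f x \<subseteq> orbit g (h x)"
  proof
    fix z assume "z \<in> h ` orbit f x"
    then obtain y where "y \<in> orbit f x" "z = h y" by blast
    then show "z \<in> orbit g (h x)"
    proof (induction arbitrary: z)
      case base
      then show ?case using assms by (simp add: orbit.base)
    next
      case (step y)
      then have "y \<in> S" using S by auto
      then show ?case using step assms by (simp add: orbit.step)
    qed
  qed
  show "orbit g (h x) \<subseteq> h ` orbit f x"
  proof
    fix z assume "z \<in> orbit g (h x)"
    then show "z \<in> h ` orbit f x"
    proof induction
      case base
      then show ?case using assms by (metis imageI orbit.base)
    next
      case (step y)
      then obtain w where "w \<in> orbit f x" "y = h w" by blast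
      moreover from this have "w \<in> S" using S by auto
      ultimately show ?case using assms by (metis imageI orbit.step)
    qed
  qed
qed

lemma permutes_orbit_eq:
  assumes "f permutes A" "finite A" "y \<in> orbit f x"
  shows "orbit f y = orbit f x"
  using assms by (metis cyclic_on_orbit orbit_cyclic_eq3 permutation_permutes)

lemma permutes_self_in_orbit:
  assumes "f permutes A" "finite A"
  shows "x \<in> orbit f x"
  using assms by (metis permutation_permutes permutation_self_in_orbit)

lemma permutes_orbit_iterate:
  assumes "f permutes A" "finite A" "y \<in> orbit f x"
  obtains k where "y = (f ^^ k) x"
  using assms(3) unfolding orbit_altdef by blast

lemma funpow_in_orbit_self:
  assumes "f permutes A" "finite A"
  shows "(f ^^ k) x \<in> orbit f x"
  using funpow_in_orbit[OF permutes_self_in_orbit[OF assms]] .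

lemma orbit_set_support:
  assumes "f permutes A" "finite A"
  shows "orbit f x = set (support f x)"
proof -
  have "permutation f" using assms by (auto simp: permutation_permutes)
  then show ?thesis
    by (simp add: support_set[OF \<open>permutation f\<close>, simplified] orbit_altdef_permutation full_SetCompr_eq[symmetric])
qed

text \<open>The period of \<open>x\<close>, given by \<open>least_power\<close>, is also the length
  of the list \<open>support f x\<close> that enumerates the orbit. Exponents modulo this period
  later serve as coordinates on a cycle.\<close>

lemma funpow_eq_iff_card_orbit:
  assumes "f permutes A" "finite A"
  shows "(f ^^ i) x = (f ^^ j) x \<longleftrightarrow> i mod card (orbit f x) = j mod card (orbit f x)"
proof -
  have p: "permutation f" using assms by (auto simp: permutation_permutes)
  have inj: "inj f" using assms(1) by (rule permutes_inj)
  have "card (orbit f x) = length (support f x)"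
    unfolding orbit_set_support[OF assms] by (rule distinct_card) (rule cycle_of_permutation[OF p])
  then have c: "card (orbit f x) = least_power f x" by simp
  have *: "(f ^^ i) x = (f ^^ j) x \<longleftrightarrow> i mod least_power f x = j mod least_power f x" if "i \<le> j" for i j
  proof -
    have "(f ^^ i) x = (f ^^ j) x \<longleftrightarrow> (f ^^ (j - i)) x = x"
      using that inj by (metis funpow_diff le_add_diff_inverse funpow_add comp_apply)
    also have "\<dots> \<longleftrightarrow> least_power f x dvd j - i"
      using least_power_dvd[OF p] by simp
    also have "\<dots> \<longleftrightarrow> i mod least_power f x = j mod least_power f x"
      using that by (metis mod_eq_dvd_iff_nat)
    finally show ?thesis .
  qed
  show ?thesis
    using *[of i j] *[of j i] c by (metis nat_le_linear)
qed

text \<open>The intrinsic form of a nontrivial cycle: no list of entries has to be chosen, and the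
  length of the cycle is simply \<open>card (moved \<sigma>)\<close>.\<close>

definition cyclic_perm :: "nat \<Rightarrow> (nat \<Rightarrow> nat) \<Rightarrow> bool" where
  "cyclic_perm n \<sigma> \<longleftrightarrow> \<sigma> permutes {1..n} \<and> moved \<sigma> \<noteq> {} \<and> (\<forall>a\<in>moved \<sigma>. orbit \<sigma> a = moved \<sigma>)"

lemma permutes_moved_subset:
  assumes "\<sigma> permutes A"
  shows "moved \<sigma> \<subseteq> A"
  using assms by (auto simp: permutes_def)

lemma cyclic_permI:
  assumes "\<sigma> permutes {1..n}" "\<sigma> a \<noteq> a" "\<And>b. \<sigma> b \<noteq> b \<Longrightarrow> b \<in> orbit \<sigma> a"
  shows "cyclic_perm n \<sigma>"
proof -
  have fin: "finite {1..n}" by simp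
  note p = assms(1) fin
  have "orbit \<sigma> b = moved \<sigma>" if b: "\<sigma> b \<noteq> b" for b
  proof
    have inj: "inj \<sigma>" using assms(1) by (rule permutes_inj)
    show "orbit \<sigma> b \<subseteq> moved \<sigma>"
      by (rule orbit_mapsto_subset) (use b inj in \<open>auto dest: injD\<close>)
    show "moved \<sigma> \<subseteq> orbit \<sigma> b"
      using assms(3) permutes_orbit_eq[OF p] b by blast
  qed
  then show ?thesis using assms unfolding cyclic_perm_def by blast
qed

lemma cyclic_perm_card:
  assumes "cyclic_perm n \<sigma>"
  shows "2 \<le> card (moved \<sigma>)" "card (moved \<sigma>) \<le> n"
proof -
  have p: "\<sigma> permutes {1..n}" using assms by (simp add: cyclic_perm_def)
  obtain a where a: "\<sigma> a \<noteq> a" using assms by (auto simp: cyclic_perm_def)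
  have "\<sigma> (\<sigma> a) \<noteq> \<sigma> a" using a permutes_inj[OF p] by (auto dest: injD)
  then have s: "{a, \<sigma> a} \<subseteq> moved \<sigma>" using a by auto
  have sub: "moved \<sigma> \<subseteq> {1..n}" using permutes_moved_subset[OF p] .
  have "finite (moved \<sigma>)" using sub finite_subset by blast
  then have "card {a, \<sigma> a} \<le> card (moved \<sigma>)" using s card_mono by blast
  then show "2 \<le> card (moved \<sigma>)" using a by auto
  show "card (moved \<sigma>) \<le> n" using card_mono[OF _ sub] by simp
qed

text \<open>A cycle list is rotated by its permutation, so the orbit of its head runs through all
  entries; conversely \<open>support \<sigma> a\<close> is a cycle list for \<sigma>. The bound on
  \<open>k\<close> excludes one-element lists, which denote the identity.\<close>

lemma is_k_cycle_iff:
  assumes "2 \<le> k"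
  shows "is_k_cycle n k \<sigma> \<longleftrightarrow> cyclic_perm n \<sigma> \<and> card (moved \<sigma>) = k"
proof
  assume "is_k_cycle n k \<sigma>"
  then obtain cs where cs: "distinct cs" "length cs = k" "set cs \<subseteq> {1..n}" "\<sigma> = cycle_of_list cs"
    unfolding is_k_cycle_def by blast
  have perm: "\<sigma> permutes set cs" using cs cycle_permutes by simp
  then have permn: "\<sigma> permutes {1..n}" using cs(3) permutes_subset by blast
  have step: "\<sigma> (cs ! i) = cs ! (Suc i mod k)" if "i < k" for i
  proof -
    have "map \<sigma> cs = rotate1 cs" using cyclic_rotation[OF cs(1), of 1] cs(4) by simp
    then have "map \<sigma> cs ! i = rotate1 cs ! i" by simp
    then show ?thesis using that cs(2) by (simp add: nth_rotate1)
  qed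
  have moved: "\<sigma> (cs ! i) \<noteq> cs ! i" if "i < k" for i
  proof -
    have "Suc i mod k \<noteq> i"
    proof (cases "Suc i = k")
      case True then show ?thesis using assms by auto
    next
      case False then show ?thesis using that by simp
    qed
    moreover have "Suc i mod k < k" using assms by simp
    ultimately show ?thesis using that step[OF that] cs nth_eq_iff_index_eq by metis
  qed
  have mv: "moved \<sigma> = set cs"
    using moved cs perm unfolding permutes_def in_set_conv_nth set_eq_iff mem_Collect_eq by metis
  have orb: "cs ! i \<in> orbit \<sigma> (cs ! 0)" if "i < k" for i
    using that
  proof (induction i)
    case 0
    then show ?case using permutes_self_in_orbit[OF permn] by simp
  next
    case (Suc i)
    then show ?case using step[of i] by (metis Suc_lessD mod_less orbit.step)
  qed
  have "0 < k" using assms by simp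
  have "cyclic_perm n \<sigma>"
  proof (rule cyclic_permI[OF permn])
    show "\<sigma> (cs ! 0) \<noteq> cs ! 0" using moved[OF \<open>0 < k\<close>] .
    show "b \<in> orbit \<sigma> (cs ! 0)" if "\<sigma> b \<noteq> b" for b
      using that mv orb cs(2) by (metis (mono_tags, lifting) in_set_conv_nth mem_Collect_eq)
  qed
  moreover have "card (moved \<sigma>) = k" using mv cs distinct_card by metis
  ultimately show "cyclic_perm n \<sigma> \<and> card (moved \<sigma>) = k" ..
next
  assume r: "cyclic_perm n \<sigma> \<and> card (moved \<sigma>) = k"
  then have permn: "\<sigma> permutes {1..n}" by (simp add: cyclic_perm_def)
  then have p: "permutation \<sigma>" by (auto simp: permutation_permutes)
  obtain a where a: "\<sigma> a \<noteq> a" using r by (auto simp: cyclic_perm_def)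
  let ?cs = "support \<sigma> a"
  have st: "set ?cs = moved \<sigma>"
  proof -
    have "orbit \<sigma> a = moved \<sigma>" using r a by (simp add: cyclic_perm_def)
    then show ?thesis using orbit_set_support[OF permn finite_atLeastAtMost] by blast
  qed
  have d: "distinct ?cs" by (rule cycle_of_permutation[OF p])
  have "\<sigma> = cycle_of_list ?cs"
  proof
    fix y
    show "\<sigma> y = cycle_of_list ?cs y"
    proof (cases "y \<in> set ?cs")
      case True
      then show ?thesis using cycle_restrict[OF p] by blast
    next
      case False
      then show ?thesis using st id_outside_supp by (metis (mono_tags, lifting) mem_Collect_eq)
    qed
  qed
  moreover have "length ?cs = k" using r st d distinct_card by metis
  moreover have "set ?cs \<subseteq> {1..n}" using st permutes_moved_subset[OF permn] by simp
  ultimately show "is_k_cycle n k \<sigma>" unfolding is_k_cycle_def using d by blast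
qed

lemma ex_is_k_cycle_iff: "(\<exists>k\<ge>2. is_k_cycle n k \<sigma>) \<longleftrightarrow> cyclic_perm n \<sigma>"
  using is_k_cycle_iff cyclic_perm_card by metis

text \<open>Agreement along one nontrivial orbit forces the supports to coincide, because each
  support is a single orbit; elsewhere both permutations are the identity.\<close>

lemma cyclic_perm_eqI:
  assumes "cyclic_perm n \<sigma>" "cyclic_perm k \<tau>" "\<sigma> a \<noteq> a" "\<And>b. b \<in> orbit \<sigma> a \<Longrightarrow> \<sigma> b = \<tau> b"
  shows "\<sigma> = \<tau>"
proof -
  have s: "orbit \<sigma> a = moved \<sigma>" using assms(1,3) by (simp add: cyclic_perm_def)
  have a: "a \<in> orbit \<sigma> a" using s assms(3) by simp
  have "\<sigma> a = \<tau> a" using assms(4)[OF a] .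
  then have t: "orbit \<tau> a = moved \<tau>" using assms(2,3) by (simp add: cyclic_perm_def)
  have "orbit \<sigma> a = orbit \<tau> a" using orbit_cong[OF a assms(4)[symmetric]] by simp
  then have m: "moved \<sigma> = moved \<tau>" using s t by simp
  show ?thesis
  proof
    fix x
    show "\<sigma> x = \<tau> x"
    proof (cases "\<sigma> x = x")
      case True
      then have "x \<notin> moved \<tau>" using m by blast
      then show ?thesis using True by simp
    next
      case False
      then show ?thesis using assms(4)[of x] s by blast
    qed
  qed
qed

section \<open>Words up to commutation of disjoint letters\<close>

lemma commutation_equiv_refl: "(fs, fs) \<in> commutation_equiv"
  by (simp add: commutation_equiv_def)

lemma commutation_equiv_sym: "(fs, fs') \<in> commutation_equiv \<Longrightarrow> (fs', fs) \<in> commutation_equiv"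
  using equiv_commutation_equiv by (meson equivE symD)

lemma commutation_equiv_trans:
  "(fs, fs') \<in> commutation_equiv \<Longrightarrow> (fs', gs) \<in> commutation_equiv \<Longrightarrow> (fs, gs) \<in> commutation_equiv"
  unfolding commutation_equiv_def by (rule rtrancl_trans)

lemma commutation_equiv_Cons:
  assumes "(fs, fs') \<in> commutation_equiv"
  shows "(\<sigma> # fs, \<sigma> # fs') \<in> commutation_equiv"
  using assms unfolding commutation_equiv_def
proof (induction rule: rtrancl_induct)
  case base
  then show ?case by simp
next
  case (step fs' gs)
  have "(\<sigma> # fs', \<sigma> # gs) \<in> commutation_step"
    using step(2) unfolding commutation_step_def mem_Collect_eq prod.inject
    by (metis append_Cons)
  then show ?case using step by (meson rtrancl.rtrancl_into_rtrancl)
qed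

lemma commutation_equiv_move_front:
  assumes "\<And>\<tau>. \<tau> \<in> set us \<Longrightarrow> disjoint_perms \<tau> \<sigma>"
  shows "(us @ \<sigma> # vs, \<sigma> # us @ vs) \<in> commutation_equiv"
  using assms
proof (induction us)
  case Nil
  then show ?case by (simp add: commutation_equiv_refl)
next
  case (Cons \<tau> us)
  have "([] @ [\<tau>, \<sigma>] @ (us @ vs), [] @ [\<sigma>, \<tau>] @ (us @ vs)) \<in> commutation_step"
    unfolding commutation_step_def using Cons.prems by (metis (mono_tags, lifting) list.set_intros(1) mem_Collect_eq)
  then have "(\<tau> # \<sigma> # us @ vs, \<sigma> # \<tau> # us @ vs) \<in> commutation_equiv"
    unfolding commutation_equiv_def by auto
  moreover have "(\<tau> # us @ \<sigma> # vs, \<tau> # \<sigma> # us @ vs) \<in> commutation_equiv"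
    using Cons by (intro commutation_equiv_Cons) auto
  ultimately show ?case using commutation_equiv_trans by fastforce
qed

text \<open>The projection criterion of Cartier-Foata trace theory.\<close>

lemma commutation_equivI_filter:
  assumes "\<And>\<sigma>. \<sigma> \<in> set fs \<union> set fs' \<Longrightarrow> moved \<sigma> \<noteq> {}"
    and "\<And>a. filter (\<lambda>\<sigma>. \<sigma> a \<noteq> a) fs = filter (\<lambda>\<sigma>. \<sigma> a \<noteq> a) fs'"
  shows "(fs, fs') \<in> commutation_equiv"
  using assms
proof (induction fs arbitrary: fs')
  case Nil
  have "fs' = []"
  proof (rule ccontr)
    assume "fs' \<noteq> []"
    then obtain \<sigma> gs where gs: "fs' = \<sigma> # gs" by (meson neq_Nil_conv)
    then obtain a where "\<sigma> a \<noteq> a" using Nil(1)[of \<sigma>] by auto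
    then show False using Nil(2)[of a] gs by simp
  qed
  then show ?case by (simp add: commutation_equiv_refl)
next
  case (Cons \<sigma> fs)
  obtain a where a: "\<sigma> a \<noteq> a" using Cons.prems(1)[of \<sigma>] by auto
  have "\<sigma> \<in> set (filter (\<lambda>\<sigma>. \<sigma> a \<noteq> a) fs')"
    using Cons.prems(2)[of a] a by (metis (mono_tags, lifting) filter.simps(2) list.set_intros(1))
  then have "\<sigma> \<in> set fs'" by simp
  then obtain us vs where uv: "fs' = us @ \<sigma> # vs" "\<sigma> \<notin> set us"
    by (meson split_list_first)
  \<comment> \<open>A letter before the first \<sigma> in \<open>fs'\<close> that shared a moved
    point \<open>b\<close> with \<sigma> would precede it in the projection to \<open>b\<close>.
    That projection must start with \<sigma>, which does not occur in \<open>us\<close>.\<close>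
  have dj: "disjoint_perms \<tau> \<sigma>" if t: "\<tau> \<in> set us" for \<tau>
  proof (rule ccontr)
    assume "\<not> disjoint_perms \<tau> \<sigma>"
    then obtain b where b: "\<tau> b \<noteq> b" "\<sigma> b \<noteq> b" by (auto simp: disjoint_perms_def)
    let ?u = "filter (\<lambda>\<sigma>. \<sigma> b \<noteq> b) us"
    have "?u \<noteq> []" using t b(1) by (auto simp: filter_empty_conv)
    then have "hd ?u \<in> set us" by (metis filter_is_subset hd_in_set subsetD)
    moreover have "\<sigma> # filter (\<lambda>\<sigma>. \<sigma> b \<noteq> b) fs = ?u @ \<sigma> # filter (\<lambda>\<sigma>. \<sigma> b \<noteq> b) vs"
      using Cons.prems(2)[of b] b(2) uv(1) by simp
    then have "hd ?u = \<sigma>"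
      using \<open>?u \<noteq> []\<close> by (metis hd_append2 list.sel(1))
    ultimately show False using uv(2) by simp
  qed
  \<comment> \<open>With \<sigma> moved to the front of both words, it can be cancelled: a
    projection loses its leading \<sigma> if \<sigma> moves \<open>b\<close> and is unchanged
    otherwise.\<close>
  have "(fs, us @ vs) \<in> commutation_equiv"
  proof (rule Cons.IH)
    show "moved \<rho> \<noteq> {}" if "\<rho> \<in> set fs \<union> set (us @ vs)" for \<rho>
      using Cons.prems(1)[of \<rho>] that uv(1) by auto
    show "filter (\<lambda>\<sigma>. \<sigma> b \<noteq> b) fs = filter (\<lambda>\<sigma>. \<sigma> b \<noteq> b) (us @ vs)" for b
    proof (cases "\<sigma> b = b")
      case True
      then show ?thesis using Cons.prems(2)[of b] uv(1) by simp
    next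
      case False
      then have "filter (\<lambda>\<sigma>. \<sigma> b \<noteq> b) us = []"
        using dj by (auto simp: filter_empty_conv disjoint_perms_def)
      then show ?thesis using Cons.prems(2)[of b] uv(1) False by simp
    qed
  qed
  then have "(\<sigma> # fs, \<sigma> # us @ vs) \<in> commutation_equiv" by (rule commutation_equiv_Cons)
  moreover have "(fs', \<sigma> # us @ vs) \<in> commutation_equiv"
    unfolding uv(1) by (rule commutation_equiv_move_front) (rule dj)
  ultimately show ?case using commutation_equiv_trans commutation_equiv_sym by blast
qed

lemma disjoint_perms_comp_commute:
  assumes "disjoint_perms \<sigma> \<tau>" "inj \<sigma>" "inj \<tau>"
  shows "\<sigma> \<circ> \<tau> = \<tau> \<circ> \<sigma>"
proof
  fix x
  show "(\<sigma> \<circ> \<tau>) x = (\<tau> \<circ> \<sigma>) x"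
  proof (cases "\<sigma> x = x")
    case True
    have "\<sigma> (\<tau> x) = \<tau> x"
    proof (cases "\<tau> x = x")
      case False
      then have "\<tau> (\<tau> x) \<noteq> \<tau> x" using assms(3) by (auto dest: injD)
      then show ?thesis using assms(1) by (auto simp: disjoint_perms_def)
    qed (simp add: True)
    then show ?thesis using True by simp
  next
    case False
    then have "\<sigma> (\<sigma> x) \<noteq> \<sigma> x" using assms(2) by (auto dest: injD)
    then have "\<tau> x = x" "\<tau> (\<sigma> x) = \<sigma> x"
      using False assms(1) by (auto simp: disjoint_perms_def)
    then show ?thesis by simp
  qed
qed

section \<open>Transport of maps along isomorphisms\<close>

definition map_hom :: "('d \<Rightarrow> 'e) \<Rightarrow> ('d, 'z) dmap_scheme \<Rightarrow> ('e, 'y) dmap_scheme \<Rightarrow> bool" where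
  "map_hom h M N \<longleftrightarrow>
     bij_betw h (darts M) (darts N) \<and>
     (\<forall>d\<in>darts M. h (rot M d) = rot N (h d) \<and> h (opp M d) = opp N (h d) \<and>
                  (h d \<in> outs N \<longleftrightarrow> d \<in> outs M))"

lemma labelled_map_iso_iff:
  "labelled_map_iso h M N \<longleftrightarrow> map_hom h M N \<and>
     face_list N = map ((`) h) (face_list M) \<and> distinguished N = map ((`) h) (distinguished M)"
  by (auto simp: labelled_map_iso_def map_hom_def)

text \<open>An isomorphism only constrains values on darts, whereas \<open>directed_map\<close> asks
  \<open>rot\<close> and \<open>opp\<close> to be the identity elsewhere. The target must bring this
  property along.\<close>

definition trivial_off_darts :: "('d, 'z) dmap_scheme \<Rightarrow> bool" where
  "trivial_off_darts M \<longleftrightarrow> (\<forall>d. d \<notin> darts M \<longrightarrow> rot M d = d \<and> opp M d = d) \<and> outs M \<subseteq> darts M"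

locale map_iso =
  fixes h :: "'d \<Rightarrow> 'e" and M :: "('d, 'z) dmap_scheme" and N :: "('e, 'y) dmap_scheme"
  assumes dM: "directed_map M" and hom: "map_hom h M N" and triv: "trivial_off_darts N"
begin

lemma bij: "bij_betw h (darts M) (darts N)"
  and rot: "d \<in> darts M \<Longrightarrow> h (rot M d) = rot N (h d)"
  and opp: "d \<in> darts M \<Longrightarrow> h (opp M d) = opp N (h d)"
  and outs: "d \<in> darts M \<Longrightarrow> h d \<in> outs N \<longleftrightarrow> d \<in> outs M"
  using hom by (auto simp: map_hom_def)

lemma inj: "inj_on h (darts M)"
  using bij by (simp add: bij_betw_def)

lemma darts_N: "darts N = h ` darts M"
  using bij by (simp add: bij_betw_def)

lemma rot_darts: "d \<in> darts M \<Longrightarrow> rot M d \<in> darts M"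
  and opp_darts: "d \<in> darts M \<Longrightarrow> opp M d \<in> darts M"
  using dM by (auto simp: directed_map_def permutes_in_image)

lemma outs_M: "outs M \<subseteq> darts M" and outs_N: "outs N = h ` outs M"
proof -
  show o: "outs M \<subseteq> darts M" using dM by (simp add: directed_map_def)
  have "outs N \<subseteq> darts N" using triv by (simp add: trivial_off_darts_def)
  then show "outs N = h ` outs M" using o outs darts_N by auto
qed

lemma permutes_N:
  assumes "f permutes darts M" "\<And>d. d \<in> darts M \<Longrightarrow> h (f d) = g (h d)" "\<And>d. d \<notin> darts N \<Longrightarrow> g d = d"
  shows "g permutes darts N"
proof (rule bij_imp_permutes[OF _ assms(3)])
  have "bij_betw (h \<circ> f) (darts M) (darts N)"
    using bij_betw_trans[OF permutes_imp_bij[OF assms(1)] bij] .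
  moreover have "(h \<circ> f) d = (g \<circ> h) d" if "d \<in> darts M" for d
    using assms(2) that by simp
  ultimately have "bij_betw (g \<circ> h) (darts M) (darts N)"
    using bij_betw_cong by blast
  then show "bij_betw g (darts N) (darts N)"
    using bij_betw_comp_iff[OF bij] by blast
qed simp

lemma rot_N: "rot N permutes darts N"
  using permutes_N[of "rot M" "rot N"] dM rot triv by (simp add: directed_map_def trivial_off_darts_def)

lemma opp_N: "opp N permutes darts N"
  using permutes_N[of "opp M" "opp N"] dM opp triv by (simp add: directed_map_def trivial_off_darts_def)

lemma vertex_of: "d \<in> darts M \<Longrightarrow> vertex_of N (h d) = h ` vertex_of M d"
  unfolding vertex_of_def by (rule image_orbit[symmetric, where S = "darts M"]) (auto simp: rot rot_darts)

lemma vertices: "vertices N = (`) h ` vertices M"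
  unfolding vertices_def darts_N image_image using vertex_of by auto

lemma face_of: "d \<in> darts M \<Longrightarrow> orbit (rot N \<circ> opp N) (h d) = h ` orbit (rot M \<circ> opp M) d"
  by (rule image_orbit[symmetric, where S = "darts M"]) (auto simp: rot rot_darts opp opp_darts)

lemma faces: "faces N = (`) h ` faces M"
  unfolding faces_def darts_N image_image using face_of by auto

lemma edges: "edges N = (`) h ` edges M"
  unfolding edges_def darts_N image_image using opp by auto

lemma vertex_subset: "v \<in> vertices M \<Longrightarrow> v \<subseteq> darts M"
  and face_subset: "F \<in> faces M \<Longrightarrow> F \<subseteq> darts M"
  and edge_subset: "e \<in> edges M \<Longrightarrow> e \<subseteq> darts M"
  using directed_map_cell_subsets[OF dM] opp_darts by (auto simp: edges_def)

lemma inj_image: "inj_on ((`) h) (Pow (darts M))"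
  using inj by (rule inj_on_image_Pow)

lemma card_image_cells:
  assumes "\<And>v. v \<in> V \<Longrightarrow> v \<subseteq> darts M"
  shows "card ((`) h ` V) = card V"
proof (rule card_image)
  have "V \<subseteq> Pow (darts M)" using assms by blast
  then show "inj_on ((`) h) V" using inj_image inj_on_subset by blast
qed

lemma image_subset_outs: "v \<subseteq> darts M \<Longrightarrow> h ` v \<subseteq> outs N \<longleftrightarrow> v \<subseteq> outs M"
  using outs by auto

lemma image_disjoint_outs: "v \<subseteq> darts M \<Longrightarrow> h ` v \<inter> outs N = {} \<longleftrightarrow> v \<inter> outs M = {}"
  using outs by fast

lemma sources: "sources N = (`) h ` sources M"
proof -
  have "h ` v \<subseteq> outs N \<longleftrightarrow> v \<subseteq> outs M" if "v \<in> vertices M" for v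
    using image_subset_outs[OF vertex_subset[OF that]] .
  then show ?thesis unfolding sources_def vertices by blast
qed

lemma sinks: "sinks N = (`) h ` sinks M"
proof -
  have "h ` v \<inter> outs N = {} \<longleftrightarrow> v \<inter> outs M = {}" if "v \<in> vertices M" for v
    using image_disjoint_outs[OF vertex_subset[OF that]] .
  then show ?thesis unfolding sinks_def vertices by blast
qed

lemma image_contained_in_face:
  "v \<subseteq> darts M \<Longrightarrow> F \<subseteq> darts M \<Longrightarrow> contained_in_face (h ` v) (h ` F) \<longleftrightarrow> contained_in_face v F"
  unfolding contained_in_face_def using inj_on_image_Int[OF inj, of v F] by auto

lemma arc_rel: "arc_rel N = map_prod ((`) h) ((`) h) ` arc_rel M"
proof -
  have "arc_rel M = (\<lambda>d. (vertex_of M d, vertex_of M (opp M d))) ` outs M"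
    by (auto simp: arc_rel_def)
  moreover have "arc_rel N = (\<lambda>d. (vertex_of N d, vertex_of N (opp N d))) ` outs N"
    by (auto simp: arc_rel_def)
  moreover have "(vertex_of N (h d), vertex_of N (opp N (h d)))
      = map_prod ((`) h) ((`) h) (vertex_of M d, vertex_of M (opp M d))" if "d \<in> outs M" for d
    using that outs_M vertex_of opp opp_darts by (metis map_prod_simp subsetD)
  ultimately show ?thesis
    unfolding outs_N by (simp add: image_image)
qed

lemma arc_rel_M: "arc_rel M \<subseteq> vertices M \<times> vertices M"
  unfolding arc_rel_def vertices_def using outs_M opp_darts by auto

lemma inj_vertices: "inj_on ((`) h) (vertices M)"
proof -
  have "vertices M \<subseteq> Pow (darts M)" using vertex_subset by blast
  then show ?thesis using inj_image inj_on_subset by blast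
qed

lemma directed_N: "directed_map N"
proof -
  have "finite (darts N)" "darts N \<noteq> {}" using dM darts_N by (auto simp: directed_map_def)
  moreover have "opp N e \<noteq> e \<and> opp N (opp N e) = e" if e: "e \<in> darts N" for e
  proof -
    obtain d where d: "d \<in> darts M" "e = h d" using e darts_N by auto
    have "opp M d \<noteq> d" "opp M (opp M d) = d" using dM d by (auto simp: directed_map_def)
    then show ?thesis using d opp opp_darts inj by (metis inj_on_eq_iff)
  qed
  moreover have "opp N e \<in> outs N \<longleftrightarrow> e \<notin> outs N" if e: "e \<in> darts N" for e
  proof -
    obtain d where d: "d \<in> darts M" "e = h d" using e darts_N by auto
    have "opp M d \<in> outs M \<longleftrightarrow> d \<notin> outs M" using dM d by (auto simp: directed_map_def)
    then show ?thesis using d opp opp_darts outs by metis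
  qed
  moreover have "(u, v) \<in> (arc_rel N \<union> (arc_rel N)\<inverse>)\<^sup>*" if uv: "u \<in> vertices N" "v \<in> vertices N" for u v
  proof -
    have r: "((`) h x, (`) h y) \<in> (arc_rel N \<union> (arc_rel N)\<inverse>)\<^sup>*"
      if "(x, y) \<in> (arc_rel M \<union> (arc_rel M)\<inverse>)\<^sup>*" for x y
      using that
    proof (induction rule: rtrancl_induct)
      case (step y z)
      have "((`) h y, (`) h z) \<in> arc_rel N \<union> (arc_rel N)\<inverse>"
        using step(2) unfolding arc_rel by force
      then show ?case using step(3) by (rule rtrancl.rtrancl_into_rtrancl[rotated])
    qed simp
    obtain x y where "x \<in> vertices M" "y \<in> vertices M" "u = h ` x" "v = h ` y"
      using uv vertices by auto
    then show ?thesis using r dM by (auto simp: directed_map_def)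
  qed
  ultimately show ?thesis
    unfolding directed_map_def using rot_N opp_N triv by (auto simp: trivial_off_darts_def)
qed

lemma acyclic_N:
  assumes "acyclic_map M"
  shows "acyclic_map N"
proof -
  let ?k = "inv_into (vertices M) ((`) h)"
  have k: "?k (h ` v) = v" if "v \<in> vertices M" for v
    using that inj_vertices by simp
  have "(?k x, ?k y) \<in> (arc_rel M)\<^sup>+" if "(x, y) \<in> (arc_rel N)\<^sup>+" for x y
    using that
  proof (induction rule: trancl_induct)
    case (base y)
    then show ?case unfolding arc_rel using arc_rel_M k by auto
  next
    case (step y z)
    have "(?k y, ?k z) \<in> arc_rel M" using step(2) unfolding arc_rel using arc_rel_M k by auto
    then show ?case using step(3) by simp
  qed
  then show ?thesis using assms unfolding acyclic_map_def acyclic_def by blast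
qed

lemma alternating_N:
  assumes "alternating M"
  shows "alternating N"
  unfolding alternating_def
proof (intro ballI impI)
  fix e assume e: "e \<in> darts N" "rot N e \<noteq> e"
  obtain d where d: "d \<in> darts M" "e = h d" using e darts_N by auto
  then have "rot M d \<noteq> d" using e rot by metis
  then have "rot M d \<in> outs M \<longleftrightarrow> d \<notin> outs M" using assms d by (simp add: alternating_def)
  then show "rot N e \<in> outs N \<longleftrightarrow> e \<notin> outs N" using d rot outs rot_darts by metis
qed

lemma card_vertex: "v \<in> vertices M \<Longrightarrow> card (h ` v) = card v"
  using inj vertex_subset by (meson card_image inj_on_subset)

lemma card_filter_cells:
  assumes "\<And>v. v \<in> V \<Longrightarrow> v \<subseteq> darts M" "\<And>v. v \<in> V \<Longrightarrow> Q (h ` v) \<longleftrightarrow> P v"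
  shows "card {v \<in> (`) h ` V. Q v} = card {v \<in> V. P v}"
proof -
  have "{v \<in> (`) h ` V. Q v} = (`) h ` {v \<in> V. P v}" using assms(2) by blast
  moreover have "card ((`) h ` {v \<in> V. P v}) = card {v \<in> V. P v}"
    by (rule card_image_cells) (use assms(1) in auto)
  ultimately show ?thesis by simp
qed

end

text \<open>Each clause is phrased through cells and incidences, which \<open>h\<close> carries over
  bijectively. It is used both to make an arbitrary admissible map into a strand map and to move a
  strand map to darts in \<open>nat\<close>.\<close>

lemma correspondence_map_transport:
  assumes M: "correspondence_map m g \<alpha> \<beta> M" and h: "labelled_map_iso h M N" and N: "trivial_off_darts N"
  shows "correspondence_map m g \<alpha> \<beta> N"
proof -
  interpret map_iso h M N
    using assms by unfold_locales (auto simp: correspondence_map_def labelled_map_iso_iff)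
  note M = M[unfolded correspondence_map_def]
  have fl: "face_list N = map ((`) h) (face_list M)" and dl: "distinguished N = map ((`) h) (distinguished M)"
    using h by (auto simp: labelled_map_iso_iff)
  have fs: "face_list M ! i \<subseteq> darts M" if "i < m" for i
    using that M face_subset by (metis nth_mem)
  have "has_genus N g"
    using M unfolding has_genus_def vertices edges faces
    by (simp add: card_image_cells vertex_subset face_subset edge_subset)
  moreover have "distinct (face_list N)"
  proof -
    have "set (face_list M) \<subseteq> Pow (darts M)" using M face_subset by blast
    then show ?thesis
      unfolding fl distinct_map using M inj_image inj_on_subset by blast
  qed
  moreover have "set (face_list N) = faces N"
    unfolding fl faces using M by simp
  moreover have "v \<in> sources N \<or> v \<in> sinks N \<or> even (degree v) \<and> 4 \<le> degree v" if v: "v \<in> vertices N" for v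
  proof -
    obtain u where u: "u \<in> vertices M" "v = h ` u" using v vertices by auto
    then have "u \<in> sources M \<or> u \<in> sinks M \<or> even (degree u) \<and> 4 \<le> degree u" using M by blast
    then show ?thesis unfolding sources sinks using u card_vertex by auto
  qed
  moreover have "card {v \<in> sources N. contained_in_face v (face_list N ! i)} = \<alpha> ! i"
    "card {v \<in> sinks N. contained_in_face v (face_list N ! i)} = \<alpha> ! i" if i: "i < m" for i
  proof -
    have n: "face_list N ! i = h ` (face_list M ! i)" using M i fl by simp
    have c: "contained_in_face (h ` v) (face_list N ! i) \<longleftrightarrow> contained_in_face v (face_list M ! i)"
      if "v \<in> vertices M" for v
      unfolding n using image_contained_in_face[OF vertex_subset[OF that] fs[OF i]] .
    have "card {v \<in> sources N. contained_in_face v (face_list N ! i)}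
        = card {v \<in> sources M. contained_in_face v (face_list M ! i)}"
      unfolding sources by (rule card_filter_cells) (use c vertex_subset in \<open>auto simp: sources_def\<close>)
    then show "card {v \<in> sources N. contained_in_face v (face_list N ! i)} = \<alpha> ! i" using M i by simp
    have "card {v \<in> sinks N. contained_in_face v (face_list N ! i)}
        = card {v \<in> sinks M. contained_in_face v (face_list M ! i)}"
      unfolding sinks by (rule card_filter_cells) (use c vertex_subset in \<open>auto simp: sinks_def\<close>)
    then show "card {v \<in> sinks N. contained_in_face v (face_list N ! i)} = \<alpha> ! i" using M i by simp
  qed
  moreover have "distinguished N ! i \<in> sources N \<and> contained_in_face (distinguished N ! i) (face_list N ! i)"
    if i: "i < m" for i
  proof -
    have d: "distinguished M ! i \<in> sources M" "contained_in_face (distinguished M ! i) (face_list M ! i)"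
      using M i by auto
    have "face_list N ! i = h ` (face_list M ! i)" "distinguished N ! i = h ` (distinguished M ! i)"
      using M i fl dl by auto
    moreover have "distinguished M ! i \<subseteq> darts M"
      using d vertex_subset by (simp add: sources_def)
    ultimately show ?thesis using d image_contained_in_face fs[OF i] sources by auto
  qed
  moreover have "card {v \<in> vertices N. degree v = 2 * k} = \<beta> k" if "2 \<le> k" for k
  proof -
    have "card {v \<in> vertices N. degree v = 2 * k} = card {v \<in> vertices M. degree v = 2 * k}"
      unfolding vertices by (rule card_filter_cells) (use card_vertex vertex_subset in auto)
    then show ?thesis using M that by simp
  qed
  ultimately show ?thesis
    unfolding correspondence_map_def
    using M directed_N alternating_N acyclic_N fl dl by simp
qed

definition relabel :: "('d \<Rightarrow> 'e) \<Rightarrow> 'd labelled_map \<Rightarrow> 'e labelled_map" where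
  "relabel e M =
     \<lparr>darts = e ` darts M,
      rot = (\<lambda>x. if x \<in> e ` darts M then e (rot M (inv_into UNIV e x)) else x),
      opp = (\<lambda>x. if x \<in> e ` darts M then e (opp M (inv_into UNIV e x)) else x),
      outs = e ` outs M,
      face_list = map ((`) e) (face_list M),
      distinguished = map ((`) e) (distinguished M)\<rparr>"

lemma relabel_iso:
  assumes "inj e"
  shows "labelled_map_iso e M (relabel e M)"
proof -
  have [simp]: "e d \<in> e ` A \<longleftrightarrow> d \<in> A" "inv_into UNIV e (e d) = d" for d A
    using assms by (auto simp: inj_image_mem_iff)
  have "inj_on e (darts M)" using assms inj_on_subset by blast
  then show ?thesis by (simp add: labelled_map_iso_def relabel_def bij_betw_def)
qed

lemma relabel_trivial_off_darts:
  assumes "outs M \<subseteq> darts M"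
  shows "trivial_off_darts (relabel e M)"
  using assms by (auto simp: trivial_off_darts_def relabel_def)

text \<open>When every listed face is the orbit of a chosen dart and every distinguished vertex is
  that dart alone, both lists are encoded by one list of darts, so it suffices that \<open>h\<close>
  matches these darts.\<close>

lemma map_hom_imp_labelled_map_iso:
  assumes hom: "map_hom h M N" and dM: "directed_map M" and tN: "trivial_off_darts N"
    and cs: "set cs \<subseteq> darts M" and h: "map h cs = cs'"
    and M: "face_list M = map (orbit (rot M \<circ> opp M)) cs" "distinguished M = map (\<lambda>c. {c}) cs"
    and N: "face_list N = map (orbit (rot N \<circ> opp N)) cs'" "distinguished N = map (\<lambda>c. {c}) cs'"
  shows "labelled_map_iso h M N"
proof -
  interpret map_iso h M N using hom dM tN by unfold_locales
  show ?thesis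
    unfolding labelled_map_iso_iff M N h[symmetric] using hom cs face_of by auto
qed

section \<open>The map of a factorization\<close>

text \<open>The dart (a, p, b) lies on strand a at position p: position 0 is the source of the strand,
  position length fs + 1 its sink, and position p in between the vertex of the p-th factor.
  The flag b marks out-directed darts.\<close>

definition factor_at :: "('a \<Rightarrow> 'a) list \<Rightarrow> nat \<Rightarrow> 'a \<Rightarrow> 'a" where
  "factor_at fs p = (if 0 < p \<and> p \<le> length fs then fs ! (p - 1) else id)"

text \<open>Both ends count as visited by every strand. Thus \<open>next_visit\<close> is meaningful
  from every position up to \<open>length fs\<close>, and \<open>prev_visit\<close> from every
  positive position.\<close>

definition visits :: "('a \<Rightarrow> 'a) list \<Rightarrow> 'a \<Rightarrow> nat \<Rightarrow> bool" where
  "visits fs a p \<longleftrightarrow> p = 0 \<or> p = Suc (length fs) \<or> factor_at fs p a \<noteq> a"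

definition next_visit :: "('a \<Rightarrow> 'a) list \<Rightarrow> 'a \<Rightarrow> nat \<Rightarrow> nat" where
  "next_visit fs a p = (LEAST q. p < q \<and> visits fs a q)"

definition prev_visit :: "('a \<Rightarrow> 'a) list \<Rightarrow> 'a \<Rightarrow> nat \<Rightarrow> nat" where
  "prev_visit fs a q = (GREATEST p. p < q \<and> visits fs a p)"

definition strand_darts :: "nat \<Rightarrow> (nat \<Rightarrow> nat) list \<Rightarrow> (nat \<times> nat \<times> bool) set" where
  "strand_darts n fs =
     {(a, p, b). a \<in> {1..n} \<and> visits fs a p \<and> (p = 0 \<longrightarrow> b) \<and> (p = Suc (length fs) \<longrightarrow> \<not> b)}"

text \<open>At an inner vertex the rotation turns an in-dart into the out-dart of the same strand,
  and an out-dart of \<open>a\<close> into the in-dart of the strand to which the factor sends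
  \<open>a\<close>. Two steps apply the factor, and the flags alternate.\<close>

definition strand_rot :: "nat \<Rightarrow> (nat \<Rightarrow> nat) list \<Rightarrow> nat \<times> nat \<times> bool \<Rightarrow> nat \<times> nat \<times> bool" where
  "strand_rot n fs d =
     (if d \<in> strand_darts n fs then case d of (a, p, b) \<Rightarrow>
        if p = 0 \<or> p = Suc (length fs) then d
        else if b then (factor_at fs p a, p, False) else (a, p, True)
      else d)"

definition strand_opp :: "nat \<Rightarrow> (nat \<Rightarrow> nat) list \<Rightarrow> nat \<times> nat \<times> bool \<Rightarrow> nat \<times> nat \<times> bool" where
  "strand_opp n fs d =
     (if d \<in> strand_darts n fs then case d of (a, p, b) \<Rightarrow>
        if b then (a, next_visit fs a p, False) else (a, prev_visit fs a p, True)
      else d)"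

definition strand_map ::
    "nat \<Rightarrow> nat list \<Rightarrow> (nat \<Rightarrow> nat) list \<Rightarrow> (nat \<times> nat \<times> bool) labelled_map" where
  "strand_map n cs fs =
     \<lparr>darts = strand_darts n fs, rot = strand_rot n fs, opp = strand_opp n fs,
      outs = {d \<in> strand_darts n fs. snd (snd d)},
      face_list = map (\<lambda>c. orbit (strand_rot n fs \<circ> strand_opp n fs) (c, 0, True)) cs,
      distinguished = map (\<lambda>c. {(c, 0, True)}) cs\<rparr>"

lemma strand_map_sel [simp]:
  "darts (strand_map n cs fs) = strand_darts n fs"
  "rot (strand_map n cs fs) = strand_rot n fs"
  "opp (strand_map n cs fs) = strand_opp n fs"
  "outs (strand_map n cs fs) = {d \<in> strand_darts n fs. snd (snd d)}"
  "face_list (strand_map n cs fs) =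
     map (\<lambda>c. orbit (strand_rot n fs \<circ> strand_opp n fs) (c, 0, True)) cs"
  "distinguished (strand_map n cs fs) = map (\<lambda>c. {(c, 0, True)}) cs"
  by (simp_all add: strand_map_def)

lemma trivial_off_darts_strand_map: "trivial_off_darts (strand_map n cs fs)"
  by (auto simp: trivial_off_darts_def strand_rot_def strand_opp_def)

lemma factor_at_0 [simp]: "factor_at fs 0 = id"
  and factor_at_beyond [simp]: "length fs < p \<Longrightarrow> factor_at fs p = id"
  and factor_at_Suc: "i < length fs \<Longrightarrow> factor_at fs (Suc i) = fs ! i"
  by (auto simp: factor_at_def)

lemma visits_ends [simp]: "visits fs a 0" "visits fs a (Suc (length fs))"
  by (simp_all add: visits_def)

lemma visits_le: "visits fs a p \<Longrightarrow> p \<le> Suc (length fs)"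
  by (cases "length fs < p") (auto simp: visits_def)

lemma
  assumes "p \<le> length fs"
  shows next_visit_gt: "p < next_visit fs a p"
    and visits_next_visit: "visits fs a (next_visit fs a p)"
    and not_visits_before_next: "p < s \<Longrightarrow> s < next_visit fs a p \<Longrightarrow> \<not> visits fs a s"
proof -
  have "p < Suc (length fs) \<and> visits fs a (Suc (length fs))" using assms by simp
  then have "p < next_visit fs a p \<and> visits fs a (next_visit fs a p)"
    unfolding next_visit_def by (rule LeastI)
  then show "p < next_visit fs a p" "visits fs a (next_visit fs a p)" by auto
  show "p < s \<Longrightarrow> s < next_visit fs a p \<Longrightarrow> \<not> visits fs a s"
    unfolding next_visit_def using not_less_Least by blast
qed

lemma next_visit_eqI:
  assumes "p < q" "visits fs a q" "\<And>s. p < s \<Longrightarrow> s < q \<Longrightarrow> \<not> visits fs a s"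
  shows "next_visit fs a p = q"
  unfolding next_visit_def by (rule Least_equality) (use assms in \<open>auto simp: not_less[symmetric]\<close>)

lemma prev_visit_eqI:
  assumes "p < q" "visits fs a p" "\<And>s. p < s \<Longrightarrow> s < q \<Longrightarrow> \<not> visits fs a s"
  shows "prev_visit fs a q = p"
  unfolding prev_visit_def by (rule Greatest_equality) (use assms in \<open>auto simp: not_less[symmetric]\<close>)

lemma
  assumes "0 < q"
  shows prev_visit_less: "prev_visit fs a q < q"
    and visits_prev_visit: "visits fs a (prev_visit fs a q)"
    and not_visits_after_prev: "prev_visit fs a q < s \<Longrightarrow> s < q \<Longrightarrow> \<not> visits fs a s"
proof -
  let ?P = "\<lambda>p. p < q \<and> visits fs a p"
  have "?P 0" using assms by simp
  then have "?P (Greatest ?P)" by (rule GreatestI_nat[where b = q]) auto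
  then show "prev_visit fs a q < q" "visits fs a (prev_visit fs a q)"
    unfolding prev_visit_def by auto
  show "\<not> visits fs a s" if "prev_visit fs a q < s" "s < q"
    using that Greatest_le_nat[of ?P s q] unfolding prev_visit_def by fastforce
qed

lemma next_prev_visit: "0 < q \<Longrightarrow> visits fs a q \<Longrightarrow> next_visit fs a (prev_visit fs a q) = q"
  by (rule next_visit_eqI[OF prev_visit_less _ not_visits_after_prev])

lemma prev_next_visit: "p \<le> length fs \<Longrightarrow> visits fs a p \<Longrightarrow> prev_visit fs a (next_visit fs a p) = p"
  by (rule prev_visit_eqI[OF next_visit_gt _ not_visits_before_next])

lemma next_visit_le: "p \<le> length fs \<Longrightarrow> next_visit fs a p \<le> Suc (length fs)"
  by (rule visits_le[OF visits_next_visit])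

lemma foldr_comp_append: "foldr (\<circ>) (xs @ ys) id = foldr (\<circ>) xs id \<circ> foldr (\<circ>) ys id"
  by (induction xs) (simp_all add: comp_assoc)

text \<open>The product of the factors strictly before position \<open>p\<close>, positions of
  factors starting at 1. Truncated subtraction makes it the identity at both \<open>p = 0\<close>
  and \<open>p = 1\<close>.\<close>

definition prefix_product :: "('a \<Rightarrow> 'a) list \<Rightarrow> nat \<Rightarrow> 'a \<Rightarrow> 'a" where
  "prefix_product fs p = foldr (\<circ>) (take (p - 1) fs) id"

lemma prefix_product_Suc: "prefix_product fs (Suc p) = prefix_product fs p \<circ> factor_at fs p"
proof (cases "0 < p \<and> p \<le> length fs")
  case True
  then have "take p fs = take (p - 1) fs @ [fs ! (p - 1)]"
    using take_Suc_conv_app_nth[of "p - 1" fs] by (cases p) auto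
  then show ?thesis
    using True foldr_comp_append[of "take (p - 1) fs" "[fs ! (p - 1)]"]
    by (simp add: prefix_product_def factor_at_def)
next
  case False
  then show ?thesis by (auto simp: prefix_product_def factor_at_def)
qed

lemma prefix_product_0 [simp]: "prefix_product fs 0 = id"
  by (simp add: prefix_product_def)

lemma prefix_product_end: "prefix_product fs (Suc (length fs)) = foldr (\<circ>) fs id"
  by (simp add: prefix_product_def)

text \<open>Products act from the right, so the factors between \<open>p\<close> and
  \<open>q\<close> meet \<open>a\<close> first, and an unvisited factor fixes it.\<close>

lemma prefix_product_skip:
  assumes "p < q" "\<And>s. p < s \<Longrightarrow> s < q \<Longrightarrow> \<not> visits fs a s"
  shows "prefix_product fs q a = prefix_product fs (Suc p) a"
  using assms
proof (induction q)
  case (Suc q)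
  show ?case
  proof (cases "p = q")
    case False
    then have "prefix_product fs q a = prefix_product fs (Suc p) a" using Suc by auto
    moreover have "factor_at fs q a = a" using Suc.prems(2)[of q] Suc.prems(1) False by (simp add: visits_def)
    ultimately show ?thesis by (simp add: prefix_product_Suc)
  qed simp
qed simp

text \<open>The source at which the boundary walk from \<open>d\<close> first arrives. From an
  in-dart at \<open>p\<close> the walk runs back through the factors before \<open>p\<close>; from
  an inner out-dart it reaches the sink and then runs back through all factors. A source dart has
  already arrived.\<close>

definition face_label :: "(nat \<Rightarrow> nat) list \<Rightarrow> nat \<times> nat \<times> bool \<Rightarrow> nat" where
  "face_label fs d = (case d of (a, p, b) \<Rightarrow>
     if p = 0 then a else if b then foldr (\<circ>) fs id a else prefix_product fs p a)"

section \<open>Rotation, edges and face walks of a strand map\<close>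

locale factor_strands =
  fixes n :: nat and fs :: "(nat \<Rightarrow> nat) list"
  assumes n_pos: "1 \<le> n" and factors: "\<And>\<sigma>. \<sigma> \<in> set fs \<Longrightarrow> cyclic_perm n \<sigma>"
begin

declare atLeastAtMost_iff [simp del] One_nat_def [simp del]

abbreviation r :: nat where "r \<equiv> length fs"
abbreviation D :: "(nat \<times> nat \<times> bool) set" where "D \<equiv> strand_darts n fs"
abbreviation \<pi> :: "nat \<Rightarrow> nat" where "\<pi> \<equiv> foldr (\<circ>) fs id"
abbreviation \<rho> where "\<rho> \<equiv> strand_rot n fs"
abbreviation \<epsilon> where "\<epsilon> \<equiv> strand_opp n fs"
abbreviation \<phi> where "\<phi> \<equiv> \<rho> \<circ> \<epsilon>"

lemma factor_cyclic: "0 < p \<Longrightarrow> p \<le> r \<Longrightarrow> cyclic_perm n (factor_at fs p)"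
  using factors by (auto simp: factor_at_def)

lemma factor_permutes: "factor_at fs p permutes {1..n}"
proof (cases "0 < p \<and> p \<le> r")
  case True
  then show ?thesis using factor_cyclic by (simp add: cyclic_perm_def)
next
  case False
  then show ?thesis by (auto simp: factor_at_def permutes_id)
qed

lemma foldr_permutes:
  assumes "set gs \<subseteq> set fs"
  shows "foldr (\<circ>) gs id permutes {1..n}"
  using assms factors
  by (induction gs) (auto simp: cyclic_perm_def permutes_id intro: permutes_compose)

lemma pi_permutes: "\<pi> permutes {1..n}"
  by (rule foldr_permutes) simp

lemma prefix_permutes: "prefix_product fs p permutes {1..n}"
  unfolding prefix_product_def by (rule foldr_permutes) (rule set_take_subset)

lemma factor_in: "factor_at fs p a \<in> {1..n} \<longleftrightarrow> a \<in> {1..n}"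
  by (rule permutes_in_image[OF factor_permutes])

lemma visits_factor: "visits fs (factor_at fs p a) p \<longleftrightarrow> visits fs a p"
  unfolding visits_def using permutes_inj[OF factor_permutes] by (metis injD)

lemma darts_iff:
  "(a, p, b) \<in> D \<longleftrightarrow> a \<in> {1..n} \<and> visits fs a p \<and> (p = 0 \<longrightarrow> b) \<and> (p = Suc r \<longrightarrow> \<not> b)"
  by (simp add: strand_darts_def)

lemma dart_le: "(a, p, b) \<in> D \<Longrightarrow> p \<le> Suc r"
  using visits_le by (auto simp: darts_iff)

lemma out_le: "(a, p, True) \<in> D \<Longrightarrow> p \<le> r"
  using dart_le by (fastforce simp: darts_iff)

lemma in_pos: "(a, p, False) \<in> D \<Longrightarrow> 0 < p"
  by (auto simp: darts_iff)

lemma source_in [simp]: "(a, 0, True) \<in> D \<longleftrightarrow> a \<in> {1..n}"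
  by (simp add: darts_iff)

lemma sink_in [simp]: "(a, Suc r, False) \<in> D \<longleftrightarrow> a \<in> {1..n}"
  by (simp add: darts_iff)

lemma inner_in: "0 < p \<Longrightarrow> p \<le> r \<Longrightarrow> (a, p, b) \<in> D \<longleftrightarrow> a \<in> moved (factor_at fs p)"
  using permutes_moved_subset[OF factor_permutes] by (auto simp: darts_iff visits_def)

lemma rot_end: "p = 0 \<or> p = Suc r \<Longrightarrow> \<rho> (a, p, b) = (a, p, b)"
  by (auto simp: strand_rot_def)

lemma rot_in: "(a, p, False) \<in> D \<Longrightarrow> p \<noteq> Suc r \<Longrightarrow> \<rho> (a, p, False) = (a, p, True)"
  using in_pos by (auto simp: strand_rot_def)

lemma rot_out: "(a, p, True) \<in> D \<Longrightarrow> p \<noteq> 0 \<Longrightarrow> \<rho> (a, p, True) = (factor_at fs p a, p, False)"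
  using out_le by (fastforce simp: strand_rot_def)

lemma opp_out: "(a, p, True) \<in> D \<Longrightarrow> \<epsilon> (a, p, True) = (a, next_visit fs a p, False)"
  by (simp add: strand_opp_def)

lemma opp_in: "(a, p, False) \<in> D \<Longrightarrow> \<epsilon> (a, p, False) = (a, prev_visit fs a p, True)"
  by (simp add: strand_opp_def)

lemma next_dart: "(a, p, True) \<in> D \<Longrightarrow> (a, next_visit fs a p, False) \<in> D"
  using next_visit_gt[OF out_le, of a p a] visits_next_visit[OF out_le, of a p a] by (auto simp: darts_iff)

lemma prev_dart:
  assumes "(a, p, False) \<in> D"
  shows "(a, prev_visit fs a p, True) \<in> D"
proof -
  have "prev_visit fs a p < p" "visits fs a (prev_visit fs a p)"
    by (rule prev_visit_less[OF in_pos[OF assms]], rule visits_prev_visit[OF in_pos[OF assms]])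
  then show ?thesis using assms dart_le[OF assms] by (auto simp: darts_iff)
qed

lemma flip_dart: "(a, p, b) \<in> D \<Longrightarrow> 0 < p \<Longrightarrow> p \<le> r \<Longrightarrow> (a, p, b') \<in> D"
  by (simp add: inner_in)

lemma factor_dart: "(a, p, b) \<in> D \<Longrightarrow> 0 < p \<Longrightarrow> p \<le> r \<Longrightarrow> (factor_at fs p a, p, b') \<in> D"
  by (simp add: darts_iff visits_factor factor_in)

text \<open>Forward, the walk goes straight on: the dart after an in-dart is the out-dart of the
  same strand. Only at the sink does the flag stay \<open>False\<close>, which turns the walk
  around.\<close>

lemma face_step_out:
  assumes "(a, p, True) \<in> D"
  shows "\<phi> (a, p, True) = (a, next_visit fs a p, next_visit fs a p \<noteq> Suc r)"
  using opp_out[OF assms] rot_in[OF next_dart[OF assms]] rot_end[of "next_visit fs a p" a False]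
  by (cases "next_visit fs a p = Suc r") auto

text \<open>Backward, the walk arrives at an out-dart and the rotation moves it to the image strand.
  Arrival at a source obeys the same formula because \<open>factor_at fs 0 = id\<close>; there the
  flag becomes \<open>True\<close> again.\<close>

lemma face_step_in:
  assumes "(a, p, False) \<in> D"
  shows "\<phi> (a, p, False) =
    (factor_at fs (prev_visit fs a p) a, prev_visit fs a p, prev_visit fs a p = 0)"
  using opp_in[OF assms] rot_out[OF prev_dart[OF assms]] rot_end[of "prev_visit fs a p" a True]
  by (cases "prev_visit fs a p = 0") auto

lemma finite_D: "finite D"
proof -
  have "D \<subseteq> {1..n} \<times> {..Suc r} \<times> UNIV" using dart_le by (auto simp: darts_iff)
  then show ?thesis by (rule finite_subset) simp
qed

lemma opp_D: "d \<in> D \<Longrightarrow> \<epsilon> d \<in> D"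
  by (cases d rule: prod_cases3, rename_tac a p b, case_tac b)
     (auto simp: opp_out opp_in next_dart prev_dart)

lemma opp_opp: "d \<in> D \<Longrightarrow> \<epsilon> (\<epsilon> d) = d"
proof -
  assume d: "d \<in> D"
  obtain a p b where e: "d = (a, p, b)" by (cases d)
  show ?thesis
  proof (cases b)
    case True
    then have *: "(a, p, True) \<in> D" using d e by simp
    then have "visits fs a p" "p \<le> r" using out_le by (auto simp: darts_iff)
    then show ?thesis using True e * opp_out opp_in[OF next_dart] prev_next_visit by simp
  next
    case False
    then have *: "(a, p, False) \<in> D" using d e by simp
    then have "visits fs a p" "0 < p" using in_pos by (auto simp: darts_iff)
    then show ?thesis using False e * opp_in opp_out[OF prev_dart] next_prev_visit by simp
  qed
qed

lemma opp_snd: "d \<in> D \<Longrightarrow> snd (snd (\<epsilon> d)) \<longleftrightarrow> \<not> snd (snd d)"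
  by (cases d rule: prod_cases3, rename_tac a p b, case_tac b) (auto simp: opp_out opp_in)

lemma opp_permutes: "\<epsilon> permutes D"
proof (rule bij_imp_permutes)
  show "bij_betw \<epsilon> D D"
    by (rule bij_betw_byWitness[where f' = \<epsilon>]) (use opp_D opp_opp in auto)
qed (auto simp: strand_opp_def)

lemma rot_D: "d \<in> D \<Longrightarrow> \<rho> d \<in> D"
proof -
  assume d: "d \<in> D"
  obtain a p b where e: "d = (a, p, b)" by (cases d)
  show ?thesis
  proof (cases "p = 0 \<or> p = Suc r")
    case True
    then show ?thesis using d e rot_end by simp
  next
    case False
    then have "0 < p" "p \<le> r" using d e dart_le by fastforce+
    then show ?thesis using d e False flip_dart factor_dart
      by (cases b) (auto simp: rot_in rot_out)
  qed
qed

lemma rot_permutes: "\<rho> permutes D"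
proof (rule bij_imp_permutes)
  have "inj_on \<rho> D"
  proof (rule inj_onI)
    fix x y assume x: "x \<in> D" and y: "y \<in> D" and eq: "\<rho> x = \<rho> y"
    show "x = y"
      using x y eq permutes_inj[OF factor_permutes]
      by (cases x; cases y) (auto simp: strand_rot_def split: if_splits dest: injD)
  qed
  then show "bij_betw \<rho> D D"
    using finite_D rot_D by (metis bij_betw_def endo_inj_surj image_subsetI)
qed (auto simp: strand_rot_def)

lemma face_permutes: "\<phi> permutes D"
  using permutes_compose[OF opp_permutes rot_permutes] .

lemma source_iff: "d \<in> D \<Longrightarrow> snd (snd d) \<Longrightarrow> \<rho> d = d \<longleftrightarrow> fst (snd d) = 0"
proof -
  assume d: "d \<in> D" "snd (snd d)"
  obtain a p where e: "d = (a, p, True)" using d by (cases d) auto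
  show ?thesis using d e rot_out rot_end by (cases "p = 0") auto
qed

text \<open>On the way forward nothing is applied yet, and at the sink the prefix is the whole
  product. On the way back one step takes the last factor of the prefix that moves the strand and
  applies it to the strand.\<close>

lemma label_step:
  assumes "d \<in> D" "fst (snd d) \<noteq> 0"
  shows "face_label fs (\<phi> d) = face_label fs d"
proof -
  obtain a p b where e: "d = (a, p, b)" by (cases d)
  show ?thesis
  proof (cases b)
    case True
    then have *: "(a, p, True) \<in> D" using assms e by simp
    have "0 < next_visit fs a p" using next_visit_gt[OF out_le[OF *], of a] by simp
    then show ?thesis
      using e True assms(2) face_step_out[OF *] prefix_product_end[of fs] by (simp add: face_label_def)
  next
    case False
    then have *: "(a, p, False) \<in> D" using assms e by simp
    have "prefix_product fs p a = prefix_product fs (Suc (prev_visit fs a p)) a"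
      by (rule prefix_product_skip[OF prev_visit_less not_visits_after_prev]) (use in_pos[OF *] in auto)
    then show ?thesis
      using e False assms(2) face_step_in[OF *] in_pos[OF *] by (auto simp: face_label_def prefix_product_Suc)
  qed
qed

text \<open>The only place where the label changes: leaving the source of \<open>a\<close>, the walk
  heads for the source of \<open>\<pi> a\<close>. Iteration makes one face collect one whole cycle
  of \<pi>.\<close>

lemma label_step_source:
  assumes "a \<in> {1..n}"
  shows "face_label fs (\<phi> (a, 0, True)) = \<pi> a"
proof -
  have *: "(a, 0, True) \<in> D" using assms by simp
  have "0 < next_visit fs a 0" using next_visit_gt[of 0 fs a] by simp
  then show ?thesis
    using face_step_out[OF *] prefix_product_end[of fs] by (simp add: face_label_def)
qed

lemma label_source [simp]: "face_label fs (a, 0, b) = a"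
  by (simp add: face_label_def)

lemma label_in: "d \<in> D \<Longrightarrow> face_label fs d \<in> {1..n}"
  using permutes_in_image[OF pi_permutes] permutes_in_image[OF prefix_permutes]
  by (cases d) (auto simp: face_label_def darts_iff)

text \<open>A bound that drops at every step of the walk until a source is reached. On inner
  out-darts \<open>2 * Suc r - p\<close> exceeds \<open>Suc r\<close>, the value at the sink, so the
  turn at the sink also decreases it.\<close>

definition face_measure :: "nat \<times> nat \<times> bool \<Rightarrow> nat" where
  "face_measure d = (case d of (a, p, b) \<Rightarrow> if p = 0 then 0 else if b then 2 * Suc r - p else p)"

text \<open>From any dart, the boundary walk runs forward along its strand to the sink and then
  backward to a source.\<close>

lemma walk_induct [consumes 1, case_names source step]:
  assumes d: "d \<in> D" and src: "\<And>a. a \<in> {1..n} \<Longrightarrow> P (a, 0, True)"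
    and step: "\<And>d. d \<in> D \<Longrightarrow> fst (snd d) \<noteq> 0 \<Longrightarrow> P (\<phi> d) \<Longrightarrow> P d"
  shows "P d"
  using d
proof (induction "face_measure d" arbitrary: d rule: less_induct)
  case less
  obtain a p b where e: "d = (a, p, b)" by (cases d)
  show ?case
  proof (cases "p = 0")
    case True
    then show ?thesis using less.prems e src by (auto simp: darts_iff)
  next
    case False
    have "face_measure (\<phi> d) < face_measure d"
    proof (cases b)
      case True
      then have *: "(a, p, True) \<in> D" using less.prems e by simp
      then show ?thesis
        using e True False face_step_out[OF *] next_visit_gt[OF out_le[OF *], of a]
          next_visit_le[OF out_le[OF *], of a] out_le[OF *]
        by (auto simp: face_measure_def)
    next
      case b: False
      then have *: "(a, p, False) \<in> D" using less.prems e by simp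
      then show ?thesis
        using e b False face_step_in[OF *] prev_visit_less[OF in_pos[OF *]]
        by (auto simp: face_measure_def)
    qed
    moreover have "\<phi> d \<in> D" using less.prems rot_D opp_D by simp
    ultimately show ?thesis using step less.prems less.hyps e False by auto
  qed
qed

lemma face_of_dart: "d \<in> D \<Longrightarrow> orbit \<phi> d = orbit \<phi> (face_label fs d, 0, True)"
proof (induction d rule: walk_induct)
  case (step d)
  have "orbit \<phi> (\<phi> d) = orbit \<phi> d"
    by (rule permutes_orbit_eq[OF face_permutes finite_D]) (rule orbit.base)
  then show ?case using step label_step by metis
qed simp

lemma face_pi: "a \<in> {1..n} \<Longrightarrow> orbit \<phi> (\<pi> a, 0, True) = orbit \<phi> (a, 0, True)"
proof -
  assume a: "a \<in> {1..n}"
  have "\<phi> (a, 0, True) \<in> D" using a rot_D opp_D by simp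
  then have "orbit \<phi> (\<pi> a, 0, True) = orbit \<phi> (\<phi> (a, 0, True))"
    using face_of_dart label_step_source[OF a] by simp
  also have "\<dots> = orbit \<phi> (a, 0, True)"
    by (rule permutes_orbit_eq[OF face_permutes finite_D]) (rule orbit.base)
  finally show ?thesis .
qed

text \<open>Labels along the walk change only by \<pi>, which confines them to one cycle. Conversely
  each dart walks to the source named by its label, and sources in one cycle of \<pi> lie on one
  walk by \<open>face_pi\<close>.\<close>

lemma face_of_source:
  assumes a: "a \<in> {1..n}"
  shows "orbit \<phi> (a, 0, True) = {d \<in> D. face_label fs d \<in> orbit \<pi> a}"
proof
  have pi_in: "\<pi> x \<in> {1..n} \<longleftrightarrow> x \<in> {1..n}" for x by (rule permutes_in_image[OF pi_permutes])
  have "\<phi> d \<in> {d \<in> D. face_label fs d \<in> orbit \<pi> a}" if "d \<in> {d \<in> D. face_label fs d \<in> orbit \<pi> a}" for d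
  proof -
    obtain x p b where d: "d = (x, p, b)" by (cases d)
    have D: "d \<in> D" "\<phi> d \<in> D" using that rot_D opp_D by auto
    show ?thesis
    proof (cases "p = 0")
      case True
      then have "d = (x, 0, True)" "x \<in> {1..n}" using D d by (auto simp: darts_iff)
      then show ?thesis using label_step_source[of x] that D by (simp add: orbit.step)
    next
      case False
      then show ?thesis using label_step[OF D(1)] that D d by simp
    qed
  qed
  then show "orbit \<phi> (a, 0, True) \<subseteq> {d \<in> D. face_label fs d \<in> orbit \<pi> a}"
    by (rule orbit_mapsto_subset) (use a permutes_self_in_orbit[OF pi_permutes] in simp_all)
  have same: "orbit \<phi> (x, 0, True) = orbit \<phi> (a, 0, True) \<and> x \<in> {1..n}" if "x \<in> orbit \<pi> a" for x
    using that
  proof induction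
    case base
    then show ?case using face_pi[OF a] a pi_in by blast
  next
    case (step y)
    then show ?case using face_pi[of y] pi_in by metis
  qed
  show "{d \<in> D. face_label fs d \<in> orbit \<pi> a} \<subseteq> orbit \<phi> (a, 0, True)"
  proof
    fix d assume d: "d \<in> {d \<in> D. face_label fs d \<in> orbit \<pi> a}"
    then have "orbit \<phi> d = orbit \<phi> (a, 0, True)" using face_of_dart same by (metis (no_types, lifting) mem_Collect_eq)
    moreover have "d \<in> orbit \<phi> d" using permutes_self_in_orbit[OF face_permutes finite_D] .
    ultimately show "d \<in> orbit \<phi> (a, 0, True)" by simp
  qed
qed

end

lemma card_inj_image_filter:
  assumes "inj_on f A"
  shows "card {v \<in> f ` A. P v} = card {a \<in> A. P (f a)}"
proof -
  have "{v \<in> f ` A. P v} = f ` {a \<in> A. P (f a)}" by blast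
  moreover have "inj_on f {a \<in> A. P (f a)}" using assms by (rule inj_on_subset) blast
  ultimately show ?thesis by (simp add: card_image)
qed

text \<open>The algebraic counterpart of face labels and distinguished sources: the order of
  \<open>cs\<close> labels the cycles, and each entry distinguishes a point of its cycle.\<close>

definition base_points :: "nat \<Rightarrow> (nat \<Rightarrow> nat) \<Rightarrow> nat list \<Rightarrow> nat list \<Rightarrow> bool" where
  "base_points n \<pi> \<alpha> cs \<longleftrightarrow>
     length cs = length \<alpha> \<and> set cs \<subseteq> {1..n} \<and> distinct (map (orbit \<pi>) cs) \<and>
     orbit \<pi> ` set cs = perm_cycles n \<pi> \<and> (\<forall>i<length \<alpha>. card (orbit \<pi> (cs ! i)) = \<alpha> ! i)"

lemma signature_cyclic:
  assumes "\<And>\<sigma>. \<sigma> \<in> set fs \<Longrightarrow> cyclic_perm n \<sigma>" "2 \<le> k"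
  shows "signature n fs k = length (filter (\<lambda>\<sigma>. card (moved \<sigma>) = k) fs)"
proof -
  have "filter (is_k_cycle n k) fs = filter (\<lambda>\<sigma>. card (moved \<sigma>) = k) fs"
    using assms is_k_cycle_iff by (intro filter_cong) auto
  then show ?thesis by (simp add: signature_def)
qed

text \<open>A factor contributes to exactly one summand of \<open>depth\<close>, the one for its own
  length; this length lies in the range 2..n by \<open>cyclic_perm_card\<close>.\<close>

lemma depth_cyclic:
  assumes "\<And>\<sigma>. \<sigma> \<in> set fs \<Longrightarrow> cyclic_perm n \<sigma>"
  shows "depth n fs = (\<Sum>\<sigma>\<leftarrow>fs. card (moved \<sigma>) - 1)"
  using assms
proof (induction fs)
  case Nil
  then show ?case by (simp add: depth_def signature_def)
next
  case (Cons \<sigma> fs)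
  let ?c = "card (moved \<sigma>)"
  have c: "2 \<le> ?c" "?c \<le> n" using cyclic_perm_card[OF Cons.prems[of \<sigma>]] by auto
  have s: "signature n (\<sigma> # fs) k = (if k = ?c then 1 else 0) + signature n fs k" if "2 \<le> k" for k
    using signature_cyclic[of "\<sigma> # fs" n k] signature_cyclic[of fs n k] Cons.prems that by auto
  have "depth n (\<sigma> # fs) = (\<Sum>k = 2..n. (if k = ?c then k - 1 else 0) + (k - 1) * signature n fs k)"
    unfolding depth_def by (rule sum.cong) (auto simp: s algebra_simps)
  also have "\<dots> = (\<Sum>k = 2..n. if k = ?c then k - 1 else 0) + depth n fs"
    by (simp add: sum.distrib depth_def)
  also have "(\<Sum>k = 2..n. if k = ?c then k - 1 else 0) = ?c - 1"
    using c by (simp add: sum.delta)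
  finally show ?case using Cons by simp
qed

section \<open>Cells, genus and acyclicity of a strand map\<close>

context factor_strands
begin

definition block :: "nat \<Rightarrow> (nat \<times> nat \<times> bool) set" where
  "block p = moved (factor_at fs p) \<times> {p} \<times> UNIV"

lemma vertex_source: "orbit \<rho> (a, 0, b) = {(a, 0, b)}"
  unfolding orbit_eq_singleton_iff by (simp add: rot_end)

lemma vertex_sink: "orbit \<rho> (a, Suc r, b) = {(a, Suc r, b)}"
  unfolding orbit_eq_singleton_iff by (simp add: rot_end)

text \<open>Going around the vertex runs through the powers of the factor, so all its darts form a
  single orbit precisely because the factor has only one nontrivial orbit.\<close>

lemma vertex_inner:
  assumes p: "0 < p" "p \<le> r" and a: "a \<in> moved (factor_at fs p)"
  shows "orbit \<rho> (a, p, b) = block p"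
proof
  let ?\<sigma> = "factor_at fs p"
  have cyc: "cyclic_perm n ?\<sigma>" using factor_cyclic p by simp
  have orb: "orbit ?\<sigma> a = moved ?\<sigma>" using cyc a by (auto simp: cyclic_perm_def)
  have pn: "p \<noteq> 0" "p \<noteq> Suc r" using p by auto
  have D: "(x, p, b) \<in> D" if "x \<in> moved ?\<sigma>" for x b
    using inner_in[OF p, of x b] that by blast
  have mv: "?\<sigma> x \<in> moved ?\<sigma>" if "x \<in> moved ?\<sigma>" for x
    using that permutes_inj[OF factor_permutes[of p]] by (auto dest: injD)
  show "orbit \<rho> (a, p, b) \<subseteq> block p"
  proof (rule orbit_mapsto_subset)
    fix d assume "d \<in> block p"
    then obtain x c where x: "d = (x, p, c)" "x \<in> moved ?\<sigma>" by (auto simp: block_def)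
    then show "\<rho> d \<in> block p"
      using rot_in[OF D pn(2)] rot_out[OF D pn(1)] mv by (cases c) (auto simp: block_def)
  qed (use a in \<open>auto simp: block_def\<close>)
  have flip: "(x, p, True) \<in> orbit \<rho> (a, p, b)" if "(x, p, False) \<in> orbit \<rho> (a, p, b)" "x \<in> moved ?\<sigma>" for x
    using orbit.step[OF that(1)] rot_in[OF D[OF that(2)] pn(2)] by simp
  have turn: "(?\<sigma> x, p, False) \<in> orbit \<rho> (a, p, b)"
    if "(x, p, True) \<in> orbit \<rho> (a, p, b)" "x \<in> moved ?\<sigma>" for x
    using orbit.step[OF that(1)] rot_out[OF D[OF that(2)] pn(1)] by simp
  have self: "(a, p, b) \<in> orbit \<rho> (a, p, b)"
    using permutes_self_in_orbit[OF rot_permutes finite_D] .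
  have aT: "(a, p, True) \<in> orbit \<rho> (a, p, b)"
    using self flip a by (cases b) auto
  have F: "(x, p, False) \<in> orbit \<rho> (a, p, b)" if "x \<in> orbit ?\<sigma> a" for x
    using that
  proof induction
    case base
    then show ?case using turn aT a by simp
  next
    case (step y)
    then have "y \<in> moved ?\<sigma>" using orb by blast
    then show ?case using turn[OF flip[OF step.IH]] by blast
  qed
  show "block p \<subseteq> orbit \<rho> (a, p, b)"
  proof
    fix d assume "d \<in> block p"
    then obtain x c where x: "d = (x, p, c)" "x \<in> moved ?\<sigma>" by (auto simp: block_def)
    then have "(x, p, False) \<in> orbit \<rho> (a, p, b)" using F orb by blast
    then show "d \<in> orbit \<rho> (a, p, b)" using x flip by (cases c) auto
  qed
qed

lemma dart_cases:
  assumes "d \<in> D"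
  obtains a where "a \<in> {1..n}" "d = (a, 0, True)"
    | a where "a \<in> {1..n}" "d = (a, Suc r, False)"
    | a p b where "0 < p" "p \<le> r" "a \<in> moved (factor_at fs p)" "d = (a, p, b)"
proof -
  obtain a p b where d: "d = (a, p, b)" by (cases d)
  consider "p = 0" | "p = Suc r" | "0 < p" "p \<le> r" using dart_le assms d by fastforce
  then show ?thesis
  proof cases
    case 1
    then show ?thesis using assms d that(1) by (auto simp: darts_iff)
  next
    case 2
    then show ?thesis using assms d that(2) by (auto simp: darts_iff)
  next
    case 3
    then show ?thesis using assms d that(3) inner_in[OF 3] by blast
  qed
qed

abbreviation source_vertices where "source_vertices \<equiv> (\<lambda>a. {(a, 0::nat, True)}) ` {1..n}"
abbreviation sink_vertices where "sink_vertices \<equiv> (\<lambda>a. {(a, Suc r, False)}) ` {1..n}"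

lemma inner_moved: "0 < p \<Longrightarrow> p \<le> r \<Longrightarrow> \<exists>a. a \<in> moved (factor_at fs p)"
  using factor_cyclic by (auto simp: cyclic_perm_def)

lemma vertices_eq:
  "vertices (strand_map n cs fs) = source_vertices \<union> sink_vertices \<union> block ` {0<..r}"
proof
  show "vertices (strand_map n cs fs) \<subseteq> source_vertices \<union> sink_vertices \<union> block ` {0<..r}"
  proof
    fix v assume "v \<in> vertices (strand_map n cs fs)"
    then obtain d where d: "d \<in> D" "v = orbit \<rho> d" by (auto simp: vertices_def vertex_of_def)
    from d(1) show "v \<in> source_vertices \<union> sink_vertices \<union> block ` {0<..r}"
      by (cases rule: dart_cases) (auto simp: d(2) vertex_source vertex_sink vertex_inner)
  qed
  have "block p \<in> vertices (strand_map n cs fs)" if p: "p \<in> {0<..r}" for p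
  proof -
    obtain a where "a \<in> moved (factor_at fs p)" using inner_moved p by auto
    then have "(a, p, True) \<in> D" "block p = orbit \<rho> (a, p, True)"
      using p inner_in[of p a] vertex_inner[of p a] by auto
    then show ?thesis by (auto simp: vertices_def vertex_of_def)
  qed
  moreover have "{(a, 0, True)} \<in> vertices (strand_map n cs fs)"
    "{(a, Suc r, False)} \<in> vertices (strand_map n cs fs)" if "a \<in> {1..n}" for a
    using that vertex_source[of a True] vertex_sink[of a False]
    unfolding vertices_def vertex_of_def by (auto intro!: image_eqI)
  ultimately show "source_vertices \<union> sink_vertices \<union> block ` {0<..r} \<subseteq> vertices (strand_map n cs fs)"
    by blast
qed

lemma finite_moved: "finite (moved (factor_at fs p))"
  using permutes_moved_subset[OF factor_permutes] finite_subset by blast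

lemma card_block: "card (block p) = 2 * card (moved (factor_at fs p))"
  using finite_moved by (simp add: block_def card_cartesian_product)

lemma card_moved_inner: "0 < p \<Longrightarrow> p \<le> r \<Longrightarrow> 2 \<le> card (moved (factor_at fs p))"
  using cyclic_perm_card factor_cyclic by blast

lemma inj_block: "inj_on block {0<..r}"
proof (rule inj_onI)
  fix p q assume p: "p \<in> {0<..r}" and "q \<in> {0<..r}" and eq: "block p = block q"
  obtain a where "a \<in> moved (factor_at fs p)" using inner_moved p by auto
  then have "(a, p, True) \<in> block q" using eq by (auto simp: block_def)
  then show "p = q" by (auto simp: block_def)
qed

lemma sources_eq: "sources (strand_map n cs fs) = source_vertices"
proof -
  have "\<not> block p \<subseteq> {d \<in> D. snd (snd d)}" if "p \<in> {0<..r}" for p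
  proof -
    obtain a where "a \<in> moved (factor_at fs p)" using inner_moved \<open>p \<in> {0<..r}\<close> by auto
    then have "(a, p, False) \<in> block p" by (auto simp: block_def)
    then show ?thesis by auto
  qed
  then show ?thesis by (auto simp: sources_def vertices_eq)
qed

lemma sinks_eq: "sinks (strand_map n cs fs) = sink_vertices"
proof -
  have "block p \<inter> {d \<in> D. snd (snd d)} \<noteq> {}" if p: "p \<in> {0<..r}" for p
  proof -
    obtain a where "a \<in> moved (factor_at fs p)" using inner_moved p by auto
    then have "(a, p, True) \<in> block p" "(a, p, True) \<in> D" using p inner_in[of p a] by (auto simp: block_def)
    then show ?thesis by auto
  qed
  then show ?thesis by (auto simp: sinks_def vertices_eq)
qed

lemma card_vertices: "card (vertices (strand_map n cs fs)) = 2 * n + r"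
proof -
  have i: "inj_on (\<lambda>a. {(a, 0::nat, True)}) {1..n}" "inj_on (\<lambda>a. {(a, Suc r, False)}) {1..n}"
    by (auto simp: inj_on_def)
  have "source_vertices \<inter> sink_vertices = {}" by auto
  moreover have "(source_vertices \<union> sink_vertices) \<inter> block ` {0<..r} = {}"
  proof -
    have "card v = 1" if "v \<in> source_vertices \<union> sink_vertices" for v
      using that by auto
    moreover have "card v \<noteq> 1" if "v \<in> block ` {0<..r}" for v
      using that card_block by auto
    ultimately show ?thesis by blast
  qed
  ultimately have "card (vertices (strand_map n cs fs)) = card source_vertices + card sink_vertices + card (block ` {0<..r})"
    unfolding vertices_eq by (subst card_Un_disjoint; (subst card_Un_disjoint)?) auto
  then show ?thesis using card_image[OF i(1)] card_image[OF i(2)] card_image[OF inj_block] by simp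
qed

text \<open>Each edge has exactly one out-half: n of them leave sources, and a factor of length k
  contributes the k that leave its vertex.\<close>

lemma card_edges: "card (edges (strand_map n cs fs)) = n + (\<Sum>\<sigma>\<leftarrow>fs. card (moved \<sigma>))"
proof -
  let ?O = "{d \<in> D. snd (snd d)}"
  have "edges (strand_map n cs fs) = (\<lambda>d. {d, \<epsilon> d}) ` ?O"
  proof -
    have "{d, \<epsilon> d} \<in> (\<lambda>d. {d, \<epsilon> d}) ` ?O" if "d \<in> D" for d
    proof (cases "snd (snd d)")
      case False
      then have "\<epsilon> d \<in> ?O" "{d, \<epsilon> d} = {\<epsilon> d, \<epsilon> (\<epsilon> d)}"
        using that opp_D opp_snd opp_opp by auto
      then show ?thesis by blast
    qed (use that in auto)
    then show ?thesis by (auto simp: edges_def)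
  qed
  moreover have "inj_on (\<lambda>d. {d, \<epsilon> d}) ?O"
  proof (rule inj_onI)
    fix x y assume x: "x \<in> ?O" and y: "y \<in> ?O" and eq: "{x, \<epsilon> x} = {y, \<epsilon> y}"
    have "\<not> snd (snd (\<epsilon> y))" using y opp_snd by simp
    then have "x \<noteq> \<epsilon> y" using x by auto
    then show "x = y" using eq by auto
  qed
  ultimately have "card (edges (strand_map n cs fs)) = card ?O"
    by (simp add: card_image)
  \<comment> \<open>Out-darts are indexed by position first, with position 0 for the sources, so
    that the cardinality splits into a sum over the factors.\<close>
  also have "?O = (\<lambda>(p, a). (a, p, True)) ` (SIGMA p : {0..r}. if p = 0 then {1..n} else moved (factor_at fs p))"
  proof
    show "?O \<subseteq> (\<lambda>(p, a). (a, p, True)) ` (SIGMA p : {0..r}. if p = 0 then {1..n} else moved (factor_at fs p))"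
    proof
      fix d assume d: "d \<in> ?O"
      then have "d \<in> D" by simp
      then show "d \<in> (\<lambda>(p, a). (a, p, True)) ` (SIGMA p : {0..r}. if p = 0 then {1..n} else moved (factor_at fs p))"
        by (cases rule: dart_cases) (use d in \<open>auto intro!: image_eqI[of _ _ "(_, _)"] simp: atLeastAtMost_iff\<close>)
    qed
    show "(\<lambda>(p, a). (a, p, True)) ` (SIGMA p : {0..r}. if p = 0 then {1..n} else moved (factor_at fs p)) \<subseteq> ?O"
    proof clarify
      fix p a assume "p \<in> {0..r}" "a \<in> (if p = 0 then {1..n} else moved (factor_at fs p))"
      then show "(a, p, True) \<in> D \<and> snd (snd (a, p, True))"
        using inner_in[of p a True] by (cases "p = 0") (auto simp: atLeastAtMost_iff[of p])
    qed
  qed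
  also have "card \<dots> = card (SIGMA p : {0..r}. if p = 0 then {1..n} else moved (factor_at fs p))"
    by (rule card_image) (auto simp: inj_on_def)
  also have "\<dots> = (\<Sum>p\<in>{0..r}. card (if p = 0 then {1..n} else moved (factor_at fs p)))"
    using finite_moved by (intro card_SigmaI) auto
  also have "\<dots> = n + (\<Sum>i\<in>{0..<r}. card (moved (fs ! i)))"
    by (simp add: atLeast0AtMost sum.atMost_shift atLeast0LessThan factor_at_Suc)
  also have "(\<Sum>i\<in>{0..<r}. card (moved (fs ! i))) = (\<Sum>\<sigma>\<leftarrow>fs. card (moved \<sigma>))"
    by (simp add: sum_list_sum_nth)
  finally show ?thesis .
qed

lemma faces_eq:
  "faces (strand_map n cs fs) = (\<lambda>C. {d \<in> D. face_label fs d \<in> C}) ` perm_cycles n \<pi>"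
proof -
  have f: "faces (strand_map n cs fs) = orbit \<phi> ` D"
    by (simp add: faces_def)
  have "faces (strand_map n cs fs) = (\<lambda>a. orbit \<phi> (a, 0, True)) ` {1..n}"
    unfolding f
  proof (intro equalityI image_subsetI)
    show "orbit \<phi> d \<in> (\<lambda>a. orbit \<phi> (a, 0, True)) ` {1..n}" if "d \<in> D" for d
      unfolding face_of_dart[OF that] using label_in[OF that] by (rule imageI)
    show "orbit \<phi> (a, 0, True) \<in> orbit \<phi> ` D" if "a \<in> {1..n}" for a
      by (rule imageI) (use that in simp)
  qed
  then show ?thesis using face_of_source by (simp add: perm_cycles_def image_image)
qed

lemma cycle_subset: "a \<in> {1..n} \<Longrightarrow> orbit \<pi> a \<subseteq> {1..n}"
  using permutes_orbit_subset[OF pi_permutes] .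

text \<open>The dart \<open>(x, 0, True)\<close> has label \<open>x\<close>, so a set of labels can
  be recovered from the source darts in its preimage.\<close>

lemma inj_on_face_of_cycle: "inj_on (\<lambda>C. {d \<in> D. face_label fs d \<in> C}) (Pow {1..n})"
proof (rule inj_onI)
  fix A B assume A: "A \<in> Pow {1..n}" and B: "B \<in> Pow {1..n}"
    and eq: "{d \<in> D. face_label fs d \<in> A} = {d \<in> D. face_label fs d \<in> B}"
  have "x \<in> A \<longleftrightarrow> x \<in> B" if "x \<in> {1..n}" for x
    using that eq[unfolded set_eq_iff, rule_format, of "(x, 0, True)"] by simp
  then show "A = B" using A B by blast
qed

lemma perm_cycles_subset: "perm_cycles n \<pi> \<subseteq> Pow {1..n}"
  using cycle_subset by (auto simp: perm_cycles_def)

lemma card_faces: "card (faces (strand_map n cs fs)) = card (perm_cycles n \<pi>)"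
  unfolding faces_eq using inj_on_subset[OF inj_on_face_of_cycle perm_cycles_subset] by (rule card_image)

lemma depth_eq: "int (depth n fs) = (\<Sum>\<sigma>\<leftarrow>fs. int (card (moved \<sigma>))) - int r"
proof -
  have "int (\<Sum>\<sigma>\<leftarrow>gs. card (moved \<sigma>) - 1) = (\<Sum>\<sigma>\<leftarrow>gs. int (card (moved \<sigma>))) - int (length gs)"
    if "set gs \<subseteq> set fs" for gs
    using that
  proof (induction gs)
    case (Cons \<sigma> gs)
    then have "2 \<le> card (moved \<sigma>)" using factors cyclic_perm_card by auto
    then show ?case using Cons by (simp add: of_nat_diff)
  qed simp
  then show ?thesis using depth_cyclic factors by auto
qed

text \<open>There are \<open>2 * n + r\<close> vertices, n plus the total length of the factors many
  edges, and one face per cycle of \<pi>. Since depth is total length minus \<open>r\<close>,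
  vertices minus edges plus faces is n plus the number of cycles minus depth.\<close>

lemma has_genus_iff:
  "has_genus (strand_map n cs fs) g \<longleftrightarrow>
     int (depth n fs) = int n + int (card (perm_cycles n \<pi>)) - 2 + 2 * int g"
proof -
  have "int (\<Sum>\<sigma>\<leftarrow>fs. card (moved \<sigma>)) = (\<Sum>\<sigma>\<leftarrow>fs. int (card (moved \<sigma>)))"
    by (induction fs) auto
  then show ?thesis
    unfolding has_genus_def card_vertices card_edges card_faces depth_eq by auto
qed

lemma alternating_strand_map: "alternating (strand_map n cs fs)"
  unfolding alternating_def
proof (intro ballI impI)
  fix d assume d: "d \<in> darts (strand_map n cs fs)" "rot (strand_map n cs fs) d \<noteq> d"
  then have "d \<in> D" by simp
  then show "rot (strand_map n cs fs) d \<in> outs (strand_map n cs fs) \<longleftrightarrow> d \<notin> outs (strand_map n cs fs)"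
  proof (cases rule: dart_cases)
    case (3 a p b)
    then show ?thesis using \<open>d \<in> D\<close> rot_D[of d] rot_in[of a p] rot_out[of a p] by (cases b) auto
  qed (use d rot_end in auto)
qed

lemma vertex_of_position:
  assumes "d \<in> D" "x \<in> orbit \<rho> d"
  shows "fst (snd x) = fst (snd d)"
  using assms(1)
proof (cases rule: dart_cases)
  case 1
  then show ?thesis using assms(2) by (simp add: vertex_source)
next
  case 2
  then show ?thesis using assms(2) by (simp add: vertex_sink)
next
  case (3 a p b)
  then have "x \<in> block p" using assms(2) vertex_inner[OF 3(1-3)] by metis
  then show ?thesis unfolding block_def 3(4) by auto
qed

lemma opp_position:
  assumes "d \<in> D" "snd (snd d)"
  shows "fst (snd d) < fst (snd (\<epsilon> d))"
proof -
  obtain a p where d: "d = (a, p, True)" using assms(2) by (cases d) auto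
  then have *: "(a, p, True) \<in> D" using assms(1) by simp
  show ?thesis unfolding d opp_out[OF *] using next_visit_gt[OF out_le[OF *]] by simp
qed

text \<open>The position is constant on a vertex and strictly increases along every edge, so it
  obstructs directed cycles.\<close>

lemma acyclic_strand_map: "acyclic_map (strand_map n cs fs)"
proof -
  let ?M = "strand_map n cs fs"
  \<comment> \<open>Positions belong to darts, so the induction carries representatives of both end
    vertices instead of a function on vertices.\<close>
  have "\<exists>x y. x \<in> D \<and> y \<in> D \<and> u = orbit \<rho> x \<and> v = orbit \<rho> y \<and> fst (snd x) < fst (snd y)"
    if "(u, v) \<in> (arc_rel ?M)\<^sup>+" for u v
    using that
  proof (induction rule: trancl_induct)
    case (base v)
    then obtain d where "d \<in> D" "snd (snd d)" "u = orbit \<rho> d" "v = orbit \<rho> (\<epsilon> d)"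
      unfolding arc_rel_def vertex_of_def strand_map_sel by blast
    then show ?case using opp_D opp_position by blast
  next
    case (step v w)
    obtain x y where xy: "x \<in> D" "y \<in> D" "u = orbit \<rho> x" "v = orbit \<rho> y" "fst (snd x) < fst (snd y)"
      using step by blast
    obtain d where d: "d \<in> D" "snd (snd d)" "v = orbit \<rho> d" "w = orbit \<rho> (\<epsilon> d)"
      using step(2) unfolding arc_rel_def vertex_of_def strand_map_sel by blast
    have "d \<in> orbit \<rho> y" using xy(4) d(3) permutes_self_in_orbit[OF rot_permutes finite_D] by metis
    then have "fst (snd d) = fst (snd y)" using vertex_of_position xy by blast
    then have "fst (snd x) < fst (snd (\<epsilon> d))" using xy(5) opp_position[OF d(1,2)] by simp
    then show ?case using xy(1,3) d(1,4) opp_D by blast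
  qed
  moreover have False if "x \<in> D" "y \<in> D" "orbit \<rho> x = orbit \<rho> y" "fst (snd x) < fst (snd y)" for x y
  proof -
    have "x \<in> orbit \<rho> y" using that(3) permutes_self_in_orbit[OF rot_permutes finite_D] by metis
    then show False using vertex_of_position that by fastforce
  qed
  ultimately show ?thesis unfolding acyclic_map_def acyclic_def by blast
qed

section \<open>Transitivity of the factors as connectedness of the map\<close>

definition linked :: "nat \<Rightarrow> nat \<Rightarrow> bool" where
  "linked x y \<longleftrightarrow> (\<exists>h\<in>generate (sym_group n) (set fs). h x = y)"

lemma linked_refl: "linked x x"
  unfolding linked_def using generate.one[of "sym_group n" "set fs"] unfolding sym_group_one
  by (rule bexI[rotated]) simp

lemma linked_trans: "linked x y \<Longrightarrow> linked y z \<Longrightarrow> linked x z"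
  unfolding linked_def using generate.eng[of _ "sym_group n" "set fs"]
  by (metis comp_apply sym_group_mult)

lemma linked_orbit:
  assumes "\<sigma> \<in> set fs" "y \<in> orbit \<sigma> x"
  shows "linked x y"
  using assms(2)
proof induction
  case base
  then show ?case using assms(1) generate.incl unfolding linked_def by metis
next
  case (step y)
  have "linked y (\<sigma> y)" using assms(1) generate.incl unfolding linked_def by metis
  then show ?case using step linked_trans by blast
qed

lemma transitive_factors_iff: "transitive_factors n fs \<longleftrightarrow> (\<forall>x\<in>{1..n}. \<forall>y\<in>{1..n}. linked x y)"
  by (simp add: transitive_factors_def linked_def)

text \<open>Strands through a common vertex lie in one orbit of its factor, and powers of that
  factor belong to the generated group.\<close>

lemma linked_vertex:
  assumes "d \<in> D" "e \<in> orbit \<rho> d"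
  shows "linked (fst d) (fst e)"
  using assms(1)
proof (cases rule: dart_cases)
  case (1 a)
  then show ?thesis using assms(2) vertex_source[of a True] linked_refl by simp
next
  case (2 a)
  then show ?thesis using assms(2) vertex_sink[of a False] linked_refl by simp
next
  case (3 a p b)
  then have "e \<in> block p" using assms(2) vertex_inner[OF 3(1-3)] by metis
  then have "fst e \<in> moved (factor_at fs p)" unfolding block_def by auto
  also have "moved (factor_at fs p) = orbit (factor_at fs p) a"
    using factor_cyclic[OF 3(1,2)] 3(3) unfolding cyclic_perm_def by blast
  finally show ?thesis
    using linked_orbit[of "factor_at fs p" "fst e" a] 3 by (simp add: factor_at_def)
qed

text \<open>Arcs do not depend on the base points, so the empty list serves as a representative for
  all choices.\<close>

abbreviation connected_rel :: "(nat \<times> nat \<times> bool) set rel" where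
  "connected_rel \<equiv> (arc_rel (strand_map n [] fs) \<union> (arc_rel (strand_map n [] fs))\<inverse>)\<^sup>*"

lemma arc_rel_eq: "arc_rel (strand_map n cs fs) = arc_rel (strand_map n [] fs)"
  by (simp add: arc_rel_def vertex_of_def)

lemma connected_sym: "(u, v) \<in> connected_rel \<Longrightarrow> (v, u) \<in> connected_rel"
  by (meson sym_Un_converse sym_rtrancl symD)

lemma connected_trans: "(u, v) \<in> connected_rel \<Longrightarrow> (v, w) \<in> connected_rel \<Longrightarrow> (u, w) \<in> connected_rel"
  by (rule rtrancl_trans)

lemma connected_arc:
  assumes "d \<in> D" "snd (snd d)"
  shows "(orbit \<rho> d, orbit \<rho> (\<epsilon> d)) \<in> connected_rel"
proof -
  have "(orbit \<rho> d, orbit \<rho> (\<epsilon> d)) \<in> arc_rel (strand_map n [] fs)"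
    unfolding arc_rel_def vertex_of_def strand_map_sel using assms by blast
  then show ?thesis by blast
qed

lemma connected_strand:
  assumes "(a, p, b) \<in> D"
  shows "(orbit \<rho> (a, 0, True), orbit \<rho> (a, p, b)) \<in> connected_rel"
  using assms
proof (induction p arbitrary: b rule: less_induct)
  case (less p)
  have F: "(orbit \<rho> (a, 0, True), orbit \<rho> (a, p, False)) \<in> connected_rel" if F: "(a, p, False) \<in> D"
  proof -
    let ?q = "prev_visit fs a p"
    have "?q < p" using prev_visit_less[OF in_pos[OF F]] .
    then have "(orbit \<rho> (a, 0, True), orbit \<rho> (a, ?q, True)) \<in> connected_rel"
      using less.IH prev_dart[OF F] by blast
    moreover have "(orbit \<rho> (a, ?q, True), orbit \<rho> (a, p, False)) \<in> connected_rel"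
      using connected_arc[OF prev_dart[OF F]] opp_opp[OF F] opp_in[OF F] by simp
    ultimately show ?thesis by (rule connected_trans)
  qed
  show ?case
  proof (cases b)
    case False
    then show ?thesis using F less.prems by simp
  next
    case b: True
    show ?thesis
    proof (cases "p = 0")
      case True
      then show ?thesis using b by simp
    next
      case False
      then have p: "0 < p" "p \<le> r" using out_le less.prems b by auto
      then have a: "a \<in> moved (factor_at fs p)" using inner_in[OF p] less.prems by blast
      have "(a, p, False) \<in> D" using flip_dart[OF less.prems p] .
      then show ?thesis using F vertex_inner[OF p a] by metis
    qed
  qed
qed

lemma connected_factor:
  assumes "\<sigma> \<in> set fs" "a \<in> {1..n}"
  shows "(orbit \<rho> (a, 0, True), orbit \<rho> (\<sigma> a, 0, True)) \<in> connected_rel"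
proof (cases "\<sigma> a = a")
  case False
  obtain i where i: "i < r" "\<sigma> = fs ! i" using assms(1) by (auto simp: in_set_conv_nth)
  then have p: "0 < Suc i" "Suc i \<le> r" "\<sigma> = factor_at fs (Suc i)" by (auto simp: factor_at_Suc)
  have a: "a \<in> moved (factor_at fs (Suc i))" using False p by simp
  then have b: "\<sigma> a \<in> moved (factor_at fs (Suc i))"
    using p permutes_inj[OF factor_permutes[of "Suc i"]] by (auto dest: injD)
  have "(orbit \<rho> (x, 0, True), block (Suc i)) \<in> connected_rel"
    if x: "x \<in> moved (factor_at fs (Suc i))" for x
  proof -
    have "(x, Suc i, True) \<in> D" using inner_in[OF p(1,2), of x True] x by blast
    then have "(orbit \<rho> (x, 0, True), orbit \<rho> (x, Suc i, True)) \<in> connected_rel"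
      by (rule connected_strand)
    then show ?thesis unfolding vertex_inner[OF p(1,2) x] .
  qed
  from this[OF a] this[OF b] show ?thesis using connected_sym connected_trans by blast
qed simp

text \<open>Connectedness is symmetric and transitive, hence passes from the factors to inverses and
  composites. That \<open>h\<close> permutes {1..n} is carried along to keep the intermediate points
  in range.\<close>

lemma connected_generate:
  assumes "h \<in> generate (sym_group n) (set fs)"
  shows "h permutes {1..n} \<and>
    (\<forall>a\<in>{1..n}. (orbit \<rho> (a, 0, True), orbit \<rho> (h a, 0, True)) \<in> connected_rel)"
  using assms
proof induction
  case one
  show ?case unfolding sym_group_one by (intro conjI ballI permutes_id) simp
next
  case (incl h)
  then show ?case using connected_factor factors by (auto simp: cyclic_perm_def)
next
  case (inv h)
  then have h: "h permutes {1..n}" using factors by (simp add: cyclic_perm_def)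
  then have "inv\<^bsub>sym_group n\<^esub> h = inv' h" by (simp add: sym_group_carrier)
  moreover have "(orbit \<rho> (a, 0, True), orbit \<rho> (inv' h a, 0, True)) \<in> connected_rel" if "a \<in> {1..n}" for a
  proof -
    have "inv' h a \<in> {1..n}" using permutes_in_image[OF permutes_inv[OF h]] that by simp
    then have "(orbit \<rho> (inv' h a, 0, True), orbit \<rho> (h (inv' h a), 0, True)) \<in> connected_rel"
      using connected_factor[OF inv] by blast
    moreover have "h (inv' h a) = a" using permutes_inverses(1)[OF h] .
    ultimately show ?thesis using connected_sym by metis
  qed
  ultimately show ?case using permutes_inv[OF h] by simp
next
  case (eng h1 h2)
  then have "h2 a \<in> {1..n}" if "a \<in> {1..n}" for a using permutes_in_image that by metis
  then have "(orbit \<rho> (a, 0, True), orbit \<rho> (h1 (h2 a), 0, True)) \<in> connected_rel" if "a \<in> {1..n}" for a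
    using eng.IH that connected_trans by blast
  moreover have "(h1 \<circ> h2) permutes {1..n}" using eng.IH permutes_compose by blast
  ultimately show ?case unfolding sym_group_mult comp_apply by blast
qed

text \<open>Crossing an edge stays on its strand, and changing darts at a vertex leads to a linked
  strand.\<close>

lemma connected_imp_linked:
  assumes "(orbit \<rho> d, v) \<in> connected_rel" "d \<in> D"
  shows "\<exists>e\<in>D. v = orbit \<rho> e \<and> linked (fst d) (fst e)"
  using assms(1)
proof (induction rule: rtrancl_induct)
  case base
  then show ?case using assms(2) linked_refl by blast
next
  case (step v w)
  then obtain e where e: "e \<in> D" "v = orbit \<rho> e" "linked (fst d) (fst e)" by blast
  obtain x where x: "x \<in> D" "(v = orbit \<rho> x \<and> w = orbit \<rho> (\<epsilon> x)) \<or> (w = orbit \<rho> x \<and> v = orbit \<rho> (\<epsilon> x))"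
    using step(2) unfolding arc_rel_def vertex_of_def strand_map_sel by blast
  then obtain y where y: "y \<in> D" "v = orbit \<rho> y" "w = orbit \<rho> (\<epsilon> y)"
    using opp_D opp_opp by metis
  have "y \<in> orbit \<rho> e" using y e permutes_self_in_orbit[OF rot_permutes finite_D] by metis
  then have "linked (fst d) (fst y)" using linked_vertex e linked_trans by blast
  moreover have "fst (\<epsilon> y) = fst y"
    using y(1) by (cases y) (auto simp: strand_opp_def)
  ultimately show ?case using y opp_D by metis
qed

text \<open>All clauses of \<open>directed_map\<close> except connectedness hold for every strand
  map. Sources represent the strands, and a source vertex has a single dart, so it recovers its
  strand exactly.\<close>

lemma directed_map_iff: "directed_map (strand_map n cs fs) \<longleftrightarrow> transitive_factors n fs"
proof -
  have "(1, 0, True) \<in> D" unfolding source_in using n_pos by (simp add: atLeastAtMost_iff)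
  then have "D \<noteq> {}" by blast
  moreover have "\<epsilon> d \<noteq> d" if "d \<in> D" for d using opp_snd[OF that] by auto
  ultimately have "directed_map (strand_map n cs fs) \<longleftrightarrow>
      (\<forall>u\<in>vertices (strand_map n cs fs). \<forall>v\<in>vertices (strand_map n cs fs). (u, v) \<in> connected_rel)"
    unfolding directed_map_def arc_rel_eq[of cs]
    using finite_D rot_permutes opp_permutes opp_opp opp_D opp_snd by auto
  also have "\<dots> \<longleftrightarrow> transitive_factors n fs"
  proof
    assume c: "\<forall>u\<in>vertices (strand_map n cs fs). \<forall>v\<in>vertices (strand_map n cs fs). (u, v) \<in> connected_rel"
    have "linked x y" if x: "x \<in> {1..n}" and y: "y \<in> {1..n}" for x y
    proof -
      have "orbit \<rho> (a, 0, True) \<in> vertices (strand_map n cs fs)" if "a \<in> {1..n}" for a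
        unfolding vertices_def vertex_of_def strand_map_sel by (rule imageI) (use that in simp)
      then have "(orbit \<rho> (x, 0, True), orbit \<rho> (y, 0, True)) \<in> connected_rel" using x y c by blast
      moreover have "(x, 0, True) \<in> D" using x by simp
      ultimately obtain e where e: "e \<in> D" "orbit \<rho> (y, 0, True) = orbit \<rho> e" "linked x (fst e)"
        using connected_imp_linked[of "(x, 0, True)"] by (metis fst_conv)
      have "e \<in> orbit \<rho> (y, 0, True)" using e permutes_self_in_orbit[OF rot_permutes finite_D] by metis
      then have "e = (y, 0, True)" unfolding vertex_source by simp
      then show ?thesis using e(3) by simp
    qed
    then show "transitive_factors n fs" by (simp add: transitive_factors_iff)
  next
    assume t: "transitive_factors n fs"
    have "(orbit \<rho> d, orbit \<rho> e) \<in> connected_rel" if d: "d \<in> D" and e: "e \<in> D" for d e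
    proof -
      have in_n: "fst x \<in> {1..n}" if "x \<in> D" for x using that by (cases x) (auto simp: darts_iff)
      obtain h where "h \<in> generate (sym_group n) (set fs)" "h (fst d) = fst e"
        using t d e in_n unfolding transitive_factors_def by blast
      then have de: "(orbit \<rho> (fst d, 0, True), orbit \<rho> (fst e, 0, True)) \<in> connected_rel"
        using connected_generate in_n[OF d] by metis
      have strand: "(orbit \<rho> (fst x, 0, True), orbit \<rho> x) \<in> connected_rel" if "x \<in> D" for x
        using connected_strand[of "fst x" "fst (snd x)" "snd (snd x)"] that by simp
      show ?thesis
        by (rule connected_trans[OF connected_sym[OF strand[OF d]] connected_trans[OF de strand[OF e]]])
    qed
    then show "\<forall>u\<in>vertices (strand_map n cs fs). \<forall>v\<in>vertices (strand_map n cs fs). (u, v) \<in> connected_rel"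
      unfolding vertices_def vertex_of_def strand_map_sel by blast
  qed
  finally show ?thesis .
qed

section \<open>Vertex degrees and the contents of faces\<close>

lemma card_vertices_degree:
  assumes "2 \<le> k"
  shows "card {v \<in> vertices (strand_map n cs fs). degree v = 2 * k} = signature n fs k"
proof -
  have "degree v = 1" if "v \<in> source_vertices \<union> sink_vertices" for v
    using that by auto
  then have "v \<notin> source_vertices \<union> sink_vertices" if "degree v = 2 * k" for v
    using assms that by fastforce
  then have "{v \<in> vertices (strand_map n cs fs). degree v = 2 * k} = {v \<in> block ` {0<..r}. degree v = 2 * k}"
    unfolding vertices_eq by blast
  then have "card {v \<in> vertices (strand_map n cs fs). degree v = 2 * k}
      = card {p \<in> {0<..r}. card (moved (factor_at fs p)) = k}"
    by (simp add: card_inj_image_filter[OF inj_block] card_block)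
  also have "{p \<in> {0<..r}. card (moved (factor_at fs p)) = k} = Suc ` {i. i < r \<and> card (moved (fs ! i)) = k}"
  proof (intro equalityI subsetI)
    fix p assume p: "p \<in> {p \<in> {0<..r}. card (moved (factor_at fs p)) = k}"
    then obtain i where "p = Suc i" "i < r" by (cases p) auto
    then show "p \<in> Suc ` {i. i < r \<and> card (moved (fs ! i)) = k}" using p by (simp add: factor_at_Suc)
  qed (auto simp: factor_at_Suc)
  also have "card \<dots> = length (filter (\<lambda>\<sigma>. card (moved \<sigma>) = k) fs)"
    by (simp add: card_image length_filter_conv_card)
  also have "\<dots> = signature n fs k"
    using signature_cyclic[OF factors assms] by simp
  finally show ?thesis .
qed

lemma vertex_kinds:
  assumes "v \<in> vertices (strand_map n cs fs)"
  shows "v \<in> sources (strand_map n cs fs) \<or> v \<in> sinks (strand_map n cs fs) \<or> even (degree v) \<and> 4 \<le> degree v"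
  using assms card_block card_moved_inner unfolding sources_eq sinks_eq vertices_eq by fastforce

lemma source_in_face_iff:
  assumes "c \<in> {1..n}" "a \<in> {1..n}"
  shows "contained_in_face {(a, 0, True)} (orbit \<phi> (c, 0, True)) \<longleftrightarrow> a \<in> orbit \<pi> c"
  unfolding face_of_source[OF assms(1)] contained_in_face_def using assms(2) by simp

text \<open>The sink of strand \<open>a\<close> carries the label \<open>\<pi> a\<close>, in the
  same cycle as \<open>a\<close>. Hence the source and the sink of a strand share a face, which is
  why the two counts per face agree.\<close>

lemma sink_in_face_iff:
  assumes "c \<in> {1..n}" "a \<in> {1..n}"
  shows "contained_in_face {(a, Suc r, False)} (orbit \<phi> (c, 0, True)) \<longleftrightarrow> a \<in> orbit \<pi> c"
proof -
  have "face_label fs (a, Suc r, False) = \<pi> a"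
    using prefix_product_end[of fs] by (simp add: face_label_def)
  moreover have "\<pi> a \<in> orbit \<pi> c \<longleftrightarrow> a \<in> orbit \<pi> c"
    by (metis finite_atLeastAtMost orbit.base orbit.step permutes_orbit_eq permutes_self_in_orbit pi_permutes)
  ultimately show ?thesis
    unfolding face_of_source[OF assms(1)] contained_in_face_def using assms(2) by simp
qed

lemma card_sources_in_face:
  assumes "c \<in> {1..n}"
  shows "card {v \<in> sources (strand_map n cs fs). contained_in_face v (orbit \<phi> (c, 0, True))} = card (orbit \<pi> c)"
proof -
  have "card {v \<in> sources (strand_map n cs fs). contained_in_face v (orbit \<phi> (c, 0, True))}
      = card {a \<in> {1..n}. contained_in_face {(a, 0, True)} (orbit \<phi> (c, 0, True))}"
    unfolding sources_eq by (rule card_inj_image_filter) (simp add: inj_on_def)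
  also have "{a \<in> {1..n}. contained_in_face {(a, 0, True)} (orbit \<phi> (c, 0, True))} = orbit \<pi> c"
    using source_in_face_iff[OF assms] cycle_subset[OF assms] by blast
  finally show ?thesis .
qed

lemma card_sinks_in_face:
  assumes "c \<in> {1..n}"
  shows "card {v \<in> sinks (strand_map n cs fs). contained_in_face v (orbit \<phi> (c, 0, True))} = card (orbit \<pi> c)"
proof -
  have "card {v \<in> sinks (strand_map n cs fs). contained_in_face v (orbit \<phi> (c, 0, True))}
      = card {a \<in> {1..n}. contained_in_face {(a, Suc r, False)} (orbit \<phi> (c, 0, True))}"
    unfolding sinks_eq by (rule card_inj_image_filter) (simp add: inj_on_def)
  also have "{a \<in> {1..n}. contained_in_face {(a, Suc r, False)} (orbit \<phi> (c, 0, True))} = orbit \<pi> c"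
    using sink_in_face_iff[OF assms] cycle_subset[OF assms] by blast
  finally show ?thesis .
qed

text \<open>The dictionary between the two sides. Alternation, acyclicity and the kinds of vertices
  are automatic; everything about labels, distinguished sources and \<alpha> is condensed into
  \<open>base_points\<close>.\<close>

lemma correspondence_map_strand_map_iff:
  assumes m: "length \<alpha> = m" and cs: "set cs \<subseteq> {1..n}"
  shows "correspondence_map m g \<alpha> \<beta> (strand_map n cs fs) \<longleftrightarrow>
    transitive_factors n fs \<and>
    int (depth n fs) = int n + int (card (perm_cycles n \<pi>)) - 2 + 2 * int g \<and>
    (\<forall>k\<ge>2. signature n fs k = \<beta> k) \<and> base_points n \<pi> \<alpha> cs"
proof -
  let ?M = "strand_map n cs fs"
  let ?F = "\<lambda>C. {d \<in> D. face_label fs d \<in> C}"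
  have fl: "face_list ?M = map ?F (map (orbit \<pi>) cs)"
    using cs face_of_source by auto
  have cyc: "orbit \<pi> ` set cs \<subseteq> Pow {1..n}" using cs cycle_subset by blast
  have dist: "distinct (face_list ?M) \<longleftrightarrow> distinct (map (orbit \<pi>) cs)"
    unfolding fl distinct_map[of ?F] using inj_on_subset[OF inj_on_face_of_cycle cyc] by simp
  have set: "set (face_list ?M) = faces ?M \<longleftrightarrow> orbit \<pi> ` set cs = perm_cycles n \<pi>"
    unfolding fl faces_eq set_map
    using inj_on_image_eq_iff[OF inj_on_face_of_cycle cyc perm_cycles_subset] .
  have csi: "cs ! i \<in> {1..n}" if "i < length cs" for i using that cs by (meson nth_mem subsetD)
  have counts: "card {v \<in> sources ?M. contained_in_face v (face_list ?M ! i)} = card (orbit \<pi> (cs ! i))"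
    "card {v \<in> sinks ?M. contained_in_face v (face_list ?M ! i)} = card (orbit \<pi> (cs ! i))" 
    if "i < length cs" for i
    using that csi[OF that] card_sources_in_face card_sinks_in_face by simp_all
  have disting: "distinguished ?M ! i \<in> sources ?M \<and> contained_in_face (distinguished ?M ! i) (face_list ?M ! i)"
    if "i < length cs" for i
    using that csi[OF that] source_in_face_iff permutes_self_in_orbit[OF pi_permutes] by (simp add: sources_eq)
  have len: "length (face_list ?M) = length cs" "length (distinguished ?M) = length cs" by simp_all
  show ?thesis
    unfolding correspondence_map_def base_points_def directed_map_iff has_genus_iff dist set len
    using alternating_strand_map acyclic_strand_map vertex_kinds card_vertices_degree counts disting m cs
    by (auto simp del: strand_map_sel)
qed

end

section \<open>Commutation of factors and isomorphism of maps\<close>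

lemma commutation_step_invariant:
  assumes "(fs, fs') \<in> commutation_step" "\<And>\<sigma>. \<sigma> \<in> set fs \<Longrightarrow> inj \<sigma>"
  shows "set fs' = set fs" "foldr (\<circ>) fs' id = foldr (\<circ>) fs id"
    "length (filter P fs') = length (filter P fs)"
proof -
  obtain us \<sigma> \<tau> vs where e: "fs = us @ [\<sigma>, \<tau>] @ vs" "fs' = us @ [\<tau>, \<sigma>] @ vs" "disjoint_perms \<sigma> \<tau>"
    using assms(1) unfolding commutation_step_def by blast
  show "set fs' = set fs" "length (filter P fs') = length (filter P fs)"
    unfolding e by auto
  have "\<sigma> \<circ> \<tau> = \<tau> \<circ> \<sigma>"
    using disjoint_perms_comp_commute[OF e(3)] assms(2) e(1) by simp
  then have "foldr (\<circ>) [\<tau>, \<sigma>] id = foldr (\<circ>) [\<sigma>, \<tau>] id" by (simp add: comp_assoc)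
  then show "foldr (\<circ>) fs' id = foldr (\<circ>) fs id"
    unfolding e foldr_comp_append by (rule arg_cong2[of _ _ _ _ "\<lambda>x y. x \<circ> y", OF refl arg_cong[of _ _ "\<lambda>x. x \<circ> foldr (\<circ>) vs id"]])
qed

lemma genus_factorization_commute:
  assumes "(fs, fs') \<in> commutation_step" "genus_factorization n g \<pi> fs"
  shows "genus_factorization n g \<pi> fs'" "signature n fs' = signature n fs"
proof -
  have "inj \<sigma>" if "\<sigma> \<in> set fs" for \<sigma>
    using that assms(2) permutes_inj unfolding genus_factorization_def cycle_factorization_def
      ex_is_k_cycle_iff cyclic_perm_def by blast
  note inv = commutation_step_invariant[OF assms(1) this]
  show s: "signature n fs' = signature n fs"
    by (rule ext) (simp add: signature_def inv)
  show "genus_factorization n g \<pi> fs'"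
    using assms(2) s unfolding genus_factorization_def cycle_factorization_def
      transitive_factors_def depth_def by (simp add: inv)
qed

text \<open>The map only remembers the order of the factors along each single strand, so positions
  may be permuted by any \<open>f\<close> that is increasing on the visits of every strand.\<close>

lemma position_map_hom:
  assumes A: "factor_strands n fs" and B: "factor_strands n fs'"
    and bij: "bij f" and f0: "f 0 = 0" and fr: "f (Suc (length fs)) = Suc (length fs')"
    and fac: "\<And>p. factor_at fs' (f p) = factor_at fs p"
    and mono: "\<And>a p q. p < q \<Longrightarrow> visits fs a p \<Longrightarrow> visits fs a q \<Longrightarrow> f p < f q"
  shows "map_hom (\<lambda>(a, p, b). (a, f p, b)) (strand_map n cs fs) (strand_map n cs fs')"
proof -
  interpret A: factor_strands n fs by (rule A)
  interpret B: factor_strands n fs' by (rule B)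
  let ?h = "\<lambda>(a, p, b). (a, f p, b)"
  have inj: "f p = f q \<longleftrightarrow> p = q" for p q using bij by (meson bij_is_inj injD)
  have z: "f p = 0 \<longleftrightarrow> p = 0" and e: "f p = Suc (length fs') \<longleftrightarrow> p = Suc (length fs)" for p
    using inj f0 fr by metis+
  have vis: "visits fs' a (f p) \<longleftrightarrow> visits fs a p" for a p
    by (simp add: visits_def fac z e)
  have dart: "(a, f p, b) \<in> B.D \<longleftrightarrow> (a, p, b) \<in> A.D" for a p b
    by (simp add: A.darts_iff B.darts_iff vis z e)
  have "bij_betw ?h A.D B.D"
  proof (rule bij_betw_imageI)
    show "inj_on ?h A.D" by (auto simp: inj_on_def inj)
    show "?h ` A.D = B.D"
    proof (intro equalityI subsetI)
      fix d assume d: "d \<in> B.D"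
      obtain a p b where dd: "d = (a, p, b)" by (cases d)
      obtain q where q: "p = f q" using bij by (metis bij_pointE)
      show "d \<in> ?h ` A.D"
        by (rule image_eqI[of _ _ "(a, q, b)"]) (use d dart in \<open>auto simp: dd q\<close>)
    qed (auto simp: dart)
  qed
  moreover have "?h (A.\<rho> d) = B.\<rho> (?h d)" if "d \<in> A.D" for d
  proof -
    obtain a p b where d: "d = (a, p, b)" by (cases d)
    then show ?thesis
      using that dart[of a p b] by (simp add: strand_rot_def fac z e)
  qed
  moreover have opp: "?h (A.\<epsilon> d) = B.\<epsilon> (?h d)" if D: "d \<in> A.D" for d
  proof -
    have out: "B.\<epsilon> (a, f p, True) = (a, f (next_visit fs a p), False)" if p: "(a, p, True) \<in> A.D" for a p
    proof -
      have pr: "p \<le> length fs" and va: "visits fs a p" using A.out_le p by (auto simp: A.darts_iff)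
      have "next_visit fs' a (f p) = f (next_visit fs a p)"
      proof (rule next_visit_eqI)
        show "f p < f (next_visit fs a p)"
          using mono[OF next_visit_gt[OF pr] va visits_next_visit[OF pr]] .
        show "visits fs' a (f (next_visit fs a p))" using vis visits_next_visit[OF pr] by simp
        fix s assume s: "f p < s" "s < f (next_visit fs a p)"
        show "\<not> visits fs' a s"
        proof
          assume "visits fs' a s"
          moreover obtain t where t: "s = f t" using bij by (metis bij_pointE)
          ultimately have vt: "visits fs a t" using vis by simp
          \<comment> \<open>As \<open>f\<close> is injective and increasing on the visits of one
            strand, it also reflects their order.\<close>
          have "p < t" using s(1) t mono[OF _ vt va] inj by (metis less_asym nat_neq_iff)
          moreover have "t < next_visit fs a p"
            using s(2) t mono[OF _ visits_next_visit[OF pr] vt] inj by (metis less_asym nat_neq_iff)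
          ultimately show False using not_visits_before_next[OF pr] vt by blast
        qed
      qed
      then show ?thesis using B.opp_out dart p by metis
    qed
    obtain a p b where d: "d = (a, p, b)" by (cases d)
    show ?thesis
    proof (cases b)
      case True
      then show ?thesis using D d out A.opp_out by simp
    next
      case False
      then have F: "(a, p, False) \<in> A.D" using D d by simp
      let ?q = "prev_visit fs a p"
      have q: "(a, ?q, True) \<in> A.D" using A.prev_dart[OF F] .
      have "next_visit fs a ?q = p"
        using next_prev_visit[OF A.in_pos[OF F], of fs a] F by (simp add: A.darts_iff)
      then have "B.\<epsilon> (a, f ?q, True) = (a, f p, False)" using out[OF q] by simp
      then have "B.\<epsilon> (a, f p, False) = (a, f ?q, True)"
        using B.opp_opp[of "(a, f ?q, True)"] q dart by metis
      then show ?thesis using d False A.opp_in[OF F] by simp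
    qed
  qed
  moreover have "?h d \<in> {d \<in> B.D. snd (snd d)} \<longleftrightarrow> d \<in> {d \<in> A.D. snd (snd d)}" if "d \<in> A.D" for d
    using that dart by (cases d) auto
  ultimately show ?thesis unfolding map_hom_def strand_map_sel by blast
qed

lemma commutation_step_map_hom:
  assumes A: "factor_strands n fs" and B: "factor_strands n fs'" and step: "(fs, fs') \<in> commutation_step"
  shows "\<exists>h. map_hom h (strand_map n cs fs) (strand_map n cs fs') \<and>
    (\<forall>a. h (a, 0, True) = (a, 0, True))"
proof -
  obtain us \<sigma> \<tau> vs where e: "fs = us @ [\<sigma>, \<tau>] @ vs" "fs' = us @ [\<tau>, \<sigma>] @ vs" "disjoint_perms \<sigma> \<tau>"
    using step unfolding commutation_step_def by blast
  \<comment> \<open>The factor after \<open>us\<close> has this position because positions of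
    factors start at 1; the isomorphism exchanges it with the next position.\<close>
  let ?i = "Suc (length us)"
  let ?f = "transpose ?i (Suc ?i)"
  have fi: "factor_at fs ?i = \<sigma>" "factor_at fs (Suc ?i) = \<tau>"
    "factor_at fs' ?i = \<tau>" "factor_at fs' (Suc ?i) = \<sigma>"
    by (simp_all add: e factor_at_def nth_append)
  have other: "factor_at fs' p = factor_at fs p" if "p \<noteq> ?i" "p \<noteq> Suc ?i" for p
  proof -
    have "p - 1 < length us \<or> p = 0 \<or> (\<exists>k. p - 1 = length us + Suc (Suc k))"
      using that by presburger
    then show ?thesis by (auto simp: e factor_at_def nth_append)
  qed
  have fac: "factor_at fs' (?f p) = factor_at fs p" for p
    using fi other[of p] by (cases "p = ?i"; cases "p = Suc ?i") (auto simp: transpose_def)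
  have "map_hom (\<lambda>(a, p, b). (a, ?f p, b)) (strand_map n cs fs) (strand_map n cs fs')"
  proof (rule position_map_hom[OF A B bij_transpose _ _ fac])
    fix a p q assume pq: "p < q" "visits fs a p" "visits fs a q"
    \<comment> \<open>A transposition of neighbours inverts the order of this pair alone, and no
      strand visits both positions because the two factors are disjoint.\<close>
    have "\<not> (p = ?i \<and> q = Suc ?i)"
    proof
      assume "p = ?i \<and> q = Suc ?i"
      then have "\<sigma> a \<noteq> a" "\<tau> a \<noteq> a" using pq fi by (auto simp: visits_def e(1))
      then show False using e(3) by (auto simp: disjoint_perms_def)
    qed
    then show "?f p < ?f q" using pq(1) by (auto simp: transpose_def)
  qed (auto simp: e transpose_def)
  moreover have "(\<lambda>(a, p, b). (a, ?f p, b)) (a, 0, True) = (a, 0, True)" for a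
    by (simp add: transpose_def)
  ultimately show ?thesis by blast
qed

section \<open>Rigidity of isomorphisms between strand maps\<close>

lemma filter_factors:
  "filter (\<lambda>\<sigma>. \<sigma> a \<noteq> a) gs = map (factor_at gs) (filter (\<lambda>p. factor_at gs p a \<noteq> a) [1..<Suc (length gs)])"
proof -
  have "gs = map (factor_at gs) [1..<Suc (length gs)]"
    by (rule nth_equalityI) (auto simp: factor_at_def simp del: upt_Suc)
  then have "filter (\<lambda>\<sigma>. \<sigma> a \<noteq> a) gs = filter (\<lambda>\<sigma>. \<sigma> a \<noteq> a) (map (factor_at gs) [1..<Suc (length gs)])"
    by metis
  then show ?thesis by (simp add: filter_map comp_def)
qed

locale strand_map_hom =
  A: factor_strands n fs + B: factor_strands n fs' for n fs fs' +
  fixes h :: "nat \<times> nat \<times> bool \<Rightarrow> nat \<times> nat \<times> bool" and cs cs' :: "nat list"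
  assumes hom: "map_hom h (strand_map n cs fs) (strand_map n cs' fs')"
begin

lemma h_bij: "bij_betw h A.D B.D"
  and h_rot: "d \<in> A.D \<Longrightarrow> h (A.\<rho> d) = B.\<rho> (h d)"
  and h_opp: "d \<in> A.D \<Longrightarrow> h (A.\<epsilon> d) = B.\<epsilon> (h d)"
  using hom unfolding map_hom_def strand_map_sel by blast+

lemma h_D: "d \<in> A.D \<Longrightarrow> h d \<in> B.D"
  using h_bij bij_betwE by blast

lemma h_out: "d \<in> A.D \<Longrightarrow> snd (snd (h d)) \<longleftrightarrow> snd (snd d)"
  using hom h_D unfolding map_hom_def strand_map_sel by blast

lemma h_face_step: "d \<in> A.D \<Longrightarrow> h (A.\<phi> d) = B.\<phi> (h d)"
  using h_rot h_opp A.opp_D by simp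

text \<open>Sources are recognizable without coordinates: their darts are the out-darts fixed by the
  rotation. An in-dart never has position 0.\<close>

lemma h_position_0:
  assumes "d \<in> A.D"
  shows "fst (snd (h d)) = 0 \<longleftrightarrow> fst (snd d) = 0"
proof (cases "snd (snd d)")
  case True
  have "A.\<rho> d = d \<longleftrightarrow> B.\<rho> (h d) = h d"
    using h_rot[OF assms] h_bij A.rot_D[OF assms] assms by (metis bij_betw_inv_into_left)
  then show ?thesis
    using A.source_iff[OF assms True] B.source_iff[OF h_D[OF assms]] h_out[OF assms] True by simp
next
  case False
  have "fst (snd d) \<noteq> 0" using assms False by (cases d) (auto dest: A.in_pos)
  moreover have "fst (snd (h d)) \<noteq> 0"
    using h_D[OF assms] h_out[OF assms] False by (cases "h d") (auto dest: B.in_pos)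
  ultimately show ?thesis by simp
qed

definition \<theta> :: "nat \<Rightarrow> nat" where "\<theta> a = fst (h (a, 0, True))"

lemma h_source: "a \<in> {1..n} \<Longrightarrow> h (a, 0, True) = (\<theta> a, 0, True)"
proof -
  assume "a \<in> {1..n}"
  then have D: "(a, 0, True) \<in> A.D" by (simp add: A.source_in)
  then have "fst (snd (h (a, 0, True))) = 0" "snd (snd (h (a, 0, True)))"
    using h_position_0[OF D] h_out[OF D] by auto
  then show ?thesis by (simp add: \<theta>_def prod_eq_iff)
qed

lemma \<theta>_in: "a \<in> {1..n} \<Longrightarrow> \<theta> a \<in> {1..n}"
  using h_source h_D A.source_in B.source_in by metis

text \<open>The isomorphism commutes with face walks and preserves sources, so it sends the first
  source reached from \<open>d\<close> to the first source reached from \<open>h d\<close>.\<close>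

lemma label_h: "d \<in> A.D \<Longrightarrow> face_label fs' (h d) = \<theta> (face_label fs d)"
proof (induction d rule: A.walk_induct)
  case (source a)
  then show ?case by (simp add: h_source)
next
  case (step d)
  have "face_label fs' (h d) = face_label fs' (B.\<phi> (h d))"
    using B.label_step[OF h_D[OF step(1)]] h_position_0[OF step(1)] step(2) by simp
  also have "\<dots> = \<theta> (face_label fs (A.\<phi> d))"
    using step(3) h_face_step[OF step(1)] by simp
  also have "\<dots> = \<theta> (face_label fs d)" using A.label_step[OF step(1,2)] by simp
  finally show ?case .
qed

text \<open>One step out of a source replaces its label by the image under the product, in both
  maps; comparing labels there gives the intertwining relation. It holds for two different products
  as well.\<close>

lemma \<theta>_pi:
  assumes "a \<in> {1..n}"
  shows "\<theta> (A.\<pi> a) = B.\<pi> (\<theta> a)"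
proof -
  have D: "(a, 0, True) \<in> A.D" using assms by (simp add: A.source_in)
  then have D': "A.\<phi> (a, 0, True) \<in> A.D" using A.rot_D A.opp_D by simp
  have "\<theta> (A.\<pi> a) = face_label fs' (h (A.\<phi> (a, 0, True)))"
    using label_h[OF D'] A.label_step_source[OF assms] by simp
  also have "\<dots> = face_label fs' (B.\<phi> (\<theta> a, 0, True))"
    using h_face_step[OF D] h_source[OF assms] by simp
  also have "\<dots> = B.\<pi> (\<theta> a)" by (rule B.label_step_source[OF \<theta>_in[OF assms]])
  finally show ?thesis .
qed

text \<open>The two halves of a strand at an inner position have images at the same position; the flag only
  selects a half that exists at the ends of the strand.\<close>

definition pos :: "nat \<Rightarrow> nat \<Rightarrow> nat" where "pos a p = fst (snd (h (a, p, p \<noteq> Suc A.r)))"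

context
  assumes fixed: "\<And>a. a \<in> {1..n} \<Longrightarrow> \<theta> a = a"
begin

text \<open>A strand is generated from its source by crossing edges and passing from in-darts to
  out-darts, and \<open>h\<close> respects both operations; fixing the source therefore fixes the
  strand.\<close>

lemma h_strand: "(a, p, b) \<in> A.D \<Longrightarrow> \<exists>p'. h (a, p, b) = (a, p', b)"
proof (induction p arbitrary: b rule: less_induct)
  case (less p)
  have F: "\<exists>p'. h (a, p, False) = (a, p', False)" if F: "(a, p, False) \<in> A.D"
  proof -
    let ?q = "prev_visit fs a p"
    have q: "(a, ?q, True) \<in> A.D" using A.prev_dart[OF F] .
    have "?q < p" using prev_visit_less[OF A.in_pos[OF F]] .
    then obtain q' where q': "h (a, ?q, True) = (a, q', True)" using less.IH q by blast
    have "A.\<epsilon> (a, ?q, True) = (a, p, False)" using A.opp_opp[OF F] A.opp_in[OF F] by simp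
    then have "h (a, p, False) = B.\<epsilon> (a, q', True)" using h_opp[OF q] q' by simp
    then show ?thesis using B.opp_out h_D[OF q] q' by metis
  qed
  show ?case
  proof (cases b)
    case False
    then show ?thesis using F less.prems by simp
  next
    case b: True
    show ?thesis
    proof (cases "p = 0")
      case True
      then have "a \<in> {1..n}" using less.prems b by (simp add: A.darts_iff)
      then show ?thesis using h_source fixed True b by simp
    next
      case False
      then have p: "0 < p" "p \<le> A.r" using A.out_le less.prems b by auto
      have D: "(a, p, False) \<in> A.D" using A.flip_dart[OF less.prems p] .
      obtain p' where p': "h (a, p, False) = (a, p', False)" using F[OF D] by blast
      have r: "A.\<rho> (a, p, False) = (a, p, True)" using A.rot_in[OF D] p by simp
      then have T: "h (a, p, True) = B.\<rho> (a, p', False)" using h_rot[OF D] p' by simp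
      have D': "(a, p', False) \<in> B.D" using h_D[OF D] p' by simp
      \<comment> \<open>At a sink the rotation would fix the in-dart, but the image has to be an
        out-dart; so the position is an inner one.\<close>
      have "snd (snd (h (a, p, True)))" using h_out less.prems b by auto
      then have "p' \<noteq> Suc B.r" using T B.rot_end[of p' a False] by auto
      then show ?thesis using T B.rot_in[OF D'] b by simp
    qed
  qed
qed

lemma h_flip:
  assumes "(a, p, b) \<in> A.D" "0 < p" "p \<le> A.r"
  shows "fst (snd (h (a, p, True))) = fst (snd (h (a, p, False)))"
proof -
  have F: "(a, p, False) \<in> A.D" and T: "(a, p, True) \<in> A.D" using A.flip_dart[OF assms] by auto
  obtain p' where p': "h (a, p, False) = (a, p', False)" using h_strand[OF F] by blast
  have "h (a, p, True) = B.\<rho> (a, p', False)"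
    using h_rot[OF F] p' A.rot_in[OF F] assms(3) by simp
  moreover have "snd (snd (h (a, p, True)))" using h_out[OF T] by simp
  ultimately have "p' \<noteq> Suc B.r" using B.rot_end[of p' a False] by auto
  then have "h (a, p, True) = (a, p', True)"
    using B.rot_in[of a p'] h_D[OF F] p' \<open>h (a, p, True) = B.\<rho> (a, p', False)\<close> by simp
  then show ?thesis using p' by simp
qed

lemma h_eq: "(a, p, b) \<in> A.D \<Longrightarrow> h (a, p, b) = (a, pos a p, b)"
proof -
  assume D: "(a, p, b) \<in> A.D"
  obtain p' where p': "h (a, p, b) = (a, p', b)" using h_strand[OF D] by blast
  consider "p = 0" | "p = Suc A.r" | "0 < p" "p \<le> A.r" using A.dart_le[OF D] by fastforce
  then have "p' = pos a p"
  proof cases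
    case 3
    then show ?thesis using h_flip[OF D 3] p' by (cases b) (auto simp: pos_def)
  qed (use D p' in \<open>auto simp: pos_def A.darts_iff\<close>)
  then show ?thesis using p' by simp
qed

lemma pos_next:
  assumes "(a, p, True) \<in> A.D"
  shows "pos a (next_visit fs a p) = next_visit fs' a (pos a p)"
proof -
  have "h (A.\<epsilon> (a, p, True)) = B.\<epsilon> (a, pos a p, True)"
    using h_opp[OF assms] h_eq[OF assms] by simp
  moreover have "(a, pos a p, True) \<in> B.D" using h_D[OF assms] h_eq[OF assms] by simp
  ultimately show ?thesis
    using A.opp_out[OF assms] B.opp_out h_eq[OF A.next_dart[OF assms]] by simp
qed

lemma pos_less:
  assumes "(a, p, True) \<in> A.D" "(a, q, True) \<in> A.D" "p < q"
  shows "pos a p < pos a q"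
  using assms(2,3)
proof (induction q rule: less_induct)
  case (less q)
  have qr: "0 < q" "q \<le> A.r" using less.prems A.out_le by auto
  have F: "(a, q, False) \<in> A.D" using A.flip_dart[OF less.prems(1) qr] .
  let ?s = "prev_visit fs a q"
  have s: "(a, ?s, True) \<in> A.D" "?s < q" using A.prev_dart[OF F] prev_visit_less[OF qr(1)] by auto
  have "visits fs a p" using assms(1) by (simp add: A.darts_iff)
  then have "p \<le> ?s" using not_visits_after_prev[OF qr(1), of fs a p] less.prems(2) by force
  then have "pos a p \<le> pos a ?s" using less.IH[OF s(2,1)] by (cases "p = ?s") auto
  moreover have "next_visit fs a ?s = q"
    using next_prev_visit[OF qr(1), of fs a] F by (simp add: A.darts_iff)
  then have "pos a q = next_visit fs' a (pos a ?s)" using pos_next[OF s(1)] by simp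
  moreover have "(a, pos a ?s, True) \<in> B.D" using h_D[OF s(1)] h_eq[OF s(1)] by simp
  then have "pos a ?s < next_visit fs' a (pos a ?s)" using next_visit_gt[OF B.out_le] by blast
  ultimately show ?case by simp
qed

lemma pos_inner:
  assumes "a \<in> moved (factor_at fs p)" "0 < p" "p \<le> A.r"
  shows "0 < pos a p" "pos a p \<le> B.r" "a \<in> moved (factor_at fs' (pos a p))"
proof -
  have D: "(a, p, True) \<in> A.D" using assms A.inner_in[OF assms(2,3), of a True] by blast
  then have D': "(a, pos a p, True) \<in> B.D" using h_D[OF D] h_eq[OF D] by simp
  show "0 < pos a p" using h_position_0[OF D] h_eq[OF D] assms(2) by simp
  then show "pos a p \<le> B.r" "a \<in> moved (factor_at fs' (pos a p))"
    using B.out_le[OF D'] D' B.inner_in[of "pos a p" a True] by blast+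
qed

text \<open>The strands moved by this factor meet in one vertex, so their images share one position.
  There the rotations, hence the factors, agree along an orbit, and single cycles are determined by
  that.\<close>

lemma factor_pos:
  assumes "a \<in> moved (factor_at fs p)" "0 < p" "p \<le> A.r"
  shows "factor_at fs' (pos a p) = factor_at fs p"
proof -
  let ?\<sigma> = "factor_at fs p"
  let ?P = "pos a p"
  have mv: "?\<sigma> b \<in> moved ?\<sigma>" if "b \<in> moved ?\<sigma>" for b
    using that permutes_inj[OF A.factor_permutes[of p]] by (auto dest: injD)
  have turn: "pos (?\<sigma> b) p = pos b p \<and> ?\<sigma> b = factor_at fs' (pos b p) b" if b: "b \<in> moved ?\<sigma>" for b
  proof -
    have D: "(b, p, True) \<in> A.D" "(?\<sigma> b, p, False) \<in> A.D"
      using A.inner_in[OF assms(2,3)] b mv[OF b] by blast+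
    have "h (A.\<rho> (b, p, True)) = B.\<rho> (b, pos b p, True)" using h_rot[OF D(1)] h_eq[OF D(1)] by simp
    moreover have "(b, pos b p, True) \<in> B.D" using h_D[OF D(1)] h_eq[OF D(1)] by simp
    ultimately have "h (?\<sigma> b, p, False) = (factor_at fs' (pos b p) b, pos b p, False)"
      using A.rot_out[OF D(1)] B.rot_out[of b "pos b p"] assms(2) pos_inner(1)[OF b assms(2,3)] by simp
    then show ?thesis using h_eq[OF D(2)] by (metis prod.inject)
  qed
  have orb: "orbit ?\<sigma> a = moved ?\<sigma>"
    using A.factor_cyclic[OF assms(2,3)] assms(1) unfolding cyclic_perm_def by blast
  have const: "pos b p = ?P" if "b \<in> orbit ?\<sigma> a" for b
    using that
  proof induction
    case base
    then show ?case using turn[OF assms(1)] by blast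
  next
    case (step b)
    then have b: "b \<in> moved ?\<sigma>" using orb by blast
    from turn[OF b] step.IH show ?case by (rule trans[OF conjunct1])
  qed
  have eq: "?\<sigma> b = factor_at fs' ?P b" if b: "b \<in> orbit ?\<sigma> a" for b
  proof -
    have "b \<in> moved ?\<sigma>" using b orb by blast
    from conjunct2[OF turn[OF this]] show ?thesis using const[OF b] by metis
  qed
  have "cyclic_perm n (factor_at fs' ?P)"
    by (rule B.factor_cyclic[OF pos_inner(1,2)[OF assms]])
  moreover have "?\<sigma> a \<noteq> a" using assms(1) by blast
  ultimately have "?\<sigma> = factor_at fs' ?P"
    using cyclic_perm_eqI[OF A.factor_cyclic[OF assms(2,3)] _ _ eq] by blast
  then show ?thesis by (rule sym)
qed

text \<open>\<open>pos a\<close> is an increasing bijection between the inner visits of strand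
  \<open>a\<close> in the two words, and strictly increasing lists with equal sets coincide.
  Corresponding positions carry equal factors.\<close>

lemma filter_eq: "filter (\<lambda>\<sigma>. \<sigma> a \<noteq> a) fs = filter (\<lambda>\<sigma>. \<sigma> a \<noteq> a) fs'"
proof -
  note [simp del] = upt_Suc
  let ?V = "filter (\<lambda>p. factor_at fs p a \<noteq> a) [1..<Suc A.r]"
  let ?V' = "filter (\<lambda>p. factor_at fs' p a \<noteq> a) [1..<Suc B.r]"
  have V: "p \<in> set ?V \<longleftrightarrow> 0 < p \<and> p \<le> A.r \<and> a \<in> moved (factor_at fs p)" for p
    by auto
  have V': "p \<in> set ?V' \<longleftrightarrow> 0 < p \<and> p \<le> B.r \<and> a \<in> moved (factor_at fs' p)" for p
    by auto
  have dart: "(a, p, True) \<in> A.D" if "p \<in> set ?V" for p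
    using that A.inner_in[of p a True] V by blast
  have "sorted_wrt (<) (map (pos a) ?V)"
  proof -
    have "sorted_wrt (<) ?V" by (rule sorted_wrt_filter) (simp add: sorted_wrt_upt del: upt_Suc)
    then have "sorted_wrt (\<lambda>p q. pos a p < pos a q) ?V"
      by (rule sorted_wrt_mono_rel[rotated]) (use dart pos_less in blast)
    then show ?thesis by (simp add: sorted_wrt_map)
  qed
  moreover have "sorted_wrt (<) ?V'"
    by (rule sorted_wrt_filter) (simp add: sorted_wrt_upt del: upt_Suc)
  moreover have "set (map (pos a) ?V) = set ?V'"
  proof (intro equalityI subsetI)
    fix q assume "q \<in> set (map (pos a) ?V)"
    then obtain p where "p \<in> set ?V" "q = pos a p" by (auto simp del: set_filter)
    then show "q \<in> set ?V'" using pos_inner V V' by blast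
  next
    fix q assume q: "q \<in> set ?V'"
    then have "(a, q, True) \<in> B.D" using B.inner_in[of q a True] V' by blast
    then obtain d where d: "d \<in> A.D" "h d = (a, q, True)"
      using h_bij by (metis bij_betw_inv_into_right bij_betw_imp_surj_on inv_into_into)
    obtain x p b where e: "d = (x, p, b)" by (cases d)
    then have x: "x = a" "b" "q = pos a p" using d h_eq[of x p b] by auto
    have "p \<noteq> 0" using h_position_0[OF d(1)] d(2) e q V' by auto
    moreover have "p \<le> A.r" using A.out_le d(1) e x by auto
    moreover have "a \<in> moved (factor_at fs p)"
      using calculation d(1) e x A.inner_in[of p a True] by auto
    ultimately have "p \<in> set ?V" using V by blast
    then show "q \<in> set (map (pos a) ?V)" using x by auto
  qed
  ultimately have "?V' = map (pos a) ?V" using strict_sorted_equal by metis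
  then have "map (pos a) ?V = ?V'" by (rule sym)
  then have "filter (\<lambda>\<sigma>. \<sigma> a \<noteq> a) fs' = map (\<lambda>p. factor_at fs' (pos a p)) ?V"
    unfolding filter_factors[of a fs'] by (metis (no_types, lifting) list.map_comp comp_apply map_eq_conv)
  also have "\<dots> = map (factor_at fs) ?V"
    by (rule map_cong[OF refl]) (use factor_pos V in blast)
  finally show ?thesis unfolding filter_factors[of a fs] by simp
qed

lemma commutation_equiv: "(fs, fs') \<in> commutation_equiv"
  by (rule commutation_equivI_filter[OF _ filter_eq])
     (use A.factors B.factors in \<open>auto simp: cyclic_perm_def\<close>)

end

end

section \<open>Strands of an alternating map\<close>

text \<open>A minimal element of the finite acyclic relation restricted to \<open>A\<close> goes to
  the front, and the rest is sorted recursively.\<close>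

lemma topological_list:
  assumes "finite A" "acyclic R"
  shows "\<exists>xs. distinct xs \<and> set xs = A \<and>
    (\<forall>i<length xs. \<forall>j<length xs. (xs ! i, xs ! j) \<in> R \<longrightarrow> i < j)"
  using assms(1)
proof (induction "card A" arbitrary: A)
  case 0
  then show ?case by simp
next
  case (Suc c)
  have "acyclic (R \<inter> A \<times> A)" using assms(2) acyclic_subset by blast
  moreover have "finite (R \<inter> A \<times> A)" using Suc.prems by simp
  ultimately have wf: "wf (R \<inter> A \<times> A)" by (rule finite_acyclic_wf[rotated])
  obtain y where "y \<in> A" using Suc.hyps(2) by fastforce
  then obtain x where x: "x \<in> A" "\<And>z. (z, x) \<in> R \<inter> A \<times> A \<Longrightarrow> z \<notin> A"
    using wfE_min[OF wf] by metis
  have "c = card (A - {x})" using Suc.hyps(2) Suc.prems x(1) by simp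
  then obtain xs where xs: "distinct xs" "set xs = A - {x}"
    "\<And>i j. i < length xs \<Longrightarrow> j < length xs \<Longrightarrow> (xs ! i, xs ! j) \<in> R \<Longrightarrow> i < j"
    using Suc.hyps(1)[of "A - {x}"] Suc.prems by auto
  have "i < j" if ij: "i < length (x # xs)" "j < length (x # xs)" "((x # xs) ! i, (x # xs) ! j) \<in> R" for i j
  proof (cases j)
    case 0
    have "(x # xs) ! i \<in> set (x # xs)" using ij(1) by (rule nth_mem)
    moreover have "set (x # xs) = A" using xs(2) x(1) by auto
    ultimately have z: "(x # xs) ! i \<in> A" by metis
    have "((x # xs) ! i, x) \<in> R" using ij(3) unfolding 0 nth_Cons_0 .
    then have "((x # xs) ! i, x) \<in> R \<inter> A \<times> A" using z x(1) by blast
    from x(2)[OF this] z show ?thesis by (rule notE)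
  next
    case (Suc j')
    then show ?thesis using ij xs(3) by (cases i) auto
  qed
  then show ?case using xs(1,2) x(1) by (intro exI[of _ "x # xs"]) auto
qed

text \<open>The choices from which a word is read off: \<open>lam\<close> numbers the sources and
  thereby the strands, and \<open>vs\<close> is a topological order of the vertices that are not
  leaves.\<close>

locale labelled_alternating_map =
  fixes N :: "('d, 'z) dmap_scheme" and n :: nat and lam :: "'d \<Rightarrow> nat" and vs :: "'d set list"
  assumes dN: "directed_map N" and alt: "alternating N"
    and deg: "\<And>d. d \<in> darts N \<Longrightarrow> rot N d \<noteq> d \<Longrightarrow> 4 \<le> card (vertex_of N d)"
    and n_pos: "1 \<le> n"
    and lam: "bij_betw lam {d \<in> outs N. rot N d = d} {1..n}"
    and vs_distinct: "distinct vs"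
    and vs_set: "set vs = vertex_of N ` {d \<in> darts N. rot N d \<noteq> d}"
    and vs_order: "\<And>i j. i < length vs \<Longrightarrow> j < length vs \<Longrightarrow> (vs ! i, vs ! j) \<in> arc_rel N \<Longrightarrow> i < j"
begin

abbreviation "Out \<equiv> outs N"
abbreviation "R \<equiv> rot N"
abbreviation "J \<equiv> opp N"
abbreviation r :: nat where "r \<equiv> length vs"

lemma fin: "finite (darts N)"
  and R_permutes: "R permutes darts N"
  and O_darts: "d \<in> Out \<Longrightarrow> d \<in> darts N"
  and J_darts: "d \<in> darts N \<Longrightarrow> J d \<in> darts N"
  and JJ: "d \<in> darts N \<Longrightarrow> J (J d) = d"
  and J_O: "d \<in> darts N \<Longrightarrow> J d \<in> Out \<longleftrightarrow> d \<notin> Out"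
  using dN by (auto simp: directed_map_def permutes_in_image)

lemma R_darts: "R d \<in> darts N \<longleftrightarrow> d \<in> darts N"
  using R_permutes by (rule permutes_in_image)

lemma R_inj: "R d = R e \<longleftrightarrow> d = e"
  using permutes_inj[OF R_permutes] by (auto dest: injD)

lemma R_O: "d \<in> darts N \<Longrightarrow> R d \<noteq> d \<Longrightarrow> R d \<in> Out \<longleftrightarrow> d \<notin> Out"
  using alt by (simp add: alternating_def)

lemma vertex_R: "vertex_of N (R d) = vertex_of N d"
  unfolding vertex_of_def by (rule permutes_orbit_eq[OF R_permutes fin orbit.base])

lemma self_in_vertex: "d \<in> vertex_of N d"
  unfolding vertex_of_def by (rule permutes_self_in_orbit[OF R_permutes fin])

lemma inner_R: "R (R d) \<noteq> R d \<longleftrightarrow> R d \<noteq> d"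
  by (simp add: R_inj)

text \<open>The position that a dart will receive in the strand map; the outer \<open>Suc\<close> in
  the inner case reserves 0 for sources.\<close>

definition pos :: "'d \<Rightarrow> nat" where
  "pos d = (if R d = d then if d \<in> Out then 0 else Suc r else Suc (THE i. i < r \<and> vs ! i = vertex_of N d))"

lemma pos_inner:
  assumes "d \<in> darts N" "R d \<noteq> d"
  shows "0 < pos d" "pos d \<le> r" "vs ! (pos d - 1) = vertex_of N d"
proof -
  have "vertex_of N d \<in> set vs" using assms vs_set by blast
  then have "\<exists>!i. i < r \<and> vs ! i = vertex_of N d" using vs_distinct by (rule distinct_Ex1[rotated])
  then have "(THE i. i < r \<and> vs ! i = vertex_of N d) < r \<and>
      vs ! (THE i. i < r \<and> vs ! i = vertex_of N d) = vertex_of N d"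
    by (rule theI')
  then show "0 < pos d" "pos d \<le> r" "vs ! (pos d - 1) = vertex_of N d"
    using assms by (simp_all add: pos_def)
qed

lemma pos_le: "d \<in> darts N \<Longrightarrow> pos d \<le> Suc r"
  using pos_inner[of d] by (cases "R d = d") (auto simp: pos_def)

lemma pos_eq_0: "d \<in> darts N \<Longrightarrow> pos d = 0 \<longleftrightarrow> R d = d \<and> d \<in> Out"
  using pos_inner[of d] by (cases "R d = d") (auto simp: pos_def)

lemma pos_eq_end: "d \<in> darts N \<Longrightarrow> pos d = Suc r \<longleftrightarrow> R d = d \<and> d \<notin> Out"
  using pos_inner[of d] by (cases "R d = d") (auto simp: pos_def)

lemma pos_out: "d \<in> Out \<Longrightarrow> pos d \<le> r"
  using pos_le[OF O_darts, of d] pos_eq_end[OF O_darts, of d] by fastforce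

lemma pos_R: "d \<in> darts N \<Longrightarrow> pos (R d) = pos d"
  by (cases "R d = d") (simp_all add: pos_def R_inj vertex_R)

lemma pos_eq_vertex:
  assumes "d \<in> darts N" "e \<in> darts N" "R d \<noteq> d" "pos d = pos e"
  shows "vertex_of N d = vertex_of N e"
proof -
  have "R e \<noteq> e"
    using assms pos_eq_0[of d] pos_eq_end[of d] pos_eq_0[of e] pos_eq_end[of e] by metis
  then show ?thesis using assms pos_inner(3)[of d] pos_inner(3)[of e] by simp
qed

text \<open>Sources come before and sinks after all inner vertices, and between inner vertices
  \<open>vs\<close> respects the arcs.\<close>

lemma pos_J:
  assumes d: "d \<in> Out"
  shows "pos d < pos (J d)"
proof -
  have D: "d \<in> darts N" "J d \<in> darts N" "J d \<notin> Out" using d O_darts J_darts J_O by auto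
  show ?thesis
  proof (cases "R (J d) = J d")
    case True
    then show ?thesis using pos_out[OF d] pos_eq_end[OF D(2)] D(3) by simp
  next
    case J: False
    show ?thesis
    proof (cases "R d = d")
      case True
      then show ?thesis using pos_eq_0[OF D(1)] d pos_inner[OF D(2) J] by simp
    next
      case False
      note p = pos_inner[OF D(1) False] and q = pos_inner[OF D(2) J]
      have "(vs ! (pos d - 1), vs ! (pos (J d) - 1)) \<in> arc_rel N"
        unfolding p(3) q(3) arc_rel_def using d by blast
      then have "pos d - 1 < pos (J d) - 1" by (rule vs_order[rotated 2]) (use p q in auto)
      then show ?thesis by simp
    qed
  qed
qed

text \<open>The preceding out-dart on the strand: back to the in-dart before \<open>d\<close> in the
  rotation, then across its edge. Sources are fixed, so iteration stops there.\<close>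

definition pr :: "'d \<Rightarrow> 'd" where
  "pr d = (if R d = d then d else J (inv' R d))"

lemma pr_R:
  assumes "d \<in> darts N" "R d \<noteq> d"
  shows "pr (R d) = J d"
  using assms permutes_inverses(2)[OF R_permutes] by (simp add: pr_def R_inj)

lemma inner_out_cases:
  assumes "d \<in> Out" "R d \<noteq> d"
  obtains e where "e \<in> darts N" "e \<notin> Out" "R e \<noteq> e" "d = R e" "pr d = J e"
proof -
  let ?e = "inv' R d"
  have e: "R ?e = d" using permutes_inverses(1)[OF R_permutes] .
  moreover have "?e \<in> darts N" using R_darts[of ?e] e O_darts[OF assms(1)] by simp
  moreover have ne: "R ?e \<noteq> ?e" using inner_R[of ?e] e assms(2) by metis
  ultimately show ?thesis using that[of ?e] R_O[of ?e] assms(1) pr_R[of ?e] by simp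
qed

lemma pr_out: "d \<in> Out \<Longrightarrow> pr d \<in> Out"
proof (cases "R d = d")
  case False
  assume "d \<in> Out"
  then obtain e where "e \<in> darts N" "e \<notin> Out" "pr d = J e" using False by (rule inner_out_cases)
  then show ?thesis using J_O by simp
qed (simp add: pr_def)

lemma pr_less: "d \<in> Out \<Longrightarrow> R d \<noteq> d \<Longrightarrow> pos (pr d) < pos d"
proof -
  assume d: "d \<in> Out" "R d \<noteq> d"
  then obtain e where e: "e \<in> darts N" "e \<notin> Out" "d = R e" "pr d = J e" by (rule inner_out_cases)
  then have "pos (J e) < pos (J (J e))" using pos_J[of "J e"] J_O by simp
  then show ?thesis using e JJ pos_R by simp
qed

lemma pr_fix: "R d = d \<Longrightarrow> pr d = d"
  by (simp add: pr_def)

lemma pr_inj: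
  assumes "d \<in> Out" "e \<in> Out" "R d \<noteq> d" "R e \<noteq> e" "pr d = pr e"
  shows "d = e"
proof -
  obtain x where x: "x \<in> darts N" "d = R x" "pr d = J x" using inner_out_cases[OF assms(1,3)] by metis
  obtain y where y: "y \<in> darts N" "e = R y" "pr e = J y" using inner_out_cases[OF assms(2,4)] by metis
  have "x = y" using x y assms(5) JJ by metis
  then show ?thesis using x y by simp
qed

lemma pr_funpow_out: "d \<in> Out \<Longrightarrow> (pr ^^ k) d \<in> Out"
  by (induction k) (auto intro: pr_out)

lemma pr_funpow_source:
  assumes "d \<in> Out" "pos d \<le> k"
  shows "R ((pr ^^ k) d) = (pr ^^ k) d"
  using assms
proof (induction k arbitrary: d)
  case 0
  then show ?case using pos_eq_0[OF O_darts[OF 0(1)]] by simp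
next
  case (Suc k)
  show ?case
  proof (cases "R d = d")
    case True
    then have fixed: "(pr ^^ j) d = d" for j by (induction j) (auto simp: pr_fix)
    show ?thesis unfolding fixed using True .
  next
    case False
    then have "pos (pr d) \<le> k" using pr_less[OF Suc.prems(1)] Suc.prems(2) by simp
    then show ?thesis using Suc.IH[OF pr_out[OF Suc.prems(1)]] by (simp add: funpow_Suc_right del: funpow.simps)
  qed
qed

text \<open>The source of the strand through an out-dart. Each proper step back lowers the position,
  which is at most \<open>r\<close> for out-darts, so \<open>r\<close> iterations always
  suffice.\<close>

definition base :: "'d \<Rightarrow> 'd" where "base d = (pr ^^ r) d"

lemma base_source: "d \<in> Out \<Longrightarrow> base d \<in> {d \<in> Out. R d = d}"
  unfolding base_def using pr_funpow_out pr_funpow_source pos_out by simp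

lemma base_fix: "R d = d \<Longrightarrow> base d = d"
proof -
  assume "R d = d"
  then have "(pr ^^ j) d = d" for j by (induction j) (auto simp: pr_fix)
  then show ?thesis by (simp add: base_def)
qed

lemma base_pr: "d \<in> Out \<Longrightarrow> base (pr d) = base d"
proof -
  assume "d \<in> Out"
  have "base (pr d) = pr (base d)" unfolding base_def by (simp add: funpow_swap1)
  then show ?thesis using base_source[OF \<open>d \<in> Out\<close>] pr_fix by simp
qed

lemma pr_funpow_pos: "d \<in> Out \<Longrightarrow> pos ((pr ^^ k) d) \<le> pos d"
proof (induction k)
  case (Suc k)
  have o: "(pr ^^ k) d \<in> Out" using Suc.prems by (rule pr_funpow_out)
  have "pos (pr ((pr ^^ k) d)) \<le> pos ((pr ^^ k) d)"
    using pr_less[OF o] pr_fix[of "(pr ^^ k) d"] by (cases "R ((pr ^^ k) d) = (pr ^^ k) d") auto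
  then show ?case using Suc by simp
qed simp

text \<open>Strands do not branch: \<open>pr\<close> is injective away from sources, so two backward
  chains with the same source are nested.\<close>

lemma same_base_comparable:
  assumes "d \<in> Out" "e \<in> Out" "base d = base e"
  shows "\<exists>k. d = (pr ^^ k) e \<or> e = (pr ^^ k) d"
  using assms
proof (induction "pos e" arbitrary: e rule: less_induct)
  case less
  show ?case
  proof (cases "R e = e")
    case True
    then have "e = (pr ^^ r) d" using base_fix less.prems unfolding base_def by metis
    then show ?thesis by blast
  next
    case e: False
    have "\<exists>k. d = (pr ^^ k) (pr e) \<or> pr e = (pr ^^ k) d"
      using less.hyps[OF pr_less[OF less.prems(2) e] less.prems(1) pr_out[OF less.prems(2)]]
        less.prems base_pr by simp
    then consider k where "d = (pr ^^ k) (pr e)" | k where "pr e = (pr ^^ k) d" by blast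
    then show ?thesis
    proof cases
      case (1 k)
      then have "d = (pr ^^ Suc k) e" by (simp add: funpow_swap1)
      then show ?thesis by blast
    next
      case 2
      \<comment> \<open>Minimality ensures that the dart reached one step earlier is not yet a
        source, since a source would be fixed by \<open>pr\<close>; then injectivity of
        \<open>pr\<close> identifies that dart with \<open>e\<close>.\<close>
      define k where "k = (LEAST k. pr e = (pr ^^ k) d)"
      have k: "pr e = (pr ^^ k) d" unfolding k_def using 2 by (rule LeastI)
      show ?thesis
      proof (cases k)
        case 0
        then have "d = (pr ^^ 1) e" using k by simp
        then show ?thesis by blast
      next
        case (Suc l)
        let ?x = "(pr ^^ l) d"
        have "pr e \<noteq> ?x" using not_less_Least[of l "\<lambda>k. pr e = (pr ^^ k) d"] Suc k_def by auto
        then have "R ?x \<noteq> ?x" using k Suc pr_fix by auto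
        then have "?x = e" using pr_inj[OF pr_funpow_out[OF less.prems(1)] less.prems(2)] e k Suc by simp
        then show ?thesis by blast
      qed
    qed
  qed
qed

text \<open>On the way back from \<open>e\<close>, the out-dart met just before \<open>d\<close>
  starts at the vertex where the edge of \<open>d\<close> ends, and going back never raises the
  position.\<close>

lemma ancestor_before:
  assumes "e \<in> Out" "d = (pr ^^ k) e" "d \<noteq> e"
  shows "pos (J d) \<le> pos e"
proof -
  define m where "m = (LEAST k. d = (pr ^^ k) e)"
  have m: "d = (pr ^^ m) e" unfolding m_def using assms(2) by (rule LeastI)
  then obtain l where l: "m = Suc l" using assms(3) by (cases m) auto
  let ?y = "(pr ^^ l) e"
  have "d \<noteq> ?y" using not_less_Least[of l "\<lambda>k. d = (pr ^^ k) e"] l m_def by auto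
  then have "R ?y \<noteq> ?y" using m l pr_fix by auto
  then obtain x where "x \<in> darts N" "?y = R x" "pr ?y = J x"
    using inner_out_cases[OF pr_funpow_out[OF assms(1)]] by metis
  then have "pos (J d) = pos ?y" using m l JJ pos_R by simp
  then show ?thesis using pr_funpow_pos[OF assms(1)] by simp
qed

lemma same_base_order:
  assumes "d \<in> Out" "e \<in> Out" "base d = base e" "d \<noteq> e"
  shows "pos (J d) \<le> pos e \<or> pos (J e) \<le> pos d"
  using same_base_comparable[OF assms(1-3)] ancestor_before assms by metis

section \<open>Strand numbers and the factors read off at the vertices\<close>

definition strand :: "'d \<Rightarrow> nat" where
  "strand d = lam (base (if d \<in> Out then d else J d))"

lemma strand_J: "d \<in> darts N \<Longrightarrow> strand (J d) = strand d"
  using J_O JJ by (simp add: strand_def)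

lemma strand_R_in:
  assumes "d \<in> darts N" "d \<notin> Out" "R d \<noteq> d"
  shows "strand (R d) = strand d"
proof -
  have o: "R d \<in> Out" using R_O assms by simp
  have "base (R d) = base (J d)" using base_pr[OF o] pr_R assms by simp
  then show ?thesis using o assms by (simp add: strand_def)
qed

lemma out_half: "d \<in> darts N \<Longrightarrow> (if d \<in> Out then d else J d) \<in> Out"
  using J_O by simp

lemma strand_in: "d \<in> darts N \<Longrightarrow> strand d \<in> {1..n}"
  unfolding strand_def by (rule bij_betw_apply[OF lam base_source[OF out_half]])

lemma strand_eq_base:
  assumes "d \<in> Out" "e \<in> Out" "strand d = strand e"
  shows "base d = base e"
proof -
  have "inj_on lam {d \<in> Out. R d = d}" using lam by (simp add: bij_betw_def)
  moreover have "lam (base d) = lam (base e)" using assms by (simp add: strand_def)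
  ultimately show ?thesis using base_source[OF assms(1)] base_source[OF assms(2)] by (rule inj_onD)
qed

lemma same_strand_order:
  assumes "d \<in> Out" "e \<in> Out" "strand d = strand e" "d \<noteq> e"
  shows "pos (J d) \<le> pos e \<or> pos (J e) \<le> pos d"
  using same_base_order[OF assms(1,2) strand_eq_base[OF assms(1-3)] assms(4)] .

text \<open>Of two distinct out-darts on one strand, the edge of one ends no later than the other
  starts. Edges strictly raise the position, so equal positions are impossible.\<close>

lemma strand_pos_inj:
  assumes "d \<in> Out" "e \<in> Out" "strand d = strand e" "pos d = pos e"
  shows "d = e"
  using same_strand_order[OF assms(1-3)] pos_J assms by fastforce

text \<open>The factor at position \<open>p\<close>: the strand of an out-dart there goes to the
  strand of the next dart in the rotation. The description is unique by
  \<open>strand_pos_inj\<close>.\<close>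

definition turn :: "nat \<Rightarrow> nat \<Rightarrow> nat" where
  "turn p a = (if \<exists>d\<in> Out. pos d = p \<and> strand d = a
     then strand (R (THE d. d \<in> Out \<and> pos d = p \<and> strand d = a)) else a)"

lemma turn_strand: "d \<in> Out \<Longrightarrow> turn (pos d) (strand d) = strand (R d)"
proof -
  assume d: "d \<in> Out"
  have "(THE e. e \<in> Out \<and> pos e = pos d \<and> strand e = strand d) = d"
    by (rule the_equality) (use d strand_pos_inj in auto)
  then show ?thesis using d unfolding turn_def by auto
qed

lemma strand_RR:
  assumes "d \<in> Out" "R d \<noteq> d"
  shows "R d \<in> darts N" "R d \<notin> Out" "R (R d) \<in> Out" "strand (R (R d)) = strand (R d)" "pos (R (R d)) = pos d"
proof -
  show D: "R d \<in> darts N" "R d \<notin> Out" using assms R_O O_darts R_darts by auto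
  have "R (R d) \<noteq> R d" using assms inner_R by simp
  then show "R (R d) \<in> Out" "strand (R (R d)) = strand (R d)" "pos (R (R d)) = pos d"
    using D R_O strand_R_in pos_R O_darts[OF assms(1)] by auto
qed

text \<open>Were the strand fixed, two rotation steps would return to \<open>d\<close>, leaving at
  most two darts at a vertex whose degree is at least 4.\<close>

lemma turn_moves:
  assumes "d \<in> Out" "R d \<noteq> d"
  shows "turn (pos d) (strand d) \<noteq> strand d"
proof
  assume "turn (pos d) (strand d) = strand d"
  then have "R (R d) = d"
    using turn_strand[OF assms(1)] strand_RR[OF assms] strand_pos_inj[OF _ assms(1)] by simp
  then have "orbit R d \<subseteq> {d, R d}" by (intro orbit_mapsto_subset) auto
  then have "card (vertex_of N d) \<le> card {d, R d}" unfolding vertex_of_def by (intro card_mono) auto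
  also have "\<dots> \<le> 2" by (simp add: card_insert_if)
  finally show False using deg[OF O_darts[OF assms(1)] assms(2)] by simp
qed

lemma inner_position:
  assumes "0 < p" "p \<le> r"
  obtains d where "d \<in> Out" "pos d = p" "R d \<noteq> d"
proof -
  have "vs ! (p - 1) \<in> set vs" using assms by simp
  then obtain x where x: "x \<in> darts N" "R x \<noteq> x" "vs ! (p - 1) = vertex_of N x" unfolding vs_set by blast
  have "vs ! (p - 1) = vs ! (pos x - 1)" using x pos_inner(3) by simp
  then have "p - 1 = pos x - 1"
    using vs_distinct pos_inner[OF x(1,2)] assms by (subst (asm) nth_eq_iff_index_eq) auto
  then have "pos x = p" using pos_inner[OF x(1,2)] assms by simp
  then show ?thesis using that[of x] that[of "R x"] R_O[OF x(1,2)] x pos_R inner_R by metis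
qed

lemma pos_inner_R: "d \<in> Out \<Longrightarrow> 0 < pos d \<Longrightarrow> R d \<noteq> d"
  using pos_eq_0 O_darts by fastforce

text \<open>Two rotation steps permute the out-darts of a vertex, and strand numbers separate these,
  so the strands through the vertex are permuted. They form one cycle because the darts of the
  vertex form one orbit.\<close>

lemma turn_cyclic:
  assumes p: "0 < p" "p \<le> r"
  shows "cyclic_perm n (turn p)"
proof -
  let ?T = "strand ` {d \<in> Out. pos d = p}"
  have off: "turn p a = a" if "a \<notin> ?T" for a using that unfolding turn_def by auto
  have T: "?T \<subseteq> {1..n}" using strand_in O_darts by blast
  have on: "turn p a \<in> ?T" if a: "a \<in> ?T" for a
  proof -
    obtain d where d: "d \<in> Out" "pos d = p" "a = strand d" using a by blast
    then have "R d \<noteq> d" using pos_inner_R p by simp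
    note rr = strand_RR[OF d(1) this]
    have "turn p a = strand (R (R d))" using turn_strand[OF d(1)] unfolding d(2,3) rr(4) .
    moreover have "pos (R (R d)) = p" using rr(5) d(2) by (rule trans)
    ultimately show ?thesis using rr(3) by blast
  qed
  have "inj_on (turn p) {1..n}"
  proof (rule inj_onI)
    fix a b assume eq: "turn p a = turn p b"
    show "a = b"
    proof (cases "a \<in> ?T \<and> b \<in> ?T")
      case True
      then obtain d e where d: "d \<in> Out" "pos d = p" "a = strand d" and e: "e \<in> Out" "pos e = p" "b = strand e"
        by blast
      then have "R d \<noteq> d" "R e \<noteq> e" using pos_inner_R p by auto
      note rd = strand_RR[OF d(1) this(1)] and re = strand_RR[OF e(1) this(2)]
      have "turn p a = strand (R d)" "turn p b = strand (R e)"
        using turn_strand[OF d(1)] turn_strand[OF e(1)] unfolding d(2,3) e(2,3) .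
      then have "strand (R (R d)) = strand (R (R e))" unfolding rd(4) re(4) using eq by metis
      moreover have "pos (R (R d)) = pos (R (R e))" unfolding rd(5) re(5) d(2) e(2) ..
      ultimately have "R (R d) = R (R e)" by (rule strand_pos_inj[OF rd(3) re(3)])
      then show ?thesis using d e by (simp add: R_inj)
    next
      case False
      have "a \<notin> ?T"
      proof
        assume a: "a \<in> ?T"
        from False have "a \<in> ?T \<longrightarrow> b \<notin> ?T" by (simp only: de_Morgan_conj imp_conv_disj)
        then have b: "b \<notin> ?T" using a by (rule mp)
        have "turn p b \<in> ?T" using on[OF a] unfolding eq .
        then show False using b unfolding off[OF b] by (rule notE[rotated])
      qed
      moreover have "b \<notin> ?T"
      proof
        assume b: "b \<in> ?T"
        have "turn p a \<in> ?T" using on[OF b] unfolding eq .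
        then show False using \<open>a \<notin> ?T\<close> unfolding off[OF \<open>a \<notin> ?T\<close>] by (rule notE[rotated])
      qed
      ultimately show ?thesis using eq unfolding off[OF \<open>a \<notin> ?T\<close>] off[OF \<open>b \<notin> ?T\<close>] by blast
    qed
  qed
  moreover have "turn p ` {1..n} \<subseteq> {1..n}"
  proof
    fix b assume "b \<in> turn p ` {1..n}"
    then obtain a where "a \<in> {1..n}" "b = turn p a" by blast
    then show "b \<in> {1..n}" using subsetD[OF T on[of a]] off[of a] by (cases "a \<in> ?T") auto
  qed
  ultimately have "bij_betw (turn p) {1..n} {1..n}"
    by (simp add: bij_betw_def endo_inj_surj)
  then have perm: "turn p permutes {1..n}"
  proof (rule bij_imp_permutes)
    fix a assume "a \<notin> {1..n}"
    then have "a \<notin> ?T" using T by (rule contra_subsetD[rotated])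
    then show "turn p a = a" by (rule off)
  qed
  obtain d where d: "d \<in> Out" "pos d = p" "R d \<noteq> d" using inner_position[OF p] .
  show ?thesis
  proof (rule cyclic_permI[OF perm])
    show "turn p (strand d) \<noteq> strand d" using turn_moves[OF d(1,3)] d(2) by simp
    fix b assume "turn p b \<noteq> b"
    then obtain e where e: "e \<in> Out" "pos e = p" "b = strand e" using off by blast
    have inner: "x \<in> darts N \<and> pos x = p \<and> R x \<noteq> x" if "x \<in> orbit R d" for x
    proof -
      have "orbit R d \<subseteq> {x \<in> darts N. pos x = p \<and> R x \<noteq> x}"
        by (rule orbit_mapsto_subset) (use d O_darts in \<open>auto simp: R_darts pos_R R_inj\<close>)
      then show ?thesis using that by blast
    qed
    \<comment> \<open>Once around the vertex: leaving an out-dart applies \<open>turn p\<close> to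
      the strand number, and leaving an in-dart keeps it.\<close>
    have "strand x \<in> orbit (turn p) (strand d)" if "x \<in> orbit R d" for x
      using that
    proof induction
      case base
      have "strand (R d) = turn p (strand d)" using turn_strand[OF d(1)] d(2) by simp
      then show ?case by (simp add: orbit.base)
    next
      case (step y)
      show ?case
      proof (cases "y \<in> Out")
        case True
        then have "strand (R y) = turn p (strand y)" using turn_strand[of y] inner[OF step(1)] by simp
        then show ?thesis using step.IH by (simp add: orbit.step)
      next
        case False
        then show ?thesis using strand_R_in[of y] inner[OF step(1)] step.IH by simp
      qed
    qed
    moreover have "e \<in> orbit R d"
      using pos_eq_vertex[of d e] d e O_darts self_in_vertex[of e] unfolding vertex_of_def by simp
    ultimately show "b \<in> orbit (turn p) (strand d)" using e(3) by blast
  qed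
qed

definition fs :: "(nat \<Rightarrow> nat) list" where "fs = map turn [1..<Suc r]"

lemma length_fs: "length fs = r"
  by (simp add: fs_def del: upt_Suc)

lemma factor_at_fs: "0 < p \<Longrightarrow> p \<le> r \<Longrightarrow> factor_at fs p = turn p"
  by (simp add: factor_at_def fs_def nth_append del: upt_Suc)

lemma factor_strands: "factor_strands n fs"
  by unfold_locales (use n_pos turn_cyclic in \<open>auto simp: fs_def simp del: upt_Suc\<close>)

section \<open>The isomorphism with the strand map of the extracted word\<close>

definition h :: "'d \<Rightarrow> nat \<times> nat \<times> bool" where
  "h d = (strand d, pos d, d \<in> Out)"

lemma visits_inner: "0 < p \<Longrightarrow> p \<le> r \<Longrightarrow> visits fs a p \<longleftrightarrow> (\<exists>d\<in> Out. pos d = p \<and> strand d = a)"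
proof -
  assume p: "0 < p" "p \<le> r"
  have "turn p a \<noteq> a \<longleftrightarrow> (\<exists>d\<in> Out. pos d = p \<and> strand d = a)"
  proof
    show "\<exists>d\<in> Out. pos d = p \<and> strand d = a" if "turn p a \<noteq> a" using that unfolding turn_def by metis
    show "turn p a \<noteq> a" if "\<exists>d\<in> Out. pos d = p \<and> strand d = a"
      using that turn_moves pos_inner_R p by blast
  qed
  then show ?thesis using p factor_at_fs by (simp add: visits_def length_fs)
qed

lemma h_in:
  assumes "d \<in> darts N"
  shows "h d \<in> strand_darts n fs"
proof -
  have "visits fs (strand d) (pos d)"
  proof (cases "R d = d")
    case True
    then have "pos d = 0 \<or> pos d = Suc r" by (simp add: pos_def)
    then show ?thesis using length_fs by (auto simp: visits_def)
  next
    case False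
    have "\<exists>e\<in> Out. pos e = pos d \<and> strand e = strand d"
    proof (cases "d \<in> Out")
      case out: False
      then show ?thesis using strand_R_in[OF assms out False] R_O[OF assms False] pos_R[OF assms] by blast
    qed blast
    then show ?thesis using visits_inner pos_inner[OF assms False] by simp
  qed
  then show ?thesis
    using strand_in[OF assms] pos_eq_0[OF assms] pos_eq_end[OF assms]
    by (simp add: strand_darts_def h_def length_fs)
qed

lemma source_of_strand:
  assumes "a \<in> {1..n}"
  obtains s where "s \<in> Out" "R s = s" "lam s = a"
proof -
  have "a \<in> lam ` {d \<in> Out. R d = d}" using lam assms by (simp add: bij_betw_def)
  then show ?thesis using that by blast
qed

text \<open>The edge of the out-dart with the greatest position on the strand must end in a sink,
  since otherwise the strand would continue with a later out-dart. This supplies the preimages of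
  the sink darts.\<close>

lemma last_out:
  assumes "a \<in> {1..n}"
  obtains d where "d \<in> Out" "strand d = a" "R (J d) = J d"
proof -
  obtain s where s: "s \<in> Out" "R s = s" "lam s = a" using source_of_strand[OF assms] .
  then have "strand s = a" using base_fix by (simp add: strand_def)
  then obtain d where d: "d \<in> Out" "strand d = a" and max: "\<And>e. e \<in> Out \<Longrightarrow> strand e = a \<Longrightarrow> pos e \<le> pos d"
    using ex_has_greatest_nat[of "\<lambda>d. d \<in> Out \<and> strand d = a" s pos "Suc r"] s(1) pos_out
    by (auto simp: less_Suc_eq_le)
  have D: "J d \<in> darts N" "J d \<notin> Out" using d O_darts J_darts J_O by auto
  have "R (J d) = J d"
  proof (rule ccontr)
    assume ne: "R (J d) \<noteq> J d"
    have "R (J d) \<in> Out" "strand (R (J d)) = a"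
      using R_O[OF D(1) ne] D strand_R_in[OF D ne] strand_J[OF O_darts[OF d(1)]] d by auto
    then have "pos (R (J d)) \<le> pos d" using max by simp
    then show False using pos_R[OF D(1)] pos_J[OF d(1)] by simp
  qed
  then show ?thesis using that d by blast
qed

lemma h_inj: "inj_on h (darts N)"
proof (rule inj_onI)
  fix d e assume D: "d \<in> darts N" "e \<in> darts N" and eq: "h d = h e"
  then have eq: "strand d = strand e" "pos d = pos e" "d \<in> Out \<longleftrightarrow> e \<in> Out" by (auto simp: h_def)
  show "d = e"
  proof (cases "d \<in> Out")
    case True
    then show ?thesis using strand_pos_inj eq by simp
  next
    case out: False
    show ?thesis
    proof (cases "R d = d")
      case True
      then have p: "pos d = Suc r" "pos e = Suc r" using pos_eq_end[OF D(1)] out eq by auto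
      have o: "J d \<in> Out" "J e \<in> Out" using J_O D out eq by auto
      have "strand (J d) = strand (J e)" using strand_J D eq by simp
      \<comment> \<open>If the tails differed, one of the two edges, which both end at
        \<open>Suc r\<close>, would have to end no later than the other starts, at a position of at
        most \<open>r\<close>.\<close>
      then have "J d = J e"
        using same_strand_order[OF o] pos_out[OF o(1)] pos_out[OF o(2)] JJ D p by fastforce
      then show ?thesis using JJ D by metis
    next
      case False
      have e: "e \<notin> Out" using out eq(3) by simp
      have ne: "R e \<noteq> e"
        using eq(2) e pos_eq_end[OF D(2)] pos_inner(2)[OF D(1) False] by auto
      have "R d \<in> Out" "R e \<in> Out" using R_O[OF D(1) False] R_O[OF D(2) ne] out e by auto
      moreover have "strand (R d) = strand (R e)"
        unfolding strand_R_in[OF D(1) out False] strand_R_in[OF D(2) e ne] by (rule eq(1))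
      moreover have "pos (R d) = pos (R e)" unfolding pos_R[OF D(1)] pos_R[OF D(2)] by (rule eq(2))
      ultimately have "R d = R e" by (rule strand_pos_inj)
      then show ?thesis by (simp add: R_inj)
    qed
  qed
qed

lemma h_bij: "bij_betw h (darts N) (strand_darts n fs)"
proof -
  interpret F: factor_strands n fs by (rule factor_strands)
  have "x \<in> h ` darts N" if x: "x \<in> F.D" for x
    using x
  proof (cases rule: F.dart_cases)
    case (1 a)
    obtain s where s: "s \<in> Out" "R s = s" "lam s = a" using source_of_strand[OF 1(1)] .
    then have "h s = x" using base_fix 1 pos_eq_0 O_darts by (simp add: h_def strand_def)
    then show ?thesis using s O_darts by blast
  next
    case (2 a)
    obtain d where d: "d \<in> Out" "strand d = a" "R (J d) = J d" using last_out[OF 2(1)] .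
    have D: "J d \<in> darts N" "J d \<notin> Out" using d O_darts J_darts J_O by auto
    have "h (J d) = x"
      using 2 d D strand_J[OF O_darts[OF d(1)]] pos_eq_end[OF D(1)] by (simp add: h_def length_fs)
    then show ?thesis using D by blast
  next
    case (3 a p b)
    have "visits fs a p" using 3(3) by (simp add: visits_def)
    then obtain d where d: "d \<in> Out" "pos d = p" "strand d = a"
      using visits_inner[of p a] 3(1,2) length_fs by auto
    have ne: "R d \<noteq> d" using pos_inner_R d 3(1) by simp
    show ?thesis
    proof (cases b)
      case True
      then show ?thesis using d 3(4) O_darts by (intro image_eqI[of _ _ d]) (auto simp: h_def)
    next
      case False
      obtain e where e: "e \<in> darts N" "e \<notin> Out" "R e \<noteq> e" "d = R e" using inner_out_cases[OF d(1) ne] by metis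
      then show ?thesis using d 3(4) False strand_R_in pos_R by (intro image_eqI[of _ _ e]) (auto simp: h_def)
    qed
  qed
  then show ?thesis using h_inj h_in unfolding bij_betw_def by blast
qed

lemma h_rot:
  assumes "d \<in> darts N"
  shows "h (R d) = strand_rot n fs (h d)"
proof -
  interpret F: factor_strands n fs by (rule factor_strands)
  show ?thesis
  proof (cases "R d = d")
    case True
    then have "pos d = 0 \<or> pos d = Suc F.r" by (simp add: pos_def length_fs)
    then show ?thesis using True F.rot_end by (simp add: h_def)
  next
    case False
    note p = pos_inner[OF assms False]
    show ?thesis
    proof (cases "d \<in> Out")
      case True
      have "(strand d, pos d, True) \<in> F.D" using h_in[OF assms] True by (simp add: h_def)
      then have "strand_rot n fs (h d) = (turn (pos d) (strand d), pos d, False)"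
        using F.rot_out p factor_at_fs True by (simp add: h_def)
      then show ?thesis
        using turn_strand[OF True] pos_R[OF assms] R_O[OF assms False] True by (simp add: h_def)
    next
      case out: False
      have "(strand d, pos d, False) \<in> F.D" using h_in[OF assms] out by (simp add: h_def)
      then have "strand_rot n fs (h d) = (strand d, pos d, True)"
        using F.rot_in p out length_fs by (simp add: h_def)
      then show ?thesis
        using strand_R_in[OF assms out False] pos_R[OF assms] R_O[OF assms False] out by (simp add: h_def)
    qed
  qed
qed

text \<open>By \<open>same_strand_order\<close> no other out-dart of the strand starts strictly
  between the two ends of an edge, so the head of the edge is the next visit.\<close>

lemma h_opp_out:
  assumes d: "d \<in> Out"
  shows "h (J d) = strand_opp n fs (h d)"
proof -
  interpret F: factor_strands n fs by (rule factor_strands)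
  have D: "d \<in> darts N" "J d \<in> darts N" "J d \<notin> Out" using d O_darts J_darts J_O by auto
  have "next_visit fs (strand d) (pos d) = pos (J d)"
  proof (rule next_visit_eqI)
    show "pos d < pos (J d)" using pos_J[OF d] .
    show "visits fs (strand d) (pos (J d))"
      using h_in[OF D(2)] strand_J[OF D(1)] by (simp add: h_def strand_darts_def)
    fix s assume s: "pos d < s" "s < pos (J d)"
    show "\<not> visits fs (strand d) s"
    proof
      assume "visits fs (strand d) s"
      moreover have "0 < s" "s \<le> r" using s pos_le[OF D(2)] by auto
      ultimately obtain e where e: "e \<in> Out" "pos e = s" "strand e = strand d" using visits_inner by blast
      then have "pos (J d) \<le> pos e \<or> pos (J e) \<le> pos d"
        using same_strand_order[OF d e(1)] s by auto
      then show False using e s pos_J[OF e(1)] by auto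
    qed
  qed
  moreover have "(strand d, pos d, True) \<in> F.D" using h_in[OF D(1)] d by (simp add: h_def)
  ultimately show ?thesis using F.opp_out d D strand_J by (simp add: h_def)
qed

lemma h_opp:
  assumes d: "d \<in> darts N"
  shows "h (J d) = strand_opp n fs (h d)"
proof (cases "d \<in> Out")
  case True
  then show ?thesis by (rule h_opp_out)
next
  case False
  interpret F: factor_strands n fs by (rule factor_strands)
  have o: "J d \<in> Out" using J_O[OF d] False by simp
  have "h d = strand_opp n fs (h (J d))" using h_opp_out[OF o] JJ[OF d] by simp
  then show ?thesis using F.opp_opp[OF h_in[OF J_darts[OF d]]] by simp
qed

lemma map_hom_h: "map_hom h N (strand_map n cs fs)"
  unfolding map_hom_def strand_map_sel using h_bij h_rot h_opp h_in by (simp add: h_def)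

lemma h_source: "d \<in> Out \<Longrightarrow> R d = d \<Longrightarrow> h d = (lam d, 0, True)"
  using base_fix pos_eq_0[OF O_darts] by (simp add: h_def strand_def)

end

text \<open>The numbering \<open>lam\<close> of the sources is free, and the result records that
  \<open>h\<close> respects it; surjectivity uses this freedom with two different
  numberings.\<close>

lemma alternating_map_is_strand_map:
  fixes N :: "('d, 'z) dmap_scheme"
  assumes dN: "directed_map N" and "alternating N" and ac: "acyclic_map N"
    and "\<And>d. d \<in> darts N \<Longrightarrow> rot N d \<noteq> d \<Longrightarrow> 4 \<le> card (vertex_of N d)"
    and "1 \<le> n" and "bij_betw lam {d \<in> outs N. rot N d = d} {1..n}"
  obtains fs h where "factor_strands n fs" "\<And>cs. map_hom h N (strand_map n cs fs)"
    "\<And>d. d \<in> outs N \<Longrightarrow> rot N d = d \<Longrightarrow> h d = (lam d, 0, True)"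
proof -
  have fin: "finite (vertex_of N ` {d \<in> darts N. rot N d \<noteq> d})" using dN by (simp add: directed_map_def)
  from topological_list[OF fin ac[unfolded acyclic_map_def]]
  obtain vs where vs: "distinct vs" "set vs = vertex_of N ` {d \<in> darts N. rot N d \<noteq> d}"
    "\<forall>i<length vs. \<forall>j<length vs. (vs ! i, vs ! j) \<in> arc_rel N \<longrightarrow> i < j" by (elim exE conjE)
  interpret labelled_alternating_map N n lam vs
    by unfold_locales (fact assms vs vs(3)[rule_format])+
  show ?thesis using that[OF factor_strands map_hom_h h_source] .
qed

section \<open>The bijection between classes\<close>

lemma quotient_bij_betw:
  assumes r: "equiv UNIV r" and s: "equiv Y s"
    and F: "\<And>x. x \<in> X \<Longrightarrow> F x \<in> Y"
    and rel: "\<And>x x'. x \<in> X \<Longrightarrow> x' \<in> X \<Longrightarrow> (x, x') \<in> r \<longleftrightarrow> (F x, F x') \<in> s"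
    and surj: "\<And>y. y \<in> Y \<Longrightarrow> \<exists>x\<in>X. (y, F x) \<in> s"
  shows "\<exists>f. bij_betw f (X // r) (Y // s)"
proof -
  \<comment> \<open>A class of \<open>r\<close> may a priori leave \<open>X\<close>, where nothing
    is known about \<open>F\<close>; the representative is therefore chosen within
    \<open>X\<close>.\<close>
  define f where "f C = s `` {F (SOME x. x \<in> X \<and> x \<in> C)}" for C
  have f: "f (r `` {x}) = s `` {F x}" if x: "x \<in> X" for x
  proof -
    let ?y = "SOME y. y \<in> X \<and> y \<in> r `` {x}"
    have "x \<in> X \<and> x \<in> r `` {x}" using x r by (auto simp: equiv_def refl_on_def)
    then have y: "?y \<in> X \<and> ?y \<in> r `` {x}" by (rule someI)
    then have "(F x, F ?y) \<in> s" using rel x by auto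
    then have "s `` {F x} = s `` {F ?y}" by (rule equiv_class_eq[OF s])
    then show ?thesis unfolding f_def by (rule sym)
  qed
  have "bij_betw f (X // r) (Y // s)"
  proof (rule bij_betw_imageI)
    show "inj_on f (X // r)"
    proof (rule inj_onI)
      fix C D assume "C \<in> X // r" "D \<in> X // r" and eq: "f C = f D"
      then obtain x y where xy: "x \<in> X" "C = r `` {x}" "y \<in> X" "D = r `` {y}"
        by (auto elim!: quotientE)
      then have "s `` {F x} = s `` {F y}" using eq f by simp
      then have "(F x, F y) \<in> s" using eq_equiv_class[OF _ s F] xy by blast
      then have "(x, y) \<in> r" using rel xy by blast
      then show "C = D" unfolding xy using equiv_class_eq[OF r] by blast
    qed
    show "f ` (X // r) = Y // s"
    proof (intro equalityI subsetI)
      fix E assume "E \<in> f ` (X // r)"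
      then obtain x where "x \<in> X" "E = s `` {F x}" using f by (auto elim!: quotientE)
      then show "E \<in> Y // s" using F by (auto intro: quotientI)
    next
      fix E assume "E \<in> Y // s"
      then obtain y where y: "y \<in> Y" "E = s `` {y}" by (rule quotientE)
      then obtain x where x: "x \<in> X" "(y, F x) \<in> s" using surj by blast
      then have "E = f (r `` {x})" using f equiv_class_eq[OF s] y by metis
      then show "E \<in> f ` (X // r)" using x by (auto intro: quotientI)
    qed
  qed
  then show ?thesis by blast
qed

text \<open>The cycle type is only a multiset of lengths, so the cycles have to be arranged until
  their lengths read \<alpha>; any point of each cycle then serves.\<close>

lemma ex_base_points:
  assumes "cycle_type n \<pi> = mset \<alpha>"
  shows "\<exists>cs. base_points n \<pi> \<alpha> cs"
proof -
  let ?C = "perm_cycles n \<pi>"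
  have fin: "finite ?C" by (simp add: perm_cycles_def)
  obtain ys where ys: "mset ys = mset_set ?C" using ex_mset by blast
  have "mset (map card ys) = mset \<alpha>" using assms ys by (simp add: cycle_type_def)
  then obtain p where p: "p permutes {..<length (map card ys)}" "permute_list p (map card ys) = \<alpha>"
    using mset_eq_permutation by metis
  define xs where "xs = permute_list p ys"
  have mx: "mset xs = mset_set ?C" and len: "map card xs = \<alpha>"
    using p ys by (simp_all add: xs_def permute_list_map)
  have set: "set xs = ?C" using arg_cong[OF mx, of set_mset] fin by simp
  have "distinct xs"
    using mx set fin by (metis card_distinct mset_set_set size_mset size_mset_set)
  define cs where "cs = map (\<lambda>C. SOME a. a \<in> {1..n} \<and> orbit \<pi> a = C) xs"
  have rep: "(SOME a. a \<in> {1..n} \<and> orbit \<pi> a = C) \<in> {1..n} \<and>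
      orbit \<pi> (SOME a. a \<in> {1..n} \<and> orbit \<pi> a = C) = C" if "C \<in> set xs" for C
    by (rule someI_ex) (use that set in \<open>auto simp: perm_cycles_def\<close>)
  have orbs: "map (orbit \<pi>) cs = xs"
    unfolding cs_def by (rule nth_equalityI) (use rep in auto)
  have "length cs = length \<alpha>" using len cs_def by auto
  moreover have "set cs \<subseteq> {1..n}" using rep by (auto simp: cs_def)
  moreover have "orbit \<pi> ` set cs = ?C" using set arg_cong[OF orbs, of set] by simp
  moreover have "card (orbit \<pi> (cs ! i)) = \<alpha> ! i" if "i < length \<alpha>" for i
    using that orbs len by (metis length_map nth_map)
  ultimately show ?thesis
    unfolding base_points_def using \<open>distinct xs\<close> orbs by blast
qed

text \<open>The pairs of a label and an exponent modulo its part are coordinates on {1..n}. The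
  criterion depends on \<alpha> alone, which makes coordinates of different permutations
  comparable.\<close>

lemma base_points_funpow_eq:
  assumes b: "base_points n \<pi> \<alpha> cs" and p: "\<pi> permutes {1..n}" and ij: "i < length \<alpha>" "j < length \<alpha>"
  shows "(\<pi> ^^ k) (cs ! i) = (\<pi> ^^ l) (cs ! j) \<longleftrightarrow> i = j \<and> k mod \<alpha> ! i = l mod \<alpha> ! i"
proof -
  have fin: "finite {1..n}" by simp
  have len: "length cs = length \<alpha>" and d: "distinct (map (orbit \<pi>) cs)" using b by (auto simp: base_points_def)
  have "i = j" if "(\<pi> ^^ k) (cs ! i) = (\<pi> ^^ l) (cs ! j)"
  proof -
    have "orbit \<pi> (cs ! i) = orbit \<pi> (cs ! j)"
      using that funpow_in_orbit_self[OF p fin] permutes_orbit_eq[OF p fin] by metis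
    then show ?thesis using d ij len nth_eq_iff_index_eq[OF d] by simp
  qed
  then show ?thesis
    using funpow_eq_iff_card_orbit[OF p fin] b ij unfolding base_points_def by metis
qed

lemma base_points_cover:
  assumes b: "base_points n \<pi> \<alpha> cs" and p: "\<pi> permutes {1..n}" and x: "x \<in> {1..n}"
  obtains i k where "i < length \<alpha>" "x = (\<pi> ^^ k) (cs ! i)"
proof -
  have fin: "finite {1..n}" by simp
  have "orbit \<pi> x \<in> orbit \<pi> ` set cs" using b x by (auto simp: base_points_def perm_cycles_def)
  then obtain c where c: "c \<in> set cs" "orbit \<pi> x = orbit \<pi> c" by blast
  then have "x \<in> orbit \<pi> c" using permutes_self_in_orbit[OF p fin, of x] by simp
  then obtain k where "x = (\<pi> ^^ k) c" using permutes_orbit_iterate[OF p fin] by blast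
  moreover obtain i where "i < length \<alpha>" "c = cs ! i"
    using c b by (metis base_points_def in_set_conv_nth)
  ultimately show ?thesis using that by blast
qed

lemma base_points_in:
  assumes "base_points n \<pi> \<alpha> cs" "\<pi> permutes {1..n}" "i < length \<alpha>"
  shows "(\<pi> ^^ k) (cs ! i) \<in> {1..n}"
proof -
  have "cs ! i \<in> {1..n}" using assms unfolding base_points_def by (metis nth_mem subsetD)
  then show ?thesis using permutes_in_image[OF permutes_funpow[OF assms(2)]] by blast
qed

text \<open>\<theta> keeps the coordinates of a point and changes the permutation they refer to. It
  is well defined and injective because equal points obey the same criterion for \<tau> and for
  \<pi>.\<close>

lemma ex_conjugation:
  assumes b: "base_points n \<pi> \<alpha> cs" and p: "\<pi> permutes {1..n}"
    and b': "base_points n \<tau> \<alpha> cs'" and p': "\<tau> permutes {1..n}"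
  shows "\<exists>\<theta>. bij_betw \<theta> {1..n} {1..n} \<and> (\<forall>x\<in>{1..n}. \<theta> (\<tau> x) = \<pi> (\<theta> x)) \<and> map \<theta> cs' = cs"
proof -
  let ?P = "\<lambda>x y. \<exists>i k. i < length \<alpha> \<and> x = (\<tau> ^^ k) (cs' ! i) \<and> y = (\<pi> ^^ k) (cs ! i)"
  define \<theta> where "\<theta> x = (SOME y. ?P x y)" for x
  have \<theta>: "\<theta> ((\<tau> ^^ k) (cs' ! i)) = (\<pi> ^^ k) (cs ! i)" if i: "i < length \<alpha>" for i k
  proof -
    let ?x = "(\<tau> ^^ k) (cs' ! i)"
    have "?P ?x ((\<pi> ^^ k) (cs ! i))" using i by blast
    then have "?P ?x (\<theta> ?x)" unfolding \<theta>_def by (rule someI)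
    then obtain j l where j: "j < length \<alpha>" "?x = (\<tau> ^^ l) (cs' ! j)" "\<theta> ?x = (\<pi> ^^ l) (cs ! j)" by blast
    then have "i = j \<and> k mod \<alpha> ! i = l mod \<alpha> ! i"
      using base_points_funpow_eq[OF b' p' i j(1)] by blast
    then have "(\<pi> ^^ k) (cs ! i) = (\<pi> ^^ l) (cs ! j)"
      using base_points_funpow_eq[OF b p i j(1)] by blast
    then show ?thesis unfolding j(3) by (rule sym)
  qed
  have "bij_betw \<theta> {1..n} {1..n}"
  proof (rule bij_betw_imageI)
    show "inj_on \<theta> {1..n}"
    proof (rule inj_onI)
      fix x y assume "x \<in> {1..n}" "y \<in> {1..n}" and eq: "\<theta> x = \<theta> y"
      then obtain i k j l where i: "i < length \<alpha>" "x = (\<tau> ^^ k) (cs' ! i)"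
        and j: "j < length \<alpha>" "y = (\<tau> ^^ l) (cs' ! j)"
        using base_points_cover[OF b' p'] by metis
      then have "(\<pi> ^^ k) (cs ! i) = (\<pi> ^^ l) (cs ! j)" using eq \<theta> by simp
      then show "x = y"
        unfolding i(2) j(2) base_points_funpow_eq[OF b p i(1) j(1)] base_points_funpow_eq[OF b' p' i(1) j(1)] .
    qed
    show "\<theta> ` {1..n} = {1..n}"
    proof (intro equalityI subsetI)
      fix y assume "y \<in> \<theta> ` {1..n}"
      then obtain x where x: "x \<in> {1..n}" "y = \<theta> x" by blast
      obtain i k where "i < length \<alpha>" "x = (\<tau> ^^ k) (cs' ! i)" using base_points_cover[OF b' p' x(1)] .
      then show "y \<in> {1..n}" using x(2) \<theta> base_points_in[OF b p] by simp
    next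
      fix y assume y: "y \<in> {1..n}"
      obtain i k where i: "i < length \<alpha>" "y = (\<pi> ^^ k) (cs ! i)" using base_points_cover[OF b p y] .
      then have "y = \<theta> ((\<tau> ^^ k) (cs' ! i))" using \<theta> by simp
      then show "y \<in> \<theta> ` {1..n}" using base_points_in[OF b' p' i(1)] by blast
    qed
  qed
  moreover have "\<theta> (\<tau> x) = \<pi> (\<theta> x)" if x: "x \<in> {1..n}" for x
  proof -
    obtain i k where i: "i < length \<alpha>" "x = (\<tau> ^^ k) (cs' ! i)" using base_points_cover[OF b' p' x] .
    then have "\<tau> x = (\<tau> ^^ Suc k) (cs' ! i)" by simp
    then have "\<theta> (\<tau> x) = (\<pi> ^^ Suc k) (cs ! i)" using \<theta>[OF i(1)] by metis
    then show ?thesis using \<theta>[OF i(1)] i(2) by simp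
  qed
  moreover have "map \<theta> cs' = cs"
  proof (rule nth_equalityI)
    show "length (map \<theta> cs') = length cs" using b b' by (simp add: base_points_def)
    fix i assume "i < length (map \<theta> cs')"
    then show "map \<theta> cs' ! i = cs ! i" using \<theta>[of i 0] b' by (simp add: base_points_def)
  qed
  ultimately show ?thesis by blast
qed

lemma centralizer_fixing_base_points:
  assumes b: "base_points n \<pi> \<alpha> cs" and p: "\<pi> permutes {1..n}"
    and comm: "\<And>x. x \<in> {1..n} \<Longrightarrow> \<theta> (\<pi> x) = \<pi> (\<theta> x)" and fixed: "\<And>c. c \<in> set cs \<Longrightarrow> \<theta> c = c"
    and x: "x \<in> {1..n}"
  shows "\<theta> x = x"
proof -
  obtain i k where i: "i < length \<alpha>" "x = (\<pi> ^^ k) (cs ! i)" using base_points_cover[OF b p x] .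
  have "\<theta> ((\<pi> ^^ k) (cs ! i)) = (\<pi> ^^ k) (cs ! i)"
  proof (induction k)
    case 0
    have "cs ! i \<in> set cs" using i(1) b by (simp add: base_points_def)
    then show ?case using fixed by simp
  next
    case (Suc k)
    then show ?case using comm[OF base_points_in[OF b p i(1), of k]] by simp
  qed
  then show ?thesis using i(2) by simp
qed

section \<open>Sources and faces described by single darts\<close>

definition isomorphic :: "'d labelled_map \<Rightarrow> 'e labelled_map \<Rightarrow> bool" where
  "isomorphic M N \<longleftrightarrow> (\<exists>h. labelled_map_iso h M N)"

lemma isomorphic_sym: "correspondence_map m g \<alpha> \<beta> M \<Longrightarrow> isomorphic M N \<Longrightarrow> isomorphic N M"
  unfolding isomorphic_def using labelled_map_iso_sym by blast

lemma isomorphic_trans: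
  "correspondence_map m g \<alpha> \<beta> M \<Longrightarrow> isomorphic M N \<Longrightarrow> isomorphic N P \<Longrightarrow> isomorphic M P"
  unfolding isomorphic_def using labelled_map_iso_trans by blast

lemma strand_map_face_list:
  "face_list (strand_map n cs fs) =
     map (orbit (rot (strand_map n cs fs) \<circ> opp (strand_map n cs fs))) (map (\<lambda>c. (c, 0, True)) cs)"
  "distinguished (strand_map n cs fs) = map (\<lambda>d. {d}) (map (\<lambda>c. (c, 0, True)) cs)"
  by simp_all

lemma source_singleton:
  assumes "directed_map N" "alternating N" "v \<in> sources N"
  obtains d where "d \<in> outs N" "rot N d = d" "v = {d}"
proof -
  obtain d where d: "d \<in> darts N" "v = vertex_of N d" "v \<subseteq> outs N"
    using assms(3) by (auto simp: sources_def vertices_def)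
  have "d \<in> v" using vertex_of_self[OF assms(1) d(1)] d(2) by simp
  have "card v = 1" using alternating_one_sided_vertex_leaf[OF assms(1,2)] assms(3) by simp
  then have v: "v = {d}" using \<open>d \<in> v\<close> by (metis card_1_singletonE singletonD)
  then have "rot N d = d" using d(2) unfolding vertex_of_def by (metis orbit_eq_singleton_iff)
  then show ?thesis using that v \<open>d \<in> v\<close> d(3) by blast
qed

lemma sources_eq_singletons:
  assumes "directed_map N" "alternating N"
  shows "sources N = (\<lambda>d. {d}) ` {d \<in> outs N. rot N d = d}"
proof (intro equalityI subsetI)
  fix v assume "v \<in> sources N"
  then show "v \<in> (\<lambda>d. {d}) ` {d \<in> outs N. rot N d = d}"
    using source_singleton[OF assms] by blast
next
  fix v assume "v \<in> (\<lambda>d. {d}) ` {d \<in> outs N. rot N d = d}"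
  then obtain d where d: "d \<in> outs N" "rot N d = d" "v = {d}" by blast
  moreover have "d \<in> darts N" using assms(1) d by (auto simp: directed_map_def)
  moreover have "vertex_of N d = {d}" unfolding vertex_of_def orbit_eq_singleton_iff using d(2) .
  ultimately show "v \<in> sources N" by (auto simp: sources_def vertices_def)
qed

lemma faces_partition:
  assumes "directed_map N" "F \<in> faces N" "d \<in> F"
  shows "F = orbit (rot N \<circ> opp N) d" "d \<in> darts N"
proof -
  have p: "(rot N \<circ> opp N) permutes darts N" "finite (darts N)"
    using assms(1) by (auto simp: directed_map_def intro: permutes_compose)
  show "F = orbit (rot N \<circ> opp N) d"
    using assms(2,3) permutes_orbit_eq[OF p] unfolding faces_def by blast
  show "d \<in> darts N" using directed_map_cell_subsets(2)[OF assms(1,2)] assms(3) by blast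
qed

section \<open>Factorization classes and map classes for fixed base points\<close>

locale correspondence =
  fixes n m g :: nat and \<alpha> cs :: "nat list" and \<pi> \<beta> :: "nat \<Rightarrow> nat"
  assumes n_pos: "1 \<le> n" and comp: "composition \<alpha> m n"
    and \<pi>: "\<pi> permutes {1..n}" and base: "base_points n \<pi> \<alpha> cs"
begin

definition X :: "(nat \<Rightarrow> nat) list set" where
  "X = {fs. genus_factorization n g \<pi> fs \<and> (\<forall>k\<ge>2. signature n fs k = \<beta> k)}"

lemma length_\<alpha>: "length \<alpha> = m" and cs_in: "set cs \<subseteq> {1..n}"
  using comp base by (auto simp: composition_def base_points_def)

lemma factor_strands_iff:
  "factor_strands n fs \<and> foldr (\<circ>) fs id = \<pi> \<longleftrightarrow> cycle_factorization n \<pi> fs"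
  using n_pos by (auto simp: factor_strands_def cycle_factorization_def ex_is_k_cycle_iff)

lemma X_iff:
  "fs \<in> X \<longleftrightarrow> factor_strands n fs \<and> foldr (\<circ>) fs id = \<pi> \<and>
    correspondence_map m g \<alpha> \<beta> (strand_map n cs fs)"
proof -
  have "correspondence_map m g \<alpha> \<beta> (strand_map n cs fs) \<longleftrightarrow>
      transitive_factors n fs \<and>
      int (depth n fs) = int n + int (card (perm_cycles n \<pi>)) - 2 + 2 * int g \<and>
      (\<forall>k\<ge>2. signature n fs k = \<beta> k)"
    if "factor_strands n fs" "foldr (\<circ>) fs id = \<pi>"
    using factor_strands.correspondence_map_strand_map_iff[OF that(1) length_\<alpha> cs_in] that(2) base by simp
  then show ?thesis
    unfolding X_def genus_factorization_def factor_strands_iff[symmetric] by auto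
qed

lemma commutation_step_X:
  assumes "fs \<in> X" "(fs, fs') \<in> commutation_step"
  shows "fs' \<in> X" "isomorphic (strand_map n cs fs) (strand_map n cs fs')"
proof -
  show X': "fs' \<in> X" using assms genus_factorization_commute unfolding X_def by fastforce
  have A: "factor_strands n fs" and B: "factor_strands n fs'" using assms(1) X' X_iff by auto
  obtain h where h: "map_hom h (strand_map n cs fs) (strand_map n cs fs')" "\<And>a. h (a, 0, True) = (a, 0, True)"
    using commutation_step_map_hom[OF A B assms(2)] by blast
  have "directed_map (strand_map n cs fs)" using assms(1) X_iff by (simp add: correspondence_map_def)
  then have "labelled_map_iso h (strand_map n cs fs) (strand_map n cs fs')"
    using h(1) trivial_off_darts_strand_map
    by (intro map_hom_imp_labelled_map_iso[where cs = "map (\<lambda>c. (c, 0, True)) cs"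
          and cs' = "map (\<lambda>c. (c, 0, True)) cs"])
       (use cs_in h(2) factor_strands.source_in[OF A] in auto)
  then show "isomorphic (strand_map n cs fs) (strand_map n cs fs')" unfolding isomorphic_def by blast
qed

lemma isomorphic_if_commutation_equiv:
  assumes "(fs, fs') \<in> commutation_equiv" "fs \<in> X"
  shows "fs' \<in> X \<and> isomorphic (strand_map n cs fs) (strand_map n cs fs')"
  using assms unfolding commutation_equiv_def
proof (induction rule: rtrancl_induct)
  case base
  have "labelled_map_iso id (strand_map n cs fs) (strand_map n cs fs)" by (simp add: labelled_map_iso_def)
  then show ?case using base by (auto simp: isomorphic_def)
next
  case (step fs' gs)
  then have "fs' \<in> X" "isomorphic (strand_map n cs fs) (strand_map n cs fs')" by auto
  then show ?case
    using commutation_step_X[OF _ step(2)] isomorphic_trans X_iff step.prems by blast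
qed

lemma commutation_equiv_if_isomorphic:
  assumes fs: "fs \<in> X" and fs': "fs' \<in> X"
    and iso: "isomorphic (strand_map n cs fs) (strand_map n cs fs')"
  shows "(fs, fs') \<in> commutation_equiv"
proof -
  obtain h where h: "labelled_map_iso h (strand_map n cs fs) (strand_map n cs fs')"
    using iso by (auto simp: isomorphic_def)
  interpret strand_map_hom n fs fs' h cs cs
    using fs fs' h by (simp add: X_iff strand_map_hom_def strand_map_hom_axioms_def labelled_map_iso_iff)
  have "map ((`) h) (map (\<lambda>c. {(c, 0, True)}) cs) = map (\<lambda>c. {(c, 0, True)}) cs"
    using h by (simp add: labelled_map_iso_iff)
  from this[unfolded map_map map_eq_conv]
  have "h (c, 0, True) = (c, 0, True)" if "c \<in> set cs" for c
    using that by simp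
  then have "\<theta> c = c" if "c \<in> set cs" for c using that by (simp add: \<theta>_def)
  moreover have "\<theta> (\<pi> x) = \<pi> (\<theta> x)" if "x \<in> {1..n}" for x
    using \<theta>_pi[OF that] fs fs' by (simp add: X_iff)
  ultimately have "\<theta> a = a" if "a \<in> {1..n}" for a
    using centralizer_fixing_base_points[OF base \<pi> _ _ that] by blast
  then show ?thesis by (rule commutation_equiv)
qed

text \<open>A source is a leaf, so its single dart lies in exactly one face; the counts per face are
  the parts of \<alpha>, which add up to n.\<close>

lemma card_source_darts:
  assumes N: "correspondence_map m g \<alpha> \<beta> N"
  shows "card {d \<in> outs N. rot N d = d} = n"
proof -
  let ?S = "{d \<in> outs N. rot N d = d}"
  note N = N[unfolded correspondence_map_def]
  have dN: "directed_map N" and alt: "alternating N" using N by auto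
  have fin: "finite ?S" using dN finite_subset[of ?S "darts N"] by (auto simp: directed_map_def)
  let ?A = "\<lambda>i. {d \<in> ?S. d \<in> face_list N ! i}"
  have len: "length (face_list N) = m" and dist: "distinct (face_list N)"
    and faces: "set (face_list N) = faces N" using N by auto
  have "card (?A i) = \<alpha> ! i" if "i < m" for i
  proof -
    have "{v \<in> sources N. contained_in_face v (face_list N ! i)} = (\<lambda>d. {d}) ` ?A i"
      unfolding sources_eq_singletons[OF dN alt] contained_in_face_def by auto
    moreover have "card ((\<lambda>d. {d}) ` ?A i) = card (?A i)" by (rule card_image) (simp add: inj_on_def)
    moreover have "card {v \<in> sources N. contained_in_face v (face_list N ! i)} = \<alpha> ! i"
      using N that by blast
    ultimately show ?thesis by simp
  qed
  then have "(\<Sum>i<m. card (?A i)) = (\<Sum>i<m. \<alpha> ! i)" by simp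
  also have "\<dots> = n"
    using comp by (auto simp: composition_def sum_list_sum_nth atLeast0LessThan)
  finally have "(\<Sum>i<m. card (?A i)) = n" .
  moreover have "card (\<Union>i<m. ?A i) = (\<Sum>i<m. card (?A i))"
  proof (rule card_UN_disjoint)
    show "\<forall>i\<in>{..<m}. finite (?A i)" by (intro ballI finite_subset[OF _ fin]) blast
    show "\<forall>i\<in>{..<m}. \<forall>j\<in>{..<m}. i \<noteq> j \<longrightarrow> ?A i \<inter> ?A j = {}"
    proof (intro ballI impI)
      fix i j assume ij: "i \<in> {..<m}" "j \<in> {..<m}" "i \<noteq> j"
      show "?A i \<inter> ?A j = {}"
      proof (rule ccontr)
        assume "?A i \<inter> ?A j \<noteq> {}"
        then obtain d where d: "d \<in> face_list N ! i" "d \<in> face_list N ! j" by blast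
        have "face_list N ! i \<in> faces N" "face_list N ! j \<in> faces N"
          using ij len unfolding faces[symmetric] by auto
        then have "face_list N ! i = face_list N ! j" using faces_partition(1)[OF dN] d by metis
        then show False using ij len nth_eq_iff_index_eq[OF dist] by auto
      qed
    qed
  qed simp
  moreover have "(\<Union>i<m. ?A i) = ?S"
  proof (intro equalityI subsetI)
    fix d assume d: "d \<in> ?S"
    then have "d \<in> darts N" using dN by (auto simp: directed_map_def)
    then have "orbit (rot N \<circ> opp N) d \<in> faces N" by (auto simp: faces_def)
    then obtain i where i: "i < m" "face_list N ! i = orbit (rot N \<circ> opp N) d"
      using len unfolding faces[symmetric] in_set_conv_nth by blast
    have "(rot N \<circ> opp N) permutes darts N" "finite (darts N)"
      using dN by (auto simp: directed_map_def intro: permutes_compose)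
    then have "d \<in> face_list N ! i" unfolding i(2) by (rule permutes_self_in_orbit)
    then show "d \<in> (\<Union>i<m. ?A i)" using i d by blast
  qed blast
  ultimately show ?thesis by simp
qed

text \<open>The dart of a distinguished source determines its face, as faces partition the darts.
  Labels and distinguished sources thus reduce to one list of source darts.\<close>

lemma ex_base_darts:
  assumes N: "correspondence_map m g \<alpha> \<beta> N"
  obtains ds where "length ds = m" "set ds \<subseteq> {d \<in> outs N. rot N d = d}"
    "face_list N = map (orbit (rot N \<circ> opp N)) ds" "distinguished N = map (\<lambda>d. {d}) ds"
proof -
  note N = N[unfolded correspondence_map_def]
  have dN: "directed_map N" and alt: "alternating N" using N by auto
  have len: "length (face_list N) = m" "length (distinguished N) = m"
    and faces: "set (face_list N) = faces N" using N by auto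
  have d: "\<exists>d. d \<in> outs N \<and> rot N d = d \<and> distinguished N ! i = {d} \<and>
      face_list N ! i = orbit (rot N \<circ> opp N) d" if i: "i < m" for i
  proof -
    have "distinguished N ! i \<in> sources N" using N i by blast
    then obtain d where d: "d \<in> outs N" "rot N d = d" "distinguished N ! i = {d}"
      by (rule source_singleton[OF dN alt])
    have "face_list N ! i \<in> faces N" using i len unfolding faces[symmetric] by auto
    moreover have "contained_in_face (distinguished N ! i) (face_list N ! i)" using N i by blast
    then have "contained_in_face {d} (face_list N ! i)" unfolding d(3) .
    ultimately have "face_list N ! i = orbit (rot N \<circ> opp N) d"
      using faces_partition(1)[OF dN, of _ d] by (simp add: contained_in_face_def)
    then show ?thesis using d by blast
  qed
  then obtain f where f: "\<And>i. i < m \<Longrightarrow> f i \<in> outs N \<and> rot N (f i) = f i \<and> distinguished N ! i = {f i} \<and>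
      face_list N ! i = orbit (rot N \<circ> opp N) (f i)" by metis
  show ?thesis
  proof (rule that[of "map f [0..<m]"])
    show "face_list N = map (orbit (rot N \<circ> opp N)) (map f [0..<m])"
      by (rule nth_equalityI) (use f len in auto)
    show "distinguished N = map (\<lambda>d. {d}) (map f [0..<m])"
      by (rule nth_equalityI) (use f len in auto)
  qed (use f in auto)
qed

lemma ex_strand_map_iso:
  assumes N: "correspondence_map m g \<alpha> \<beta> N" and lam: "bij_betw lam {d \<in> outs N. rot N d = d} {1..n}"
    and ds: "set ds \<subseteq> {d \<in> outs N. rot N d = d}"
      "face_list N = map (orbit (rot N \<circ> opp N)) ds" "distinguished N = map (\<lambda>d. {d}) ds"
  obtains fs h where "factor_strands n fs" "labelled_map_iso h N (strand_map n (map lam ds) fs)"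
    "correspondence_map m g \<alpha> \<beta> (strand_map n (map lam ds) fs)"
    "\<forall>d\<in>{d \<in> outs N. rot N d = d}. h d = (lam d, 0, True)"
proof -
  note N' = N[unfolded correspondence_map_def]
  have dN: "directed_map N" and alt: "alternating N" and ac: "acyclic_map N" using N' by auto
  have deg: "4 \<le> card (vertex_of N d)" if d: "d \<in> darts N" "rot N d \<noteq> d" for d
  proof -
    have v: "vertex_of N d \<in> vertices N" using d by (auto simp: vertices_def)
    have "vertex_of N d \<notin> sources N \<union> sinks N"
    proof
      assume "vertex_of N d \<in> sources N \<union> sinks N"
      then have "card (vertex_of N d) = 1" by (rule alternating_one_sided_vertex_leaf[OF dN alt])
      then have "vertex_of N d = {d}"
        using vertex_of_self[OF dN d(1)] by (metis card_1_singletonE singletonD)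
      then show False using d(2) unfolding vertex_of_def by (metis orbit_eq_singleton_iff)
    qed
    then show ?thesis using N' v by blast
  qed
  obtain fs h where fs: "factor_strands n fs" and hom: "\<And>cs. map_hom h N (strand_map n cs fs)"
    and h: "\<And>d. d \<in> outs N \<Longrightarrow> rot N d = d \<Longrightarrow> h d = (lam d, 0, True)"
    using alternating_map_is_strand_map[OF dN alt ac deg n_pos lam] by metis
  have "labelled_map_iso h N (strand_map n (map lam ds) fs)"
  proof (rule map_hom_imp_labelled_map_iso[OF hom dN trivial_off_darts_strand_map _ _ ds(2,3) strand_map_face_list])
    show "set ds \<subseteq> darts N" using ds(1) dN by (auto simp: directed_map_def)
    show "map h ds = map (\<lambda>c. (c, 0, True)) (map lam ds)" using ds(1) h by auto
  qed
  then show ?thesis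
    using that fs h correspondence_map_transport[OF N _ trivial_off_darts_strand_map] by blast
qed

text \<open>An arbitrary numbering of the sources gives a word with a product \<tau> that also has
  base points for \<alpha>; correcting the numbering turns \<tau> into \<pi> and the base points
  into \<open>cs\<close>.\<close>

lemma ex_factorization:
  assumes N: "correspondence_map m g \<alpha> \<beta> N"
  shows "\<exists>fs\<in>X. isomorphic N (strand_map n cs fs)"
proof -
  let ?S = "{d \<in> outs N. rot N d = d}"
  have "finite ?S"
    using N finite_subset[of ?S "darts N"] by (auto simp: correspondence_map_def directed_map_def)
  then obtain lam where lam: "bij_betw lam ?S {1..n}"
    using finite_same_card_bij[of ?S "{1..n}"] card_source_darts[OF N] by auto
  obtain ds where ds: "length ds = m" "set ds \<subseteq> ?S"
    "face_list N = map (orbit (rot N \<circ> opp N)) ds" "distinguished N = map (\<lambda>d. {d}) ds"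
    using ex_base_darts[OF N] .
  obtain gs k where gs: "factor_strands n gs" "labelled_map_iso k N (strand_map n (map lam ds) gs)"
    "correspondence_map m g \<alpha> \<beta> (strand_map n (map lam ds) gs)"
    and k: "\<forall>d\<in>?S. k d = (lam d, 0, True)"
    by (rule ex_strand_map_iso[OF N lam ds(2-4)])
  let ?\<tau> = "foldr (\<circ>) gs id"
  have \<tau>: "?\<tau> permutes {1..n}" using factor_strands.pi_permutes[OF gs(1)] .
  have in_n: "set (map lam' ds) \<subseteq> {1..n}" if "bij_betw lam' ?S {1..n}" for lam'
    using that ds(2) by (auto simp: bij_betw_def)
  have "base_points n ?\<tau> \<alpha> (map lam ds)"
    using factor_strands.correspondence_map_strand_map_iff[OF gs(1) length_\<alpha> in_n[OF lam]] gs(3) by blast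
  then obtain \<theta> where \<theta>: "bij_betw \<theta> {1..n} {1..n}" "\<forall>x\<in>{1..n}. \<theta> (?\<tau> x) = \<pi> (\<theta> x)"
    "map \<theta> (map lam ds) = cs"
    using ex_conjugation[OF base \<pi> _ \<tau>] by blast
  have lam': "bij_betw (\<theta> \<circ> lam) ?S {1..n}" using bij_betw_trans[OF lam \<theta>(1)] .
  have cs: "map (\<theta> \<circ> lam) ds = cs" using \<theta>(3) by simp
  \<comment> \<open>Extraction is repeated with the corrected numbering. The new word may come from
    another topological order, so it is not compared with \<open>gs\<close> letter by
    letter.\<close>
  obtain fs h where fs: "factor_strands n fs" "labelled_map_iso h N (strand_map n cs fs)"
    "correspondence_map m g \<alpha> \<beta> (strand_map n cs fs)"
    and h: "\<forall>d\<in>?S. h d = ((\<theta> \<circ> lam) d, 0, True)"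
    by (rule ex_strand_map_iso[OF N lam' ds(2-4), unfolded cs])
  have dk: "bij_betw k (darts N) (strand_darts n gs)" using gs(2) by (simp add: labelled_map_iso_def)
  let ?k' = "inv_into (darts N) k"
  have "labelled_map_iso (h \<circ> ?k') (strand_map n (map lam ds) gs) (strand_map n cs fs)"
    using labelled_map_iso_trans[OF gs(3) labelled_map_iso_sym[OF N gs(2)] fs(2)] .
  then have hom: "map_hom (h \<circ> ?k') (strand_map n (map lam ds) gs) (strand_map n cs fs)"
    by (simp add: labelled_map_iso_iff)
  \<comment> \<open>Both words describe \<open>N\<close>, so their strand maps are isomorphic, and
    the induced map on strands is \<theta> by the two numberings. It intertwines \<tau> with the new
    product and, by choice, \<tau> with \<pi>.\<close>
  interpret Q: strand_map_hom n gs fs "h \<circ> ?k'" "map lam ds" cs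
    using gs(1) fs(1) hom by (simp add: strand_map_hom_def strand_map_hom_axioms_def)
  have Q\<theta>: "Q.\<theta> a = \<theta> a" if "a \<in> {1..n}" for a
  proof -
    have "a \<in> lam ` ?S" using that lam by (simp add: bij_betw_def)
    then obtain d where d: "d \<in> outs N" "rot N d = d" "lam d = a" by blast
    have "d \<in> darts N" using N d(1) by (auto simp: correspondence_map_def directed_map_def)
    moreover have "k d = (a, 0, True)" using k d by simp
    ultimately have "?k' (a, 0, True) = d" using bij_betw_inv_into_left[OF dk] by metis
    then show ?thesis using h d by (simp add: Q.\<theta>_def)
  qed
  have "foldr (\<circ>) fs id = \<pi>"
  proof
    fix y
    have perm: "foldr (\<circ>) fs id permutes {1..n}" using factor_strands.pi_permutes[OF fs(1)] .
    show "foldr (\<circ>) fs id y = \<pi> y"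
    proof (cases "y \<in> {1..n}")
      case True
      then have "y \<in> \<theta> ` {1..n}" using \<theta>(1) by (simp add: bij_betw_def)
      then obtain x where x: "x \<in> {1..n}" "y = \<theta> x" by blast
      have "?\<tau> x \<in> {1..n}" using permutes_in_image[OF \<tau>] x(1) by blast
      then have "\<theta> (?\<tau> x) = foldr (\<circ>) fs id (\<theta> x)"
        using Q.\<theta>_pi[OF x(1)] Q\<theta> x(1) by simp
      then show ?thesis using \<theta>(2) x by metis
    next
      case False
      then show ?thesis using permutes_not_in[OF perm] permutes_not_in[OF \<pi>] by simp
    qed
  qed
  then have "fs \<in> X" using fs X_iff by simp
  then show ?thesis using fs(2) unfolding isomorphic_def by blast
qed

text \<open>Map classes are formed over darts in \<open>nat\<close>, so the triples of the strand
  map are encoded by an injection; its choice does not affect the isomorphism class.\<close>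

definition nat_map :: "(nat \<Rightarrow> nat) list \<Rightarrow> nat labelled_map" where
  "nat_map fs = relabel to_nat (strand_map n cs fs)"

lemma nat_map_iso: "isomorphic (strand_map n cs fs) (nat_map fs)"
  unfolding isomorphic_def nat_map_def using relabel_iso[of to_nat] by auto

lemma nat_map_correspondence:
  assumes "fs \<in> X"
  shows "correspondence_map m g \<alpha> \<beta> (nat_map fs)"
proof (rule correspondence_map_transport)
  show "correspondence_map m g \<alpha> \<beta> (strand_map n cs fs)" using assms X_iff by blast
  show "labelled_map_iso to_nat (strand_map n cs fs) (nat_map fs)"
    unfolding nat_map_def by (rule relabel_iso) simp
  show "trivial_off_darts (nat_map fs)"
    unfolding nat_map_def by (rule relabel_trivial_off_darts) auto
qed

lemma bijection:
  "\<exists>f. bij_betw f (X // commutation_equiv) (correspondence_map_classes m g \<alpha> \<beta>)"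
  unfolding correspondence_map_classes_def
proof (rule quotient_bij_betw[OF equiv_commutation_equiv equiv_labelled_map_iso_rel])
  let ?Y = "correspondence_maps m g \<alpha> \<beta>"
  have rel: "(M, N) \<in> labelled_map_iso_rel ?Y \<longleftrightarrow>
      correspondence_map m g \<alpha> \<beta> M \<and> correspondence_map m g \<alpha> \<beta> N \<and> isomorphic M N" for M N
    by (simp add: labelled_map_iso_rel_def correspondence_maps_def isomorphic_def)
  show "nat_map fs \<in> ?Y" if "fs \<in> X" for fs
    using nat_map_correspondence[OF that] by (simp add: correspondence_maps_def)
  have X: "correspondence_map m g \<alpha> \<beta> (strand_map n cs fs)" if "fs \<in> X" for fs
    using that X_iff by blast
  show "(fs, fs') \<in> commutation_equiv \<longleftrightarrow> (nat_map fs, nat_map fs') \<in> labelled_map_iso_rel ?Y"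
    if fs: "fs \<in> X" and fs': "fs' \<in> X" for fs fs'
  proof
    assume "(fs, fs') \<in> commutation_equiv"
    then have "isomorphic (strand_map n cs fs) (strand_map n cs fs')"
      using isomorphic_if_commutation_equiv fs by blast
    then have "isomorphic (strand_map n cs fs) (nat_map fs')"
      using isomorphic_trans[OF X[OF fs]] nat_map_iso by blast
    moreover have "isomorphic (nat_map fs) (strand_map n cs fs)"
      using isomorphic_sym[OF X[OF fs] nat_map_iso] .
    ultimately have "isomorphic (nat_map fs) (nat_map fs')"
      using isomorphic_trans[OF nat_map_correspondence[OF fs]] by blast
    then show "(nat_map fs, nat_map fs') \<in> labelled_map_iso_rel ?Y"
      unfolding rel using nat_map_correspondence fs fs' by blast
  next
    assume "(nat_map fs, nat_map fs') \<in> labelled_map_iso_rel ?Y"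
    then have "isomorphic (nat_map fs) (nat_map fs')" unfolding rel by blast
    then have "isomorphic (strand_map n cs fs) (nat_map fs')"
      using isomorphic_trans[OF X[OF fs] nat_map_iso] by blast
    moreover have "isomorphic (nat_map fs') (strand_map n cs fs')"
      using isomorphic_sym[OF X[OF fs'] nat_map_iso] .
    ultimately have "isomorphic (strand_map n cs fs) (strand_map n cs fs')"
      using isomorphic_trans[OF X[OF fs]] by blast
    then show "(fs, fs') \<in> commutation_equiv" by (rule commutation_equiv_if_isomorphic[OF fs fs'])
  qed
  show "\<exists>fs\<in>X. (N, nat_map fs) \<in> labelled_map_iso_rel ?Y" if "N \<in> ?Y" for N
  proof -
    have N: "correspondence_map m g \<alpha> \<beta> N" using that by (simp add: correspondence_maps_def)
    obtain fs where fs: "fs \<in> X" "isomorphic N (strand_map n cs fs)" using ex_factorization[OF N] by blast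
    then have "isomorphic N (nat_map fs)" using isomorphic_trans[OF N] nat_map_iso by blast
    then show ?thesis unfolding rel using N fs(1) nat_map_correspondence by blast
  qed
qed

end

theorem theorem2p3:
  fixes n m g :: nat
    and \<alpha> :: "nat list"
    and \<pi> :: "nat \<Rightarrow> nat"
    and \<beta> :: "nat \<Rightarrow> nat"
  assumes "1 \<le> n"
    and "composition \<alpha> m n"
    and "\<pi> permutes {1..n}"
    and "cycle_type n \<pi> = mset \<alpha>"
    and "finite {k. 2 \<le> k \<and> \<beta> k \<noteq> 0}"
  shows "\<exists>f. bij_betw f (inequivalent_factorizations n g \<pi> \<beta>)
                         (correspondence_map_classes m g \<alpha> \<beta>)"
proof -
  obtain cs where "base_points n \<pi> \<alpha> cs" using ex_base_points[OF assms(4)] by blast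
  then interpret correspondence n m g \<alpha> cs \<pi> \<beta> using assms by unfold_locales
  show ?thesis using bijection unfolding inequivalent_factorizations_def X_def .
qed

end
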